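(* Assume $\mathbb E[|Y|^2]+\mathbb E[|X|^8]<\infty$ and that the kernel function is rotationally invariant, $K(x)=\mathcal K(|x|_V^2)$, where $\mathcal K',\mathcal K'':\mathbb R_{\ge0}\to\mathbb R$ are bounded continuous functions and $r\mathcal K'(r)$ is bounded for large $r$. Suppose further that $X$ is a continuous random variable. Let $\Sigma(t)$, $t\ge0$, be a solution in $\mathrm{Sym}^2_{\ge0}$ of the Riemannian gradient flow $$\frac{d\Sigma_{ab}}{dt}=-\frac12\left(\Sigma_{ac}C_{bd}(D\mathcal J(\Sigma;\lambda))^{cd}+\Sigma_{bd}C_{ac}(D\mathcal J(\Sigma;\lambda))^{cd}\right).$$ Then there is a sequence of times $t_i\to+\infty$ such that $\Sigma(t_i)$ converges to some $\Sigma_0\in\mathrm{Sym}^2_{\ge0}$ which is a stationary point.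
   Context: $V$ is a real $d$-dimensional vector space with dual $V^*$, and $\lambda>0$ is fixed. $X$ is a $V$-valued random variable and $Y$ a complex-valued random variable. "Continuous random variable" means that the law of $X$ has a density with respect to Lebesgue measure on $V$. The covariance $\mathrm{Cov}(X)(\omega,\omega)=\mathbb E[\langle\omega,X-\mathbb E[X]\rangle^2]$ is an inner product on $V^*$, with matrix $C^{ij}$; the inverse matrix $C_{ij}$ defines the inner product $|\cdot|_V^2=(\cdot,\cdot)_V$ on $V$. Adjoints $U^T$ are taken with respect to $(\cdot,\cdot)_V$. Summation over repeated indices is understood. Kernel: $k_V:V^*\to(0,\infty)$ is rotationally invariant, i.e. a function of the dual norm $|\omega|_V^2$, with $\int_{V^*}k_V\,d\omega=1$, and $K(x)=\int_{V^*}e^{2\pi i\langle x,\omega\rangle}k_V(\omega)d\omega$. $\mathcal H$ is the Hilbert space of functions $f(x)=\int_{V^*}\hat f(\omega)e^{2\pi i\langle\omega,x\rangle}d\omega$ on $V$ with $\|f\|_{\mathcal H}^2=\int_{V^*}|\hat f|^2/k_V\,d\omega<\infty$. For $U\in\mathrm{End}(V)$: $J(U,\lambda)=\inf_{f\in\mathcal H}\{\frac12\mathbb E[|Y-f(UX)|^2]+\frac\lambda2\|f\|_{\mathcal H}^2\}$. $\mathrm{Sym}^2_+\subset \mathrm{Sym}^2V^*$ is the open set of positive definite inner products on $V$; $\mathcal S_l$ ($0\le l\le d-1$) is the manifold of positive semi-definite forms on $V$ of rank $l$; $\mathrm{Sym}^2_{\ge0}=\mathrm{Sym}^2_+\cup\bigcup_{l\le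 d-1}\mathcal S_l$. For $\Sigma\in\mathrm{Sym}^2_{\ge0}$, $\mathcal J(\Sigma;\lambda):=J(U,\lambda)$ for any $U$ with $|x|_\Sigma^2=|Ux|_V^2$, i.e. $\Sigma=U^TU$ (by rotational invariance this depends only on $\Sigma$). Known background (under the hypotheses of the claim, not needing continuity of $X$): $\mathcal J$ is $C^1$ on $\mathrm{Sym}^2_{\ge0}$, meaning there is a continuous $D\mathcal J:\mathrm{Sym}^2_{\ge0}\to\mathrm{Sym}^2V$ with $\mathcal J(\Sigma';\lambda)=\mathcal J(\Sigma;\lambda)+\langle D\mathcal J(\Sigma;\lambda),\Sigma'-\Sigma\rangle+o(|\Sigma'-\Sigma|)$ for $\Sigma,\Sigma'\in\mathrm{Sym}^2_{\ge0}$; moreover $D\mathcal J$ extends to a Lipschitz function on $\mathrm{Sym}^2V^*$. The flow in the claim exists for all $t\ge0$ and preserves $\mathrm{Sym}^2_{\ge0}$. Stationary point: $\Sigma_0\in\mathcal S_l$ is stationary if $D\mathcal J(\Sigma_0;\lambda)$ vanishes on the tangent space of the manifold $\mathcal S_l$ at $\Sigma_0$; $\Sigma_0\in\mathrm{Sym}^2_+$ is stationary if $D\mathcal J(\Sigma_0;\lambda)=0$. *)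

theory Defs
  imports "HOL-Probability.Probability"
begin

text \<open>
  V and its dual are both coordinatised as \<^typ>\<open>real ^ 'n\<close> (dual bases), so that the duality
  pairing is the standard inner product.  Bilinear forms on V and on its dual are matrices, and
  the pairing between them, the sum of D a b times S a b over all a, b, is the inner product of
  \<^typ>\<open>real ^ 'n ^ 'n\<close>.
\<close>

definition qform :: "real ^ 'n ^ 'n \<Rightarrow> real ^ 'n \<Rightarrow> real" where
  "qform S x = x \<bullet> (S *v x)"

definition cov_matrix :: "'a measure \<Rightarrow> ('a \<Rightarrow> real ^ 'n) \<Rightarrow> real ^ 'n ^ 'n" where
  "cov_matrix M X = (\<chi> i j. LINT s|M.
     (X s $ i - (LINT r|M. X r $ i)) * (X s $ j - (LINT r|M. X r $ j)))"

definition V_normsq :: "'a measure \<Rightarrow> ('a \<Rightarrow> real ^ 'n) \<Rightarrow> real ^ 'n \<Rightarrow> real" where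
  "V_normsq M X x = qform (matrix_inv (cov_matrix M X)) x"

definition V_dual_normsq :: "'a measure \<Rightarrow> ('a \<Rightarrow> real ^ 'n) \<Rightarrow> real ^ 'n \<Rightarrow> real" where
  "V_dual_normsq M X w = qform (cov_matrix M X) w"

definition kernel_fun :: "(real ^ 'n \<Rightarrow> real) \<Rightarrow> real ^ 'n \<Rightarrow> complex" where
  "kernel_fun k x = (LINT w|lborel. exp (2 * of_real pi * \<i> * of_real (x \<bullet> w)) * of_real (k w))"

text \<open>
  \<open>rkhs_rep k fh f\<close>: the function f lies in the Hilbert space H with Fourier transform fh, and
  its squared H-norm is \<open>rkhs_normsq k fh\<close>.  Note that fh is integrable by Cauchy-Schwarz, since
  the weight k has integral 1, and is determined by f almost everywhere.
\<close>

definition rkhs_normsq :: "(real ^ 'n \<Rightarrow> real) \<Rightarrow> (real ^ 'n \<Rightarrow> complex) \<Rightarrow> real" where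
  "rkhs_normsq k fh = (LINT w|lborel. (cmod (fh w))\<^sup>2 / k w)"

definition rkhs_rep ::
  "(real ^ 'n \<Rightarrow> real) \<Rightarrow> (real ^ 'n \<Rightarrow> complex) \<Rightarrow> (real ^ 'n \<Rightarrow> complex) \<Rightarrow> bool" where
  "rkhs_rep k fh f \<longleftrightarrow>
     fh \<in> borel_measurable lborel \<and>
     integrable lborel (\<lambda>w. (cmod (fh w))\<^sup>2 / k w) \<and>
     (\<forall>x. f x = (LINT w|lborel. fh w * exp (2 * of_real pi * \<i> * of_real (w \<bullet> x))))"

definition J_fun ::
  "'a measure \<Rightarrow> ('a \<Rightarrow> real ^ 'n) \<Rightarrow> ('a \<Rightarrow> complex) \<Rightarrow> (real ^ 'n \<Rightarrow> real) \<Rightarrow> real \<Rightarrow>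
   real ^ 'n ^ 'n \<Rightarrow> real" where
  "J_fun M X Y k lam U =
     Inf {1/2 * (LINT s|M. (cmod (Y s - f (U *v X s)))\<^sup>2) + lam/2 * rkhs_normsq k fh | f fh.
          rkhs_rep k fh f}"

definition Sym_pos :: "(real ^ 'n ^ 'n) set" where
  "Sym_pos = {S. transpose S = S \<and> (\<forall>x. x \<noteq> 0 \<longrightarrow> 0 < qform S x)}"

definition Sym_nonneg :: "(real ^ 'n ^ 'n) set" where
  "Sym_nonneg = {S. transpose S = S \<and> (\<forall>x. 0 \<le> qform S x)}"

definition Sym_stratum :: "nat \<Rightarrow> (real ^ 'n ^ 'n) set" where
  "Sym_stratum l = {S \<in> Sym_nonneg. rank S = l}"

text \<open>Rotational invariance of k makes the value below independent of the choice of U.\<close>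

definition calJ ::
  "'a measure \<Rightarrow> ('a \<Rightarrow> real ^ 'n) \<Rightarrow> ('a \<Rightarrow> complex) \<Rightarrow> (real ^ 'n \<Rightarrow> real) \<Rightarrow> real \<Rightarrow>
   real ^ 'n ^ 'n \<Rightarrow> real" where
  "calJ M X Y k lam S = J_fun M X Y k lam (SOME U. \<forall>x. qform S x = V_normsq M X (U *v x))"

text \<open>
  The first-order expansion is only required along \<^const>\<open>Sym_nonneg\<close>; the symmetric matrix D is
  nevertheless unique, because this convex cone spans the symmetric matrices.
\<close>

definition DJ ::
  "'a measure \<Rightarrow> ('a \<Rightarrow> real ^ 'n) \<Rightarrow> ('a \<Rightarrow> complex) \<Rightarrow> (real ^ 'n \<Rightarrow> real) \<Rightarrow> real \<Rightarrow>
   real ^ 'n ^ 'n \<Rightarrow> real ^ 'n ^ 'n" where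
  "DJ M X Y k lam S = (THE D. transpose D = D \<and>
     (calJ M X Y k lam has_derivative (\<lambda>H. D \<bullet> H)) (at S within Sym_nonneg))"

text \<open>The tangent space of an embedded submanifold: velocities of C1 curves in it.\<close>

definition tangent_space :: "'v::real_normed_vector set \<Rightarrow> 'v \<Rightarrow> 'v set" where
  "tangent_space N p = {v. \<exists>e>0. \<exists>c. c C1_differentiable_on {-e<..<e} \<and>
     c ` {-e<..<e} \<subseteq> N \<and> c 0 = p \<and> (c has_vector_derivative v) (at (0::real))}"

definition stationary_point ::
  "'a measure \<Rightarrow> ('a \<Rightarrow> real ^ 'n) \<Rightarrow> ('a \<Rightarrow> complex) \<Rightarrow> (real ^ 'n \<Rightarrow> real) \<Rightarrow> real \<Rightarrow>
   real ^ 'n ^ 'n \<Rightarrow> bool" where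
  "stationary_point M X Y k lam S \<longleftrightarrow>
     (S \<in> Sym_pos \<and> DJ M X Y k lam S = 0) \<or>
     (\<exists>l<CARD('n). S \<in> Sym_stratum l \<and>
        (\<forall>H \<in> tangent_space (Sym_stratum l) S. DJ M X Y k lam S \<bullet> H = 0))"

definition flow_field ::
  "'a measure \<Rightarrow> ('a \<Rightarrow> real ^ 'n) \<Rightarrow> ('a \<Rightarrow> complex) \<Rightarrow> (real ^ 'n \<Rightarrow> real) \<Rightarrow> real \<Rightarrow>
   real ^ 'n ^ 'n \<Rightarrow> real ^ 'n ^ 'n" where
  "flow_field M X Y k lam S =
     (let Ci = matrix_inv (cov_matrix M X); D = DJ M X Y k lam S
      in \<chi> a b. - (1/2) * ((\<Sum>c\<in>UNIV. \<Sum>d\<in>UNIV. S $ a $ c * Ci $ b $ d * D $ c $ d)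
                         + (\<Sum>c\<in>UNIV. \<Sum>d\<in>UNIV. S $ b $ d * Ci $ a $ c * D $ c $ d)))"

end

theory Submission
  imports Defs
begin

text \<open>
  By duality the optimal value is the supremum over g in L2 of
  \<open>\<langle>Y, g\<rangle> - |g|\<^sup>2 / 2 - Q\<^sub>S(g) / (2 lam)\<close>, where \<open>Q\<^sub>S\<close> is the positive quadratic form with
  kernel \<open>Kc (|X - X'|\<^sub>S\<^sup>2)\<close>.  This expression depends on S directly, also at degenerate S.  Approximate
  maximisers come from a contracting iteration whose rate does not depend on S; they depend in a
  Lipschitz way on S, and their envelope gradients converge to the gradient D, which is therefore
  Lipschitz.

  Along the flow the value decreases at the rate \<open>\<langle>D, S D C\<^sup>-\<^sup>1\<rangle> \<ge> 0\<close>, so this rate tends to 0 along some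
  sequence of times, and it vanishes only if \<open>S D = 0\<close>, which implies stationarity.  Compactness: if S
  tends to infinity then \<open>|X - X'|\<^sub>S\<close> tends to infinity almost surely, because X has a density, so
  \<open>Q\<^sub>S(Y)\<close> tends to 0 by the Riemann--Lebesgue lemma and the value tends to its maximum \<open>E|Y|\<^sup>2 / 2\<close>.
  Hence the flow is bounded unless the value is constantly equal to this maximum, and then the flow
  does not move.
\<close>

subsection \<open>Positive semidefinite matrices\<close>

text \<open>The infimum is posed through a factor U of S, and U cannot be chosen smoothly where S
  drops rank; in the dual problem only the numbers |X - X'|_S^2 occur, and these are linear in S.
  The dual problem is a strongly concave quadratic maximisation, so a small residual Y - g - T g /
  lam controls both the duality gap and the distance between near-maximisers. Hence no maximiser is
  ever formed: every estimate carries the residuals as error terms, and only gradients, which live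
  in a finite-dimensional space, are passed to the limit. Differentiability is one-sided at first,
  since a supremum is bounded below by any competitor; exchanging S and S' and using the Lipschitz
  bound for D supplies the other side. A second-order expansion of the kernel in S costs |X - X'|^4,
  whose square must be integrable, hence the eighth moment. The identity S D = 0 treats limit points
  of all ranks at once. The dissipation rate is sampled at mean-value times in unit intervals, where
  it equals a decrement of the value.\<close>

definition outer :: "real ^ 'n \<Rightarrow> real ^ 'n ^ 'n" where
  "outer v = (\<chi> i j. v $ i * v $ j)"

lemma inner_matrix: "(A :: real ^ 'n ^ 'm) \<bullet> B = (\<Sum>i\<in>UNIV. \<Sum>j\<in>UNIV. A $ i $ j * B $ i $ j)"
  by (simp add: inner_vec_def)

text \<open>Pairing with a rank-one matrix makes \<open>qform S x\<close> linear in S, so limits,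
  derivatives and closedness in S are inherited from the inner product of matrices.\<close>

lemma qform_eq_inner: "qform S x = S \<bullet> outer x"
  by (simp add: qform_def inner_matrix outer_def inner_vec_def matrix_vector_mult_def
      sum_distrib_left mult_ac)

lemma qform_outer: "qform (outer v) x = (v \<bullet> x)\<^sup>2"
  by (simp add: qform_eq_inner inner_matrix outer_def inner_vec_def power2_eq_square
      sum_product mult_ac)

lemma norm_outer: "norm (outer v) = (norm v)\<^sup>2"
proof -
  have "(norm (outer v))\<^sup>2 = ((norm v)\<^sup>2)\<^sup>2"
    by (metis power2_norm_eq_inner qform_eq_inner qform_outer)
  then show ?thesis by (rule power2_eq_imp_eq) auto
qed

lemma abs_qform_le: "\<bar>qform S x\<bar> \<le> norm S * (norm x)\<^sup>2"
  unfolding qform_eq_inner by (metis Cauchy_Schwarz_ineq2 norm_outer)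

lemma transpose_outer: "transpose (outer v) = outer v"
  by (simp add: transpose_def outer_def mult.commute vec_eq_iff)

lemma continuous_on_outer[continuous_intros]:
  "continuous_on A f \<Longrightarrow> continuous_on A (\<lambda>x. outer (f x))"
  unfolding outer_def by (intro continuous_intros)

lemma qform_diff_matrix: "qform (A - B) x = qform A x - qform B x"
  by (simp add: qform_eq_inner inner_diff_left)

lemma qform_add_matrix: "qform (A + B) x = qform A x + qform B x"
  by (simp add: qform_eq_inner inner_add_left)

lemma qform_scaleR_matrix: "qform (c *\<^sub>R A) x = c * qform A x"
  by (simp add: qform_eq_inner)

lemma transpose_add: "transpose (A + B) = transpose A + transpose (B :: real ^ 'n ^ 'm)"
  by (simp add: transpose_def vec_eq_iff)

lemma transpose_minus: "transpose (A - B) = transpose A - transpose (B :: real ^ 'n ^ 'm)"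
  by (simp add: transpose_def vec_eq_iff)

lemma transpose_scaleR: "transpose (c *\<^sub>R A) = c *\<^sub>R transpose (A :: real ^ 'n ^ 'm)"
  by (simp add: transpose_def vec_eq_iff)

lemma bounded_linear_transpose: "bounded_linear (transpose :: real ^ 'n ^ 'm \<Rightarrow> real ^ 'm ^ 'n)"
  by (intro linear_conv_bounded_linear[THEN iffD1] linearI transpose_add transpose_scaleR)

lemma inner_mult_sym: "transpose S = S \<Longrightarrow> y \<bullet> (S *v x) = x \<bullet> (S *v y)"
  for S :: "real ^ 'n ^ 'n"
  by (metis dot_lmul_matrix inner_commute transpose_matrix_vector)

lemma qform_add_scaleR:
  assumes "transpose S = S"
  shows "qform S (x + t *\<^sub>R y) = qform S x + 2 * t * (x \<bullet> (S *v y)) + t\<^sup>2 * qform S y"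
  unfolding qform_def
  by (simp add: matrix_vector_right_distrib matrix_vector_mult_scaleR inner_add_left inner_add_right
      inner_mult_sym[OF assms, of y x] power2_eq_square algebra_simps)

text \<open>Along the line x + t y with y = S x the form is a nonnegative quadratic in t without
  constant term, so its linear coefficient, twice the square of |S x|, must vanish.\<close>

lemma qform_zero_imp_kernel:
  assumes "S \<in> Sym_nonneg" "qform S x = 0"
  shows "S *v x = 0"
proof (rule ccontr)
  assume nz: "S *v x \<noteq> 0"
  define y where "y = S *v x"
  have sym: "transpose S = S" and nn: "\<And>z. 0 \<le> qform S z"
    using assms by (auto simp: Sym_nonneg_def)
  \<comment> \<open>The step against y is short enough for the linear term to outweigh the quadratic
    one; the added 1 keeps the denominator positive when \<open>qform S y\<close> is 0.\<close>
  define e where "e = (y \<bullet> y) / (qform S y + 1)"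
  have yy: "0 < y \<bullet> y" using nz by (simp add: y_def)
  have q1: "0 < qform S y + 1" using nn[of y] by simp
  have e0: "0 < e" using yy q1 by (simp add: e_def)
  have xSy: "x \<bullet> (S *v y) = y \<bullet> y"
    unfolding inner_mult_sym[OF sym, of x y] by (simp only: y_def)
  have "0 \<le> qform S (x + (- e) *\<^sub>R y)" by (rule nn)
  then have "0 \<le> e * (e * qform S y - 2 * (y \<bullet> y))"
    unfolding qform_add_scaleR[OF sym] xSy assms(2) by (simp add: power2_eq_square right_diff_distrib)
  then have "0 \<le> e * qform S y - 2 * (y \<bullet> y)"
    using e0 by (simp only: zero_le_mult_iff) simp
  then have "2 * (y \<bullet> y) \<le> e * qform S y" by simp
  also have "\<dots> \<le> e * (qform S y + 1)" using e0 by simp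
  also have "\<dots> = y \<bullet> y" using q1 by (simp add: e_def)
  finally show False using yy by simp
qed

text \<open>Cholesky elimination: B holds the indices whose rows may still be nonzero, and each
  induction step clears one of them by subtracting a rank-one matrix, leaving the Schur
  complement.\<close>

lemma psd_sum_outer:
  assumes "finite B"
  shows "S \<in> Sym_nonneg \<Longrightarrow> (\<And>i j. i \<notin> B \<Longrightarrow> S $ i $ j = 0) \<Longrightarrow>
    \<exists>v :: 'n \<Rightarrow> real ^ 'n. S = (\<Sum>i\<in>B. outer (v i))"
  using assms
proof (induction B arbitrary: S rule: finite_induct)
  case empty
  then show ?case by (simp add: vec_eq_iff)
next
  case (insert b B)
  have sym: "transpose S = S" and nn: "\<And>z. 0 \<le> qform S z"
    using insert.prems by (auto simp: Sym_nonneg_def)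
  have sij: "S $ i $ j = S $ j $ i" for i j
    using arg_cong[OF sym, of "\<lambda>A. A $ j $ i"] by (simp add: transpose_def)
  define e :: "real ^ 'n" where "e = axis b 1"
  have Se: "(S *v e) $ i = S $ i $ b" for i
    by (simp add: e_def matrix_vector_mult_def axis_def if_distrib cong: if_cong)
  have qe: "qform S e = S $ b $ b"
    using Se[of b] by (simp add: qform_def e_def inner_axis')
  show ?case
  proof (cases "S $ b $ b = 0")
    \<comment> \<open>A zero pivot forces the whole row to vanish, so the vector for this index is
      0.\<close>
    case True
    then have "S *v e = 0" using qform_zero_imp_kernel[OF insert.prems(1)] qe by simp
    then have z: "S $ b $ j = 0" for j using Se[of j] sij by simp
    have "\<exists>v. S = (\<Sum>i\<in>B. outer (v i))"
      by (rule insert.IH[OF insert.prems(1)]) (use insert.prems(2) z in \<open>metis insert_iff\<close>)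
    then obtain v where v: "S = (\<Sum>i\<in>B. outer (v i))" by blast
    have "(\<Sum>i\<in>insert b B. outer ((v(b := 0)) i)) = outer 0 + (\<Sum>i\<in>B. outer (v i))"
      using insert.hyps by (subst sum.insert) (auto intro!: arg_cong2[where f="(+)"] sum.cong)
    also have "\<dots> = S" by (simp add: v outer_def vec_eq_iff)
    finally show ?thesis by (intro exI[of _ "v(b := 0)"]) (rule HOL.sym)
  next
    case False
    then have pos: "0 < S $ b $ b" using nn[of e] qe by simp
    define w where "w = (1 / sqrt (S $ b $ b)) *\<^sub>R (S *v e)"
    define S' where "S' = S - outer w"
    have wij: "outer w $ i $ j = S $ i $ b * S $ j $ b / S $ b $ b" for i j
      using pos by (simp add: outer_def w_def Se)
    have "S' \<in> Sym_nonneg"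
      unfolding Sym_nonneg_def
    proof (intro CollectI conjI allI)
      show "transpose S' = S'" by (simp add: S'_def transpose_minus transpose_outer sym)
    next
      fix x
      \<comment> \<open>This t minimises the form along x + t e, and the minimum is the Schur
        complement evaluated at x; hence the complement is positive semidefinite.\<close>
      define t where "t = - (x \<bullet> (S *v e)) / qform S e"
      have "0 \<le> qform S (x + t *\<^sub>R e)" by (rule nn)
      also have "\<dots> = qform S x - (x \<bullet> (S *v e))\<^sup>2 / qform S e"
        using pos qe by (subst qform_add_scaleR[OF sym]) (simp add: t_def field_simps power2_eq_square)
      also have "\<dots> = qform S' x"
        using pos by (simp add: S'_def qform_diff_matrix qform_outer w_def qe inner_commute
            power_mult_distrib power_divide)
      finally show "0 \<le> qform S' x" .
    qed
    moreover have "S' $ i $ j = 0" if "i \<notin> B" for i j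
    proof (cases "i = b")
      case True
      then show ?thesis using pos wij[of i j] sij[of j b] by (simp add: S'_def)
    next
      case False
      then have "S $ i $ j' = 0" for j' using that insert.prems(2) by blast
      then show ?thesis using wij[of i j] by (simp add: S'_def)
    qed
    ultimately have "\<exists>v. S' = (\<Sum>i\<in>B. outer (v i))" by (rule insert.IH)
    then obtain v where v: "S' = (\<Sum>i\<in>B. outer (v i))" by blast
    have "(\<Sum>i\<in>insert b B. outer ((v(b := w)) i)) = outer w + (\<Sum>i\<in>B. outer (v i))"
      using insert.hyps by (subst sum.insert) (auto intro!: arg_cong2[where f="(+)"] sum.cong)
    also have "\<dots> = S" by (simp add: v[symmetric] S'_def)
    finally show ?thesis by (intro exI[of _ "v(b := w)"]) (rule HOL.sym)
  qed
qed

lemma psd_factorization: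
  assumes "S \<in> Sym_nonneg"
  shows "\<exists>U :: real ^ 'n ^ 'n. S = transpose U ** U"
proof -
  obtain v :: "'n \<Rightarrow> real ^ 'n" where v: "S = (\<Sum>i\<in>UNIV. outer (v i))"
    using psd_sum_outer[of UNIV S] assms by auto
  have "S = transpose (\<chi> i. v i) ** (\<chi> i. v i)"
    by (simp add: v vec_eq_iff outer_def matrix_matrix_mult_def transpose_def)
  then show ?thesis by blast
qed

lemma qform_transpose_mult: "qform (transpose U ** U) x = (U *v x) \<bullet> (U *v x)"
  for U :: "real ^ 'n ^ 'n"
  by (simp add: qform_def matrix_vector_mul_assoc[symmetric] dot_lmul_matrix[symmetric]
      inner_commute)

section \<open>Frobenius pairing and the dissipation of the flow\<close>

lemma inner_matrix_mult_left: "A \<bullet> (B ** C) = (transpose B ** A) \<bullet> C"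
  for A B C :: "real ^ 'n ^ 'n"
proof -
  have "A \<bullet> (B ** C) = (\<Sum>i\<in>UNIV. \<Sum>j\<in>UNIV. \<Sum>k\<in>UNIV. A $ i $ j * B $ i $ k * C $ k $ j)"
    by (simp add: inner_matrix matrix_matrix_mult_def sum_distrib_left mult.assoc)
  also have "\<dots> = (\<Sum>i\<in>UNIV. \<Sum>k\<in>UNIV. \<Sum>j\<in>UNIV. A $ i $ j * B $ i $ k * C $ k $ j)"
    by (intro sum.cong refl sum.swap)
  also have "\<dots> = (\<Sum>k\<in>UNIV. \<Sum>i\<in>UNIV. \<Sum>j\<in>UNIV. A $ i $ j * B $ i $ k * C $ k $ j)"
    by (rule sum.swap)
  also have "\<dots> = (\<Sum>k\<in>UNIV. \<Sum>j\<in>UNIV. \<Sum>i\<in>UNIV. A $ i $ j * B $ i $ k * C $ k $ j)"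
    by (intro sum.cong refl sum.swap)
  also have "\<dots> = (transpose B ** A) \<bullet> C"
    by (simp add: inner_matrix matrix_matrix_mult_def transpose_def sum_distrib_left
        sum_distrib_right mult_ac)
  finally show ?thesis .
qed

lemma inner_transpose: "transpose A \<bullet> transpose B = A \<bullet> (B :: real ^ 'n ^ 'n)"
  unfolding inner_matrix transpose_def by (simp, rule sum.swap)

lemma inner_matrix_mult_right: "A \<bullet> (B ** C) = (A ** transpose C) \<bullet> B"
  for A B C :: "real ^ 'n ^ 'n"
proof -
  have "A \<bullet> (B ** C) = transpose A \<bullet> (transpose C ** transpose B)"
    by (metis inner_transpose matrix_transpose_mul)
  also have "\<dots> = transpose (A ** transpose C) \<bullet> transpose B"
    by (simp add: inner_matrix_mult_left matrix_transpose_mul)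
  finally show ?thesis by (simp add: inner_transpose)
qed

text \<open>Multiplications by a matrix and by its transpose are adjoint for the Frobenius pairing,
  so one factor of S and one of P move to the other side and a square appears.\<close>

lemma dissipation_factor:
  "D \<bullet> ((transpose U ** U) ** D ** (transpose W ** W)) =
    (norm (U ** D ** transpose W))\<^sup>2" for U W D :: "real ^ 'n ^ 'n"
proof -
  have "D \<bullet> ((transpose U ** U) ** D ** (transpose W ** W)) =
     D \<bullet> (transpose U ** ((U ** D ** transpose W) ** W))"
    by (simp add: matrix_mul_assoc)
  also have "\<dots> = (U ** D ** transpose W) \<bullet> (U ** D ** transpose W)"
    by (simp only: inner_matrix_mult_left[of D] inner_matrix_mult_right[of _ _ W] transpose_transpose)
  finally show ?thesis by (simp add: power2_norm_eq_inner)
qed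

lemma dissipation_nonneg:
  fixes S P D :: "real ^ 'n ^ 'n"
  assumes "S \<in> Sym_nonneg" "P \<in> Sym_nonneg"
  shows "0 \<le> D \<bullet> (S ** D ** P)"
proof -
  obtain U :: "real ^ 'n ^ 'n" where U: "S = transpose U ** U" using psd_factorization[OF assms(1)] by blast
  obtain W :: "real ^ 'n ^ 'n" where W: "P = transpose W ** W" using psd_factorization[OF assms(2)] by blast
  show ?thesis unfolding U W dissipation_factor by simp
qed

text \<open>The matrix \<open>U ** D ** transpose W\<close> vanishes; multiplying by
  \<open>transpose U\<close> on the left and by \<open>W ** P'\<close> on the right restores S and
  cancels P.\<close>

lemma dissipation_zero:
  fixes S P D :: "real ^ 'n ^ 'n"
  assumes "S \<in> Sym_nonneg" "P \<in> Sym_nonneg" "P ** P' = mat 1" "D \<bullet> (S ** D ** P) = 0"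
  shows "S ** D = 0"
proof -
  obtain U :: "real ^ 'n ^ 'n" where U: "S = transpose U ** U" using psd_factorization[OF assms(1)] by blast
  obtain W :: "real ^ 'n ^ 'n" where W: "P = transpose W ** W" using psd_factorization[OF assms(2)] by blast
  have "U ** D ** transpose W = 0"
    using assms(4) unfolding U W dissipation_factor by simp
  then have "transpose U ** ((U ** D ** transpose W) ** (W ** P')) = 0" by simp
  also have "transpose U ** ((U ** D ** transpose W) ** (W ** P')) = S ** D ** (P ** P')"
    by (simp add: U W matrix_mul_assoc)
  finally show ?thesis by (simp add: assms(3))
qed

text \<open>The flow field is a symmetrised product; both halves pair equally with D, which absorbs
  the factor 1/2.\<close>

lemma dissipation_sym:
  fixes S P D :: "real ^ 'n ^ 'n"
  assumes "transpose S = S" "transpose P = P" "transpose D = D"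
  shows "D \<bullet> (P ** D ** S) = D \<bullet> (S ** D ** P)"
  using inner_transpose[of D "P ** D ** S"] by (simp add: assms matrix_transpose_mul matrix_mul_assoc)

lemma qform_eq_0_imp_0:
  assumes "transpose D = D" "\<And>x. qform D x = 0"
  shows "D = 0"
proof -
  have "x \<bullet> (D *v y) = 0" for x y
    using qform_add_scaleR[OF assms(1), of x 1 y] by (simp add: assms(2))
  then have "D *v y = 0" for y by (metis inner_eq_zero_iff)
  then show ?thesis by (simp add: matrix_eq)
qed

section \<open>The closed cone and the tangent vectors of its strata\<close>

lemma closed_Sym_nonneg: "closed (Sym_nonneg :: (real ^ 'n ^ 'n) set)"
proof -
  have "Sym_nonneg = {S :: real ^ 'n ^ 'n. transpose S = S} \<inter> (\<Inter>x. {S. 0 \<le> S \<bullet> outer x})"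
    by (auto simp: Sym_nonneg_def qform_eq_inner)
  also have "closed \<dots>"
    by (intro closed_Int closed_INT ballI closed_Collect_eq closed_Collect_le continuous_intros
        linear_continuous_on bounded_linear_transpose)
  finally show ?thesis .
qed

lemma Sym_nonneg_add_outer: "S \<in> Sym_nonneg \<Longrightarrow> 0 \<le> t \<Longrightarrow> S + t *\<^sub>R outer v \<in> Sym_nonneg"
  by (auto simp: Sym_nonneg_def transpose_add transpose_scaleR transpose_outer qform_add_matrix
      qform_scaleR_matrix qform_outer)

text \<open>Only positive semidefiniteness of the curve is used: x \<bullet> (c t *v x) is minimal at t = 0 for every
  x in the kernel of c 0, so a tangent vector H vanishes as a form on that kernel, which contains
  the range of D.\<close>

lemma tangent_space_inner_zero:
  fixes S D H :: "real ^ 'n ^ 'n"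
  assumes N: "N \<subseteq> Sym_nonneg" and H: "H \<in> tangent_space N S"
    and D: "transpose D = D" and SD: "S ** D = 0"
  shows "D \<bullet> H = 0"
proof -
  obtain e c where e: "0 < e" and c: "c ` {-e<..<e} \<subseteq> N" "c 0 = S"
    "(c has_vector_derivative H) (at (0::real))"
    using H by (auto simp: tangent_space_def)
  have csn: "c t \<in> Sym_nonneg" if "\<bar>t\<bar> < e" for t using that c N by fastforce
  have symc: "transpose (c t) = c t" if "\<bar>t\<bar> < e" for t
    using csn[OF that] by (simp add: Sym_nonneg_def)
  \<comment> \<open>The curve consists of symmetric matrices, and transposition commutes with the
    derivative; polarisation below uses the symmetry of H.\<close>
  have Hsym: "transpose H = H"
  proof -
    have "((\<lambda>t. transpose (c t)) has_vector_derivative transpose H) (at 0)"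
      by (rule bounded_linear.has_vector_derivative[OF bounded_linear_transpose c(3)])
    then have "(c has_vector_derivative transpose H) (at 0)"
      by (rule has_vector_derivative_transform_within[OF _ e]) (auto simp: symc)
    then show ?thesis using c(3) vector_derivative_unique_at by blast
  qed
  have q0: "qform H x = 0" if x: "S *v x = 0" for x
  proof -
    have "((\<lambda>t. c t \<bullet> outer x) has_vector_derivative H \<bullet> outer x) (at 0)"
      by (rule bounded_linear.has_vector_derivative[OF bounded_linear_inner_left c(3)])
    then have "((\<lambda>t. c t \<bullet> outer x) has_real_derivative H \<bullet> outer x) (at 0)"
      by (simp add: has_real_derivative_iff_has_vector_derivative)
    moreover have "\<forall>t. \<bar>0 - t\<bar> < e \<longrightarrow> c 0 \<bullet> outer x \<le> c t \<bullet> outer x"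
    proof (intro allI impI)
      fix t assume "\<bar>0 - t\<bar> < e"
      then have "0 \<le> qform (c t) x" using csn[of t] by (simp add: Sym_nonneg_def)
      then show "c 0 \<bullet> outer x \<le> c t \<bullet> outer x"
        using x by (simp add: c(2) qform_eq_inner[symmetric]) (simp add: qform_def)
    qed
    ultimately show ?thesis using DERIV_local_min[OF _ e] by (simp add: qform_eq_inner)
  qed
  have bil0: "x \<bullet> (H *v y) = 0" if "S *v x = 0" "S *v y = 0" for x y
  proof -
    have "S *v (x + 1 *\<^sub>R y) = 0" using that by (simp add: matrix_vector_right_distrib)
    from q0[OF this] show ?thesis
      using qform_add_scaleR[OF Hsym, of x 1 y] by (simp add: q0[OF that(1)] q0[OF that(2)])
  qed
  \<comment> \<open>Since S D = 0 and D is symmetric, every row of D lies in K. Expanding the rows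
    in an orthonormal basis of K turns the pairing into a sum of products of D a and H a, with both
    a and D a in K.\<close>
  define K where "K = {x. S *v x = 0}"
  have sub: "subspace K"
    by (auto simp: K_def subspace_def matrix_vector_right_distrib matrix_vector_mult_scaleR)
  obtain B where B: "B \<subseteq> K" "pairwise orthogonal B" "\<And>x. x \<in> B \<Longrightarrow> norm x = 1"
    "independent B" "span B = K"
    using orthonormal_basis_subspace[OF sub] by metis
  have finB: "finite B" using B(4) independent_imp_finite by blast
  have DK: "D *v x \<in> K" for x by (simp add: K_def matrix_vector_mul_assoc SD)
  have row: "D $ j = D *v axis j 1" for j
  proof -
    have "D $ j $ i = D $ i $ j" for i
      using arg_cong[OF D, of "\<lambda>A. A $ i $ j"] by (simp add: transpose_def)
    then show ?thesis by (simp add: matrix_vector_mult_basis column_def vec_eq_iff)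
  qed
  have "D $ j = (\<Sum>a\<in>B. (a \<bullet> D $ j) *\<^sub>R a)" for j
    using orthonormal_basis_expand[OF B(2,3) _ finB, of "D $ j"] B(5) DK[of "axis j 1"]
    by (simp add: row inner_commute)
  then have "D \<bullet> H = (\<Sum>j\<in>UNIV. (\<Sum>a\<in>B. (a \<bullet> D $ j) *\<^sub>R a) \<bullet> H $ j)"
    by (simp add: inner_vec_def[of D H])
  also have "\<dots> = (\<Sum>a\<in>B. \<Sum>j\<in>UNIV. (a \<bullet> D $ j) * (a \<bullet> H $ j))"
    by (subst sum.swap) (simp add: inner_sum_left)
  also have "\<dots> = (\<Sum>a\<in>B. (D *v a) \<bullet> (H *v a))"
    by (simp add: inner_vec_def[of "_ *v _" "_ *v _"] matrix_vector_mul_component inner_commute)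
  also have "\<dots> = 0"
  proof (rule sum.neutral, intro ballI)
    fix a assume a: "a \<in> B"
    then have "S *v a = 0" using B(1) by (auto simp: K_def)
    then show "(D *v a) \<bullet> (H *v a) = 0" using bil0[of "D *v a" a] DK[of a] by (simp add: K_def)
  qed
  finally show ?thesis .
qed

section \<open>Cauchy-Schwarz for Bochner integrals\<close>

lemma integral_Cauchy_Schwarz:
  fixes f g :: "'a \<Rightarrow> real"
  assumes [measurable]: "f \<in> borel_measurable M" "g \<in> borel_measurable M"
    and f2: "integrable M (\<lambda>x. (f x)\<^sup>2)" and g2: "integrable M (\<lambda>x. (g x)\<^sup>2)"
  shows "integrable M (\<lambda>x. f x * g x)"
    and "(LINT x|M. \<bar>f x * g x\<bar>) \<le> sqrt (LINT x|M. (f x)\<^sup>2) * sqrt (LINT x|M. (g x)\<^sup>2)"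
proof -
  show int: "integrable M (\<lambda>x. f x * g x)"
  proof (rule Bochner_Integration.integrable_bound[OF Bochner_Integration.integrable_add[OF f2 g2]])
    show "AE x in M. norm (f x * g x) \<le> norm ((f x)\<^sup>2 + (g x)\<^sup>2)"
    proof (intro AE_I2)
      fix x
      have "2 * (\<bar>f x\<bar> * \<bar>g x\<bar>) \<le> (f x)\<^sup>2 + (g x)\<^sup>2"
        using sum_squares_bound[of "\<bar>f x\<bar>" "\<bar>g x\<bar>"] by simp
      moreover have "0 \<le> \<bar>f x\<bar> * \<bar>g x\<bar>" by simp
      ultimately have "\<bar>f x\<bar> * \<bar>g x\<bar> \<le> (f x)\<^sup>2 + (g x)\<^sup>2" by linarith
      then show "norm (f x * g x) \<le> norm ((f x)\<^sup>2 + (g x)\<^sup>2)"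
        by (simp add: abs_mult)
    qed
  qed measurable
  have e1: "(\<integral>\<^sup>+x. ennreal \<bar>f x\<bar> * ennreal \<bar>g x\<bar> \<partial>M) = ennreal (LINT x|M. \<bar>f x * g x\<bar>)"
    using integrable_abs[OF int]
    by (subst nn_integral_eq_integral[symmetric]) (auto simp: abs_mult ennreal_mult)
  have e2: "(\<integral>\<^sup>+x. (ennreal \<bar>h x\<bar>)\<^sup>2 \<partial>M) = ennreal (LINT x|M. (h x)\<^sup>2)"
    if "integrable M (\<lambda>x. (h x)\<^sup>2)" for h
    using that by (subst nn_integral_eq_integral[symmetric]) (auto simp: ennreal_power)
  have "(\<integral>\<^sup>+x. ennreal \<bar>f x\<bar> * ennreal \<bar>g x\<bar> \<partial>M)\<^sup>2
      \<le> (\<integral>\<^sup>+x. (ennreal \<bar>f x\<bar>)\<^sup>2 \<partial>M) * (\<integral>\<^sup>+x. (ennreal \<bar>g x\<bar>)\<^sup>2 \<partial>M)"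
    by (rule Cauchy_Schwarz_nn_integral) measurable
  then have "(LINT x|M. \<bar>f x * g x\<bar>)\<^sup>2 \<le> (LINT x|M. (f x)\<^sup>2) * (LINT x|M. (g x)\<^sup>2)"
    unfolding e1 e2[OF f2] e2[OF g2]
    by (simp add: ennreal_power ennreal_mult'[symmetric] ennreal_le_iff)
  then show "(LINT x|M. \<bar>f x * g x\<bar>) \<le> sqrt (LINT x|M. (f x)\<^sup>2) * sqrt (LINT x|M. (g x)\<^sup>2)"
    by (simp add: real_le_rsqrt real_sqrt_mult[symmetric])
qed

lemma integrable_indicator_bounded:
  "A \<in> sets borel \<Longrightarrow> bounded A \<Longrightarrow> integrable lborel (indicator A :: 'b::euclidean_space \<Rightarrow> real)"
  by (intro integrable_real_indicator) (auto dest: emeasure_bounded_finite)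

subsection \<open>The Riemann--Lebesgue lemma along a ray\<close>

text \<open>The Fourier integral of f along the line through b. A radial profile can be read off
  along one line, so decay is studied only in this direction.\<close>

definition osc_int :: "'b::euclidean_space \<Rightarrow> ('b \<Rightarrow> real) \<Rightarrow> real \<Rightarrow> complex" where
  "osc_int b f t = (LINT w|lborel. f w *\<^sub>R cis (2 * pi * t * (b \<bullet> w)))"

lemma osc_integrable:
  fixes f :: "'b::euclidean_space \<Rightarrow> real"
  assumes "integrable lborel f"
  shows "integrable lborel (\<lambda>w. f w *\<^sub>R cis (2 * pi * t * (b \<bullet> w)))"
proof (rule Bochner_Integration.integrable_bound[OF assms])
  note [measurable] = borel_measurable_integrable[OF assms]
  have [measurable]: "cis \<in> borel_measurable borel"
    by (intro borel_measurable_continuous_onI continuous_intros)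
  show "(\<lambda>w. f w *\<^sub>R cis (2 * pi * t * (b \<bullet> w))) \<in> borel_measurable lborel"
    by measurable
qed auto

lemma norm_osc_int_le:
  fixes f :: "'b::euclidean_space \<Rightarrow> real"
  assumes "integrable lborel f"
  shows "norm (osc_int b f t) \<le> (LINT w|lborel. \<bar>f w\<bar>)"
  unfolding osc_int_def
  by (rule order_trans[OF integral_norm_bound]) simp

lemma osc_int_add:
  assumes "integrable lborel f" "integrable lborel g"
  shows "osc_int b (\<lambda>w. f w + g w) t = osc_int b f t + osc_int b g t"
  unfolding osc_int_def scaleR_add_left
  by (intro Bochner_Integration.integral_add osc_integrable assms)

lemma osc_int_diff:
  assumes "integrable lborel f" "integrable lborel g"
  shows "osc_int b (\<lambda>w. f w - g w) t = osc_int b f t - osc_int b g t"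
  unfolding osc_int_def scaleR_diff_left
  by (intro Bochner_Integration.integral_diff osc_integrable assms)

text \<open>The integral is bounded by the L1 norm uniformly in the frequency, so decay survives
  dominated limits.\<close>

lemma osc_int_limit:
  fixes f :: "'b::euclidean_space \<Rightarrow> real"
  assumes s: "\<And>i. integrable lborel (s i)" "\<And>i. (\<lambda>n. osc_int b (s i) (t n)) \<longlonglongrightarrow> 0"
    and lim: "\<And>x. (\<lambda>i. s i x) \<longlonglongrightarrow> f x"
    and g: "integrable lborel g" and dom: "\<And>i x. \<bar>s i x\<bar> \<le> g x"
    and f: "integrable lborel f"
  shows "(\<lambda>n. osc_int b f (t n)) \<longlonglongrightarrow> 0"
proof (rule LIMSEQ_I)
  fix e :: real assume e: "0 < e"
  have fg: "\<bar>f x\<bar> \<le> g x" for x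
    by (rule LIMSEQ_le_const2[OF tendsto_rabs[OF lim]]) (use dom in auto)
  have "(\<lambda>i. LINT w|lborel. \<bar>s i w - f w\<bar>) \<longlonglongrightarrow> (LINT w|(lborel::'b measure). (0::real))"
  proof (rule integral_dominated_convergence[where w="\<lambda>x. 2 * g x"])
    note [measurable] = borel_measurable_integrable[OF f] borel_measurable_integrable[OF s(1)]
    show "(\<lambda>w. \<bar>s i w - f w\<bar>) \<in> borel_measurable lborel" for i by measurable
    show "AE x in lborel. (\<lambda>i. \<bar>s i x - f x\<bar>) \<longlonglongrightarrow> 0"
      by (intro AE_I2 tendsto_rabs_zero LIM_zero lim)
    show "AE x in lborel. norm \<bar>s i x - f x\<bar> \<le> 2 * g x" for i
      using dom[of i] fg by (intro AE_I2) (smt (verit) real_norm_def)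
  qed (use g in auto)
  then obtain i where i: "(LINT w|lborel. \<bar>s i w - f w\<bar>) < e / 2"
    using e LIMSEQ_D[of _ _ "e/2"] by fastforce
  obtain N where N: "\<And>n. n \<ge> N \<Longrightarrow> norm (osc_int b (s i) (t n)) < e / 2"
    using LIMSEQ_D[OF s(2)[of i], of "e/2"] e by auto
  have "norm (osc_int b f (t n) - 0) < e" if "n \<ge> N" for n
  proof -
    have "osc_int b f (t n) = osc_int b (s i) (t n) - osc_int b (\<lambda>w. s i w - f w) (t n)"
      by (simp add: osc_int_diff s f)
    then have "norm (osc_int b f (t n)) \<le> norm (osc_int b (s i) (t n))
        + norm (osc_int b (\<lambda>w. s i w - f w) (t n))"
      by (simp only: norm_triangle_ineq4)
    also have "\<dots> < e / 2 + e / 2"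
      using N[OF that] i norm_osc_int_le[OF Bochner_Integration.integrable_diff[OF s(1)[of i] f], of b "t n"]
      by linarith
    finally show ?thesis by simp
  qed
  then show "\<exists>N. \<forall>n\<ge>N. norm (osc_int b f (t n) - 0) < e" by blast
qed

text \<open>Shifting by half a period changes the sign of the oscillating factor, so the integral is
  controlled by the L1 distance between the indicator and its translate.\<close>

lemma osc_int_box:
  fixes b :: "'b::euclidean_space"
  assumes b: "norm b = 1" and t: "filterlim t at_top sequentially"
  shows "(\<lambda>n. osc_int b (indicator (box p q)) (t n)) \<longlonglongrightarrow> 0"
proof -
  define f :: "'b \<Rightarrow> real" where "f = indicator (box p q)"
  have fi: "integrable lborel f"
    unfolding f_def by (intro integrable_indicator_bounded) auto
  define h where "h n = (1 / (2 * t n)) *\<^sub>R b" for n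
  have h0: "h \<longlonglongrightarrow> 0"
  proof -
    have "(\<lambda>n. (1/2) * inverse (t n)) \<longlonglongrightarrow> (1/2) * 0"
      by (rule tendsto_mult[OF tendsto_const filterlim_compose[OF tendsto_inverse_0_at_top[OF filterlim_ident] t]])
    then have "(\<lambda>n. ((1/2) * inverse (t n)) *\<^sub>R b) \<longlonglongrightarrow> 0 *\<^sub>R b"
      by (intro tendsto_intros) simp
    then show ?thesis by (simp add: h_def[abs_def] field_simps)
  qed
  then obtain H where H: "\<And>n. norm (h n) \<le> H"
    using convergent_imp_Bseq[OF convergentI[OF h0]] by (auto simp: Bseq_def)
  obtain R where R: "\<And>x. x \<in> box p q \<Longrightarrow> norm x \<le> R"
    using bounded_box[of p q] by (auto simp: bounded_iff)
  have fhi: "integrable lborel (\<lambda>w. f (h n + w))" for n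
  proof -
    have "integrable (distr lborel borel ((+) (h n))) f" using fi by (simp only: lborel_distr_plus)
    then show ?thesis by (subst (asm) integrable_distr_eq) (auto simp: f_def)
  qed
  have shift: "osc_int b f (t n) = - osc_int b (\<lambda>w. f (h n + w)) (t n)" if tn: "0 < t n" for n
  proof -
    have m: "(\<lambda>w. f w *\<^sub>R cis (2 * pi * t n * (b \<bullet> w))) \<in> borel_measurable borel"
      using borel_measurable_integrable[OF osc_integrable[OF fi]] by simp
    have "osc_int b f (t n) =
        (LINT w|distr lborel borel ((+) (h n)). f w *\<^sub>R cis (2 * pi * t n * (b \<bullet> w)))"
      by (simp only: osc_int_def lborel_distr_plus)
    also have "\<dots> = (LINT w|lborel. f (h n + w) *\<^sub>R cis (2 * pi * t n * (b \<bullet> (h n + w))))"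
      by (rule integral_distr) (use m in auto)
    also have "\<dots> = (LINT w|lborel. - (f (h n + w) *\<^sub>R cis (2 * pi * t n * (b \<bullet> w))))"
    proof (rule Bochner_Integration.integral_cong[OF refl])
      fix w
      have bb: "b \<bullet> b = 1" using b by (simp add: norm_eq_1)
      have "2 * pi * t n * (b \<bullet> (h n + w)) = pi + 2 * pi * t n * (b \<bullet> w)"
        using tn by (simp add: h_def inner_add_right bb field_simps)
      then have "cis (2 * pi * t n * (b \<bullet> (h n + w))) = cis pi * cis (2 * pi * t n * (b \<bullet> w))"
        by (simp only: cis_mult)
      then show "f (h n + w) *\<^sub>R cis (2 * pi * t n * (b \<bullet> (h n + w))) =
        - (f (h n + w) *\<^sub>R cis (2 * pi * t n * (b \<bullet> w)))" by simp
    qed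
    also have "\<dots> = - osc_int b (\<lambda>w. f (h n + w)) (t n)" by (simp add: osc_int_def)
    finally show ?thesis .
  qed
  have bd: "norm (osc_int b f (t n)) \<le> (LINT w|lborel. \<bar>f w - f (h n + w)\<bar>)" if "0 < t n" for n
  proof -
    \<comment> \<open>The integral equals minus that of the translate, so twice the integral belongs
      to the difference.\<close>
    have "2 * osc_int b f (t n) = osc_int b (\<lambda>w. f w - f (h n + w)) (t n)"
      using shift[OF that] by (simp add: osc_int_diff fi fhi)
    then have "norm (2 * osc_int b f (t n)) \<le> (LINT w|lborel. \<bar>f w - f (h n + w)\<bar>)"
      using norm_osc_int_le[OF Bochner_Integration.integrable_diff[OF fi fhi], of b n "t n"] by simp
    then have "2 * norm (osc_int b f (t n)) \<le> (LINT w|lborel. \<bar>f w - f (h n + w)\<bar>)"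
      by (simp add: norm_mult)
    then show ?thesis using norm_ge_zero[of "osc_int b f (t n)"] by linarith
  qed
  have "(\<lambda>n. LINT w|lborel. \<bar>f w - f (h n + w)\<bar>) \<longlonglongrightarrow> (LINT w|(lborel::'b measure). (0::real))"
  \<comment> \<open>The box and all its translates by the bounded shifts lie in one ball, of radius
    R + H, which supplies the dominating function.\<close>
  proof (rule integral_dominated_convergence[where w="indicator (cball 0 (R + H))"])
    show "(\<lambda>w. \<bar>f w - f (h n + w)\<bar>) \<in> borel_measurable lborel" for n
      using fi fhi[of n] by (auto simp: f_def)
    show "integrable lborel (indicator (cball 0 (R + H)) :: 'b \<Rightarrow> real)"
      by (intro integrable_indicator_bounded) auto
    show "AE x in lborel. norm \<bar>f x - f (h n + x)\<bar> \<le> indicator (cball 0 (R + H)) x" for n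
    proof (intro AE_I2)
      fix x :: 'b
      have "norm x \<le> norm (h n + x) + norm (h n)"
        using norm_triangle_ineq4[of "h n + x" "h n"] by simp
      moreover have "0 \<le> H" using H[of 0] norm_ge_zero order_trans by blast
      ultimately show "norm \<bar>f x - f (h n + x)\<bar> \<le> indicator (cball 0 (R + H)) x"
        using R[of x] R[of "h n + x"] H[of n] by (auto simp: f_def indicator_def)
    qed
    \<comment> \<open>Translation is continuous in L1 here for an elementary reason: off the
      boundary of the box, a null set, the indicator is locally constant.\<close>
    have "AE x in lborel. x \<notin> cbox p q - box p q"
      by (rule AE_not_in[OF null_sets_cbox_Diff_box])
    then show "AE x in lborel. (\<lambda>n. \<bar>f x - f (h n + x)\<bar>) \<longlonglongrightarrow> 0"
    proof eventually_elim
      case (elim x)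
      have hx: "(\<lambda>n. h n + x) \<longlonglongrightarrow> x" using tendsto_add[OF h0 tendsto_const[of x]] by simp
      have "eventually (\<lambda>n. f (h n + x) = f x) sequentially"
      proof (cases "x \<in> box p q")
        case True
        then have "eventually (\<lambda>n. h n + x \<in> box p q) sequentially"
          using topological_tendstoD[OF hx open_box] by blast
        then show ?thesis by eventually_elim (use True in \<open>simp add: f_def\<close>)
      next
        case False
        then have "x \<in> - cbox p q" using elim by auto
        then have "eventually (\<lambda>n. h n + x \<in> - cbox p q) sequentially"
          using topological_tendstoD[OF hx open_Compl[OF closed_cbox]] by blast
        then show ?thesis
          by eventually_elim (use False box_subset_cbox[of p q] in \<open>auto simp: f_def indicator_def\<close>)
      qed
      then have "eventually (\<lambda>n. \<bar>f x - f (h n + x)\<bar> = 0) sequentially"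
        by eventually_elim simp
      then show ?case by (simp add: tendsto_eventually)
    qed
  qed auto
  then have lim: "(\<lambda>n. LINT w|lborel. \<bar>f w - f (h n + w)\<bar>) \<longlonglongrightarrow> 0" by simp
  have "eventually (\<lambda>n. norm (osc_int b f (t n)) \<le> (LINT w|lborel. \<bar>f w - f (h n + w)\<bar>)) sequentially"
    using filterlim_at_top_dense[THEN iffD1, OF t, rule_format, of 0]
    by eventually_elim (rule bd)
  then have "(\<lambda>n. osc_int b f (t n)) \<longlonglongrightarrow> 0" by (rule Lim_null_comparison[OF _ lim])
  then show ?thesis by (simp add: f_def)
qed

text \<open>Dynkin's argument from boxes, which are stable under intersection, to Borel sets. The
  fixed box keeps every indicator integrable, so complements can be taken by subtraction.\<close>

lemma osc_int_set_Int_box: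
  fixes b :: "'b::euclidean_space"
  assumes b: "norm b = 1" and t: "filterlim t at_top sequentially" and A: "A \<in> sets borel"
  shows "(\<lambda>n. osc_int b (indicator (A \<inter> box p q)) (t n)) \<longlonglongrightarrow> 0"
proof -
  have fin: "integrable lborel (indicator (A \<inter> box p q) :: 'b \<Rightarrow> real)" if "A \<in> sets borel" for A
    using that by (intro integrable_indicator_bounded) (auto intro: bounded_Int)
  have A': "A \<in> sigma_sets UNIV (range (\<lambda>(a, b). box a b :: 'b set))"
    using A by (subst (asm) borel_eq_box) simp
  have ss: "sigma_sets UNIV (range (\<lambda>(a, b). box a b :: 'b set)) = sets borel"
    by (subst borel_eq_box) simp
  have stab: "Int_stable (range (\<lambda>(a, b). box a b :: 'b set))"
    by (auto simp: Int_stable_def box_Int_box)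
  have subset_Pow: "range (\<lambda>(a, b). box a b :: 'b set) \<subseteq> Pow UNIV" by simp
  show ?thesis
    using stab subset_Pow A'
  proof (induction rule: sigma_sets_induct_disjoint)
    case (basic A)
    then obtain u v where "A = box u v" by auto
    then show ?case using osc_int_box[OF b t] by (auto simp: box_Int_box)
  next
    case empty
    then show ?case by (simp add: osc_int_def)
  next
    case (compl A)
    then have A: "A \<in> sets borel" by (simp add: ss)
    have "indicator ((UNIV - A) \<inter> box p q) = (\<lambda>w. indicator (box p q) w - indicator (A \<inter> box p q) w :: real)"
      by (auto simp: indicator_def fun_eq_iff)
    then have "osc_int b (indicator ((UNIV - A) \<inter> box p q)) (t n) =
        osc_int b (indicator (box p q)) (t n) - osc_int b (indicator (A \<inter> box p q)) (t n)" for n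
      using osc_int_diff[OF _ fin[OF A], of "indicator (box p q)"]
        integrable_indicator_bounded[of "box p q"] by simp
    then show ?case using tendsto_diff[OF osc_int_box[OF b t, of p q] compl(2)] by simp
  next
    case (union A)
    then have A: "A i \<in> sets borel" for i using ss by auto
    \<comment> \<open>Additivity handles finite unions; the countable union is then a dominated
      limit, with the fixed box as bound.\<close>
    have fs: "(\<lambda>n. osc_int b (indicator ((\<Union>i<m. A i) \<inter> box p q)) (t n)) \<longlonglongrightarrow> 0" for m
    proof (induction m)
      case 0
      then show ?case by (simp add: osc_int_def)
    next
      case (Suc m)
      have "A i \<inter> A m = {}" if "i < m" for i
        using union(1) that disjoint_family_onD[of A UNIV i m] by auto
      then have disj: "(\<Union>i<m. A i) \<inter> A m = {}" by blast
      have "indicator ((\<Union>i<Suc m. A i) \<inter> box p q) =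
        (\<lambda>w. indicator ((\<Union>i<m. A i) \<inter> box p q) w + indicator (A m \<inter> box p q) w :: real)"
      proof
        fix w
        have "w \<in> (\<Union>i<Suc m. A i) \<longleftrightarrow> w \<in> (\<Union>i<m. A i) \<or> w \<in> A m"
          by (simp only: lessThan_Suc UN_insert Un_iff disj_commute)
        moreover have "\<not> (w \<in> (\<Union>i<m. A i) \<and> w \<in> A m)" using disj by blast
        ultimately show "indicator ((\<Union>i<Suc m. A i) \<inter> box p q) w =
          (indicator ((\<Union>i<m. A i) \<inter> box p q) w + indicator (A m \<inter> box p q) w :: real)"
          unfolding indicator_def Int_iff by (simp del: UN_iff) blast
      qed
      then have "osc_int b (indicator ((\<Union>i<Suc m. A i) \<inter> box p q)) (t n) =
        osc_int b (indicator ((\<Union>i<m. A i) \<inter> box p q)) (t n) + osc_int b (indicator (A m \<inter> box p q)) (t n)" for n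
        using osc_int_add[OF fin[of "\<Union>i<m. A i"] fin[OF A[of m]]] A by simp
      then show ?case using tendsto_add[OF Suc union(3)[of m]] by simp
    qed
    show ?case
    proof (rule osc_int_limit[OF _ fs])
      show "integrable lborel (indicator ((\<Union>i<m. A i) \<inter> box p q) :: 'b \<Rightarrow> real)" for m
        using A by (intro fin) auto
      show "(\<lambda>m. indicator ((\<Union>i<m. A i) \<inter> box p q) x :: real) \<longlonglongrightarrow> indicator ((\<Union>i. A i) \<inter> box p q) x" for x
      proof -
        have "(\<lambda>m. indicator (\<Union>i<m. A i) x :: real) \<longlonglongrightarrow> indicator (\<Union>i. A i) x"
          by (rule LIMSEQ_indicator_UN)
        from tendsto_mult[OF this tendsto_const[of "indicator (box p q) x"]]
        show ?thesis by (simp add: indicator_inter_arith)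
      qed
      show "integrable lborel (indicator (box p q) :: 'b \<Rightarrow> real)"
        by (intro integrable_indicator_bounded) auto
      show "\<bar>indicator ((\<Union>i<m. A i) \<inter> box p q) x :: real\<bar> \<le> indicator (box p q) x" for m x
        by (auto simp: indicator_def)
      show "integrable lborel (indicator ((\<Union>i. A i) \<inter> box p q) :: 'b \<Rightarrow> real)"
        using A by (intro fin) auto
    qed
  qed
qed

text \<open>Sets of finite measure are exhausted by their intersections with growing cubes;
  linearity and dominated limits then reach every integrable f. The dominating function 2 |f| comes
  with the induction rule.\<close>

theorem Riemann_Lebesgue_ray:
  fixes f :: "'b::euclidean_space \<Rightarrow> real"
  assumes f: "integrable lborel f" and b: "norm b = 1" and t: "filterlim t at_top sequentially"
  shows "(\<lambda>n. osc_int b f (t n)) \<longlonglongrightarrow> 0"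
  using f
proof (induction rule: integrable_induct)
  case (base A c)
  have A: "A \<in> sets borel" using base by simp
  have iA: "integrable lborel (indicator A :: 'b \<Rightarrow> real)" using base by simp
  define B where "B k = box (- real k *\<^sub>R One) (real k *\<^sub>R One :: 'b)" for k
  have "(\<lambda>n. osc_int b (indicator A) (t n)) \<longlonglongrightarrow> 0"
  proof (rule osc_int_limit[where s="\<lambda>k. indicator (A \<inter> B k)"])
    show "(\<lambda>n. osc_int b (indicator (A \<inter> B k)) (t n)) \<longlonglongrightarrow> 0" for k
      unfolding B_def by (rule osc_int_set_Int_box[OF b t A])
    show "integrable lborel (indicator (A \<inter> B k) :: 'b \<Rightarrow> real)" for k
      by (rule Bochner_Integration.integrable_bound[OF iA]) (use A in \<open>auto simp: B_def indicator_def\<close>)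
    show "(\<lambda>k. indicator (A \<inter> B k) x :: real) \<longlonglongrightarrow> indicator A x" for x
    proof -
      obtain N :: nat where N: "norm x < real N" using reals_Archimedean2 by blast
      have "x \<in> B k" if "k \<ge> N" for k
      proof -
        have "\<bar>x \<bullet> i\<bar> < real k" if "i \<in> Basis" for i
          using Basis_le_norm[OF that, of x] N \<open>k \<ge> N\<close> by linarith
        then show ?thesis by (auto simp: B_def mem_box abs_less_iff minus_less_iff)
      qed
      then have "eventually (\<lambda>k. indicator (A \<inter> B k) x = (indicator A x :: real)) sequentially"
        by (auto simp: eventually_sequentially indicator_def intro!: exI[of _ N])
      then show ?thesis by (rule tendsto_eventually)
    qed
    show "\<bar>indicator (A \<inter> B k) x :: real\<bar> \<le> indicator A x" for k x by (auto simp: indicator_def)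
  qed (fact iA)+
  then have "(\<lambda>n. c *\<^sub>R osc_int b (indicator A) (t n)) \<longlonglongrightarrow> c *\<^sub>R 0" by (intro tendsto_intros)
  moreover have "osc_int b (\<lambda>x. indicator A x *\<^sub>R c) s = c *\<^sub>R osc_int b (indicator A) s" for s
    unfolding osc_int_def by (subst integral_scaleR_right[symmetric]) (simp_all add: mult.commute)
  ultimately show ?case by simp
next
  case (add f g)
  then show ?case using tendsto_add[OF add.IH] by (simp add: osc_int_add)
next
  case (lim f s)
  show ?case
  proof (rule osc_int_limit[OF lim(1) lim.IH])
    show "integrable lborel (\<lambda>x. 2 * \<bar>f x\<bar>)" using lim by simp
  qed (use lim in auto)
qed

subsection \<open>Laws with a density\<close>

text \<open>A hyperplane is Lebesgue null. The density enters the rest of the argument only through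
  this fact: it makes the covariance definite, and it keeps differences of independent copies of X
  out of the kernel of a nonzero form.\<close>

lemma distributed_AE_not_hyperplane:
  fixes X :: "'a \<Rightarrow> 'b::euclidean_space"
  assumes X: "distributed M lborel X p" and a: "a \<noteq> 0"
  shows "AE s in M. a \<bullet> X s \<noteq> c"
proof -
  have [measurable]: "X \<in> borel_measurable M" "p \<in> borel_measurable lborel"
    using X by (auto simp: distributed_def)
  have "{x. a \<bullet> x = c} \<in> null_sets lebesgue"
    using negligible_hyperplane[of a c] a by (simp add: negligible_iff_null_sets)
  moreover have "{x. a \<bullet> x = c} \<in> sets lborel" by simp
  ultimately have "{x. a \<bullet> x = c} \<in> null_sets lborel"
    by (simp add: null_sets_completion_iff)
  then have "AE x in lborel. a \<bullet> x \<noteq> c" using AE_not_in by fastforce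
  then have "AE x in density lborel p. a \<bullet> x \<noteq> c"
    by (subst AE_density) auto
  then have "AE x in distr M lborel X. a \<bullet> x \<noteq> c"
    by (subst distributed_distr_eq_density[OF X])
  then show ?thesis by (subst (asm) AE_distr_iff) auto
qed

subsection \<open>Square-integrable complex functions as a real inner product space\<close>

text \<open>Genuine functions rather than classes modulo null sets: only integrals are compared, and
  completeness of this space is never invoked.\<close>

definition L2 :: "'a measure \<Rightarrow> ('a \<Rightarrow> complex) set" where
  "L2 M = {g \<in> borel_measurable M. integrable M (\<lambda>s. (cmod (g s))\<^sup>2)}"

text \<open>Complex values are treated as points of the plane, so this is the real part of the
  Hermitian product; the regression objective and its dual involve only this real part.\<close>

definition ip :: "'a measure \<Rightarrow> ('a \<Rightarrow> complex) \<Rightarrow> ('a \<Rightarrow> complex) \<Rightarrow> real" where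
  "ip M g h = (LINT s|M. g s \<bullet> h s)"

definition nrm :: "'a measure \<Rightarrow> ('a \<Rightarrow> complex) \<Rightarrow> real" where
  "nrm M g = sqrt (ip M g g)"

lemma L2_measurable[measurable_dest]: "g \<in> L2 M \<Longrightarrow> g \<in> borel_measurable M"
  by (simp add: L2_def)

lemma L2_integrable: "g \<in> L2 M \<Longrightarrow> integrable M (\<lambda>s. (cmod (g s))\<^sup>2)"
  by (simp add: L2_def)

lemma ip_self: "ip M g g = (LINT s|M. (cmod (g s))\<^sup>2)"
  by (simp add: ip_def power2_norm_eq_inner)

lemma ip_self_nonneg: "0 \<le> ip M g g"
  by (simp add: ip_self)

lemma nrm_nonneg: "0 \<le> nrm M g"
  by (simp add: nrm_def ip_self_nonneg)

lemma nrm_power2: "(nrm M g)\<^sup>2 = ip M g g"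
  by (simp add: nrm_def ip_self_nonneg)

lemma ip_commute: "ip M g h = ip M h g"
  by (simp add: ip_def inner_commute)

lemma L2_norm_mult_integrable:
  assumes [measurable]: "g \<in> L2 M" "h \<in> L2 M"
  shows "integrable M (\<lambda>s. cmod (g s) * cmod (h s))"
  by (rule integral_Cauchy_Schwarz(1)) (auto intro: L2_integrable assms)

lemma ip_integrable:
  assumes [measurable]: "g \<in> L2 M" "h \<in> L2 M"
  shows "integrable M (\<lambda>s. g s \<bullet> h s)"
  by (rule Bochner_Integration.integrable_bound[OF L2_norm_mult_integrable[OF assms]])
    (auto simp: Cauchy_Schwarz_ineq2)

lemma ip_le_nrm:
  assumes [measurable]: "g \<in> L2 M" "h \<in> L2 M"
  shows "\<bar>ip M g h\<bar> \<le> nrm M g * nrm M h"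
proof -
  have "\<bar>ip M g h\<bar> \<le> (LINT s|M. \<bar>cmod (g s) * cmod (h s)\<bar>)"
    unfolding ip_def using L2_norm_mult_integrable[OF assms]
    by (intro order_trans[OF integral_abs_bound] integral_mono)
      (auto simp: Cauchy_Schwarz_ineq2 ip_integrable assms)
  also have "\<dots> \<le> nrm M g * nrm M h"
    unfolding nrm_def ip_self
    by (rule integral_Cauchy_Schwarz(2)) (auto intro: L2_integrable assms)
  finally show ?thesis .
qed

lemma L2_add:
  assumes [measurable]: "g \<in> L2 M" "h \<in> L2 M"
  shows "(\<lambda>s. g s + h s) \<in> L2 M"
proof -
  have "integrable M (\<lambda>s. (cmod (g s))\<^sup>2 + 2 * (g s \<bullet> h s) + (cmod (h s))\<^sup>2)"
    by (intro Bochner_Integration.integrable_add integrable_mult_right L2_integrable ip_integrable assms)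
  moreover have "(\<lambda>s. (cmod (g s))\<^sup>2 + 2 * (g s \<bullet> h s) + (cmod (h s))\<^sup>2) = (\<lambda>s. (cmod (g s + h s))\<^sup>2)"
    by (simp add: power2_norm_eq_inner inner_add_left inner_add_right inner_commute fun_eq_iff)
  ultimately show ?thesis by (auto simp: L2_def)
qed

lemma L2_scaleR: "g \<in> L2 M \<Longrightarrow> (\<lambda>s. c *\<^sub>R g s) \<in> L2 M"
  by (auto simp: L2_def power_mult_distrib)

lemma L2_diff:
  assumes "g \<in> L2 M" "h \<in> L2 M"
  shows "(\<lambda>s. g s - h s) \<in> L2 M"
  using L2_add[OF assms(1) L2_scaleR[OF assms(2), of "-1"]] by simp

lemma ip_add_left:
  "f \<in> L2 M \<Longrightarrow> g \<in> L2 M \<Longrightarrow> h \<in> L2 M \<Longrightarrow> ip M (\<lambda>s. f s + g s) h = ip M f h + ip M g h"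
  by (simp add: ip_def inner_add_left ip_integrable)

lemma ip_diff_left:
  "f \<in> L2 M \<Longrightarrow> g \<in> L2 M \<Longrightarrow> h \<in> L2 M \<Longrightarrow> ip M (\<lambda>s. f s - g s) h = ip M f h - ip M g h"
  by (simp add: ip_def inner_diff_left ip_integrable)

lemma ip_scaleR_left: "ip M (\<lambda>s. c *\<^sub>R f s) h = c * ip M f h"
  by (simp add: ip_def)

lemma ip_add_right:
  "f \<in> L2 M \<Longrightarrow> g \<in> L2 M \<Longrightarrow> h \<in> L2 M \<Longrightarrow> ip M h (\<lambda>s. f s + g s) = ip M h f + ip M h g"
  by (simp add: ip_def inner_add_right ip_integrable)

lemma ip_diff_right:
  "f \<in> L2 M \<Longrightarrow> g \<in> L2 M \<Longrightarrow> h \<in> L2 M \<Longrightarrow> ip M h (\<lambda>s. f s - g s) = ip M h f - ip M h g"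
  by (simp add: ip_def inner_diff_right ip_integrable)

lemma ip_scaleR_right: "ip M h (\<lambda>s. c *\<^sub>R f s) = c * ip M h f"
  by (simp add: ip_def)

lemmas ip_simps = ip_add_left ip_diff_left ip_scaleR_left ip_add_right ip_diff_right ip_scaleR_right
  L2_add L2_diff L2_scaleR

lemma nrm_diff_le:
  assumes "g \<in> L2 M" "h \<in> L2 M"
  shows "nrm M (\<lambda>s. g s - h s) \<le> nrm M g + nrm M h"
proof (rule power2_le_imp_le)
  have "(nrm M (\<lambda>s. g s - h s))\<^sup>2 = ip M g g - 2 * ip M g h + ip M h h"
    using assms by (simp add: nrm_power2 ip_simps ip_commute[of M h g])
  also have "\<dots> \<le> (nrm M g)\<^sup>2 + 2 * (nrm M g * nrm M h) + (nrm M h)\<^sup>2"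
    using ip_le_nrm[OF assms] by (simp add: nrm_power2)
  also have "\<dots> = (nrm M g + nrm M h)\<^sup>2" by (simp add: power2_eq_square algebra_simps)
  finally show "(nrm M (\<lambda>s. g s - h s))\<^sup>2 \<le> (nrm M g + nrm M h)\<^sup>2" .
qed (simp add: nrm_nonneg add_nonneg_nonneg)

lemma (in prob_space) L2_imp_integrable:
  assumes [measurable]: "g \<in> L2 M"
  shows "integrable M g"
proof (rule Bochner_Integration.integrable_bound)
  show "integrable M (\<lambda>s. (cmod (g s))\<^sup>2 + 1)" using L2_integrable[OF assms] by simp
  show "AE s in M. norm (g s) \<le> norm ((cmod (g s))\<^sup>2 + 1)"
  proof (intro AE_I2)
    fix s
    have "0 \<le> (cmod (g s) - 1)\<^sup>2" by simp
    then have "2 * cmod (g s) \<le> (cmod (g s))\<^sup>2 + 1" by (simp add: power2_eq_square algebra_simps)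
    then show "norm (g s) \<le> norm ((cmod (g s))\<^sup>2 + 1)" using norm_ge_zero[of "g s"]
      by (smt (verit) norm_ge_zero real_norm_def)
  qed
qed measurable

lemma (in prob_space) L2_bounded:
  assumes [measurable]: "g \<in> borel_measurable M" and "\<And>s. cmod (g s) \<le> c"
  shows "g \<in> L2 M"
proof -
  have "integrable M (\<lambda>s. (cmod (g s))\<^sup>2)"
    by (rule integrable_const_bound[where B="c\<^sup>2"]) (auto intro!: AE_I2 power_mono assms)
  then show ?thesis by (simp add: L2_def)
qed

lemma (in prob_space) integral_cmod_le_nrm:
  assumes [measurable]: "g \<in> L2 M"
  shows "(LINT s|M. cmod (g s)) \<le> nrm M g"
proof -
  have "(LINT s|M. \<bar>cmod (g s) * 1\<bar>) \<le> sqrt (LINT s|M. (cmod (g s))\<^sup>2) * sqrt (LINT s|M. 1\<^sup>2)"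
    by (rule integral_Cauchy_Schwarz(2)) (auto intro: L2_integrable assms)
  then show ?thesis by (simp add: nrm_def ip_self prob_space)
qed

lemma (in pair_sigma_finite) integrable_tensor:
  fixes f :: "'a \<Rightarrow> real" and g :: "'b \<Rightarrow> real"
  assumes f: "integrable M1 f" and g: "integrable M2 g"
  shows "integrable (M1 \<Otimes>\<^sub>M M2) (\<lambda>z. f (fst z) * g (snd z))"
    and "(LINT z|(M1 \<Otimes>\<^sub>M M2). f (fst z) * g (snd z)) = (LINT s|M1. f s) * (LINT s|M2. g s)"
proof -
  note [measurable] = borel_measurable_integrable[OF f] borel_measurable_integrable[OF g]
  show int: "integrable (M1 \<Otimes>\<^sub>M M2) (\<lambda>z. f (fst z) * g (snd z))"
  proof (rule Fubini_integrable)
    show "integrable M1 (\<lambda>x. LINT y|M2. norm (f (fst (x, y)) * g (snd (x, y))))"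
      using integrable_mult_left[OF integrable_norm[OF f], of "LINT y|M2. norm (g y)"]
      by (simp add: abs_mult)
    show "AE x in M1. integrable M2 (\<lambda>y. f (fst (x, y)) * g (snd (x, y)))"
      using g by simp
  qed measurable
  show "(LINT z|(M1 \<Otimes>\<^sub>M M2). f (fst z) * g (snd z)) = (LINT s|M1. f s) * (LINT s|M2. g s)"
    using integral_fst'[OF int] by simp
qed

lemma (in prob_space) pair_self: "pair_sigma_finite M M"
  by unfold_locales

subsection \<open>Bilinear forms given by an integral kernel\<close>

definition bil :: "'a measure \<Rightarrow> ('a \<times> 'a \<Rightarrow> 'v::euclidean_space) \<Rightarrow> ('a \<Rightarrow> complex) \<Rightarrow> ('a \<Rightarrow> complex) \<Rightarrow> 'v" where
  "bil M \<kappa> g h = (LINT z|(M \<Otimes>\<^sub>M M). (g (fst z) \<bullet> h (snd z)) *\<^sub>R \<kappa> z)"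

text \<open>W is a Hilbert-Schmidt weight: a kernel bounded pointwise by c W gives a bilinear form
  of norm at most c times the L2 norm of W. The weight may be unbounded because differentiating in S
  produces powers of |X - X'|.\<close>

locale weighted_prob_space = prob_space M for M :: "'a measure" +
  fixes W :: "'a \<times> 'a \<Rightarrow> real"
  assumes W_meas[measurable]: "W \<in> borel_measurable (M \<Otimes>\<^sub>M M)"
    and W_sq: "integrable (M \<Otimes>\<^sub>M M) (\<lambda>z. (W z)\<^sup>2)"
begin

sublocale MM: pair_sigma_finite M M by (rule pair_self)

text \<open>The constant is a parameter so that Lipschitz and Taylor estimates for kernels become
  domination with a small constant, and then estimates for forms by
  \<open>norm_bil_le\<close>.\<close>

definition dominated :: "real \<Rightarrow> ('a \<times> 'a \<Rightarrow> 'v::euclidean_space) \<Rightarrow> bool" where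
  "dominated c \<kappa> \<longleftrightarrow> \<kappa> \<in> borel_measurable (M \<Otimes>\<^sub>M M) \<and>
    (\<forall>z \<in> space (M \<Otimes>\<^sub>M M). norm (\<kappa> z) \<le> c * W z)"

definition W_nrm :: real where "W_nrm = sqrt (LINT z|(M \<Otimes>\<^sub>M M). (W z)\<^sup>2)"

lemma W_nrm_nonneg: "0 \<le> W_nrm" by (simp add: W_nrm_def)

lemma W_tensor:
  assumes [measurable]: "g \<in> L2 M" "h \<in> L2 M"
  shows "integrable (M \<Otimes>\<^sub>M M) (\<lambda>z. (cmod (g (fst z)) * cmod (h (snd z))) * W z)"
    and "(LINT z|(M \<Otimes>\<^sub>M M). \<bar>(cmod (g (fst z)) * cmod (h (snd z))) * W z\<bar>) \<le> nrm M g * nrm M h * W_nrm"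
proof -
  note [measurable] = L2_measurable[OF assms(1)] L2_measurable[OF assms(2)]
  have m: "(\<lambda>z. cmod (g (fst z)) * cmod (h (snd z))) \<in> borel_measurable (M \<Otimes>\<^sub>M M)" by measurable
  have sq: "integrable (M \<Otimes>\<^sub>M M) (\<lambda>z. (cmod (g (fst z)) * cmod (h (snd z)))\<^sup>2)"
    "(LINT z|(M \<Otimes>\<^sub>M M). (cmod (g (fst z)) * cmod (h (snd z)))\<^sup>2) = ip M g g * ip M h h"
    using MM.integrable_tensor[OF L2_integrable L2_integrable, OF assms]
    by (auto simp: power_mult_distrib ip_self)
  show "integrable (M \<Otimes>\<^sub>M M) (\<lambda>z. (cmod (g (fst z)) * cmod (h (snd z))) * W z)"
    by (rule integral_Cauchy_Schwarz(1)[OF m W_meas sq(1) W_sq])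
  have "(LINT z|(M \<Otimes>\<^sub>M M). \<bar>(cmod (g (fst z)) * cmod (h (snd z))) * W z\<bar>) \<le>
      sqrt (ip M g g * ip M h h) * W_nrm"
    unfolding W_nrm_def sq(2)[symmetric]
    by (rule integral_Cauchy_Schwarz(2)[OF m W_meas sq(1) W_sq])
  then show "(LINT z|(M \<Otimes>\<^sub>M M). \<bar>(cmod (g (fst z)) * cmod (h (snd z))) * W z\<bar>) \<le> nrm M g * nrm M h * W_nrm"
    by (simp add: nrm_def real_sqrt_mult)
qed

lemma dominated_pointwise:
  assumes "dominated c \<kappa>" "z \<in> space (M \<Otimes>\<^sub>M M)"
  shows "norm ((g (fst z) \<bullet> h (snd z)) *\<^sub>R \<kappa> z) \<le> c * (cmod (g (fst z)) * cmod (h (snd z)) * W z)"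
proof -
  have "norm ((g (fst z) \<bullet> h (snd z)) *\<^sub>R \<kappa> z) \<le> (cmod (g (fst z)) * cmod (h (snd z))) * (c * W z)"
    using assms unfolding dominated_def norm_scaleR
    by (intro mult_mono) (auto simp: Cauchy_Schwarz_ineq2)
  then show ?thesis by (simp add: mult_ac)
qed

lemma bil_integrable:
  assumes \<kappa>: "dominated c \<kappa>" and [measurable]: "g \<in> L2 M" "h \<in> L2 M"
  shows "integrable (M \<Otimes>\<^sub>M M) (\<lambda>z. (g (fst z) \<bullet> h (snd z)) *\<^sub>R \<kappa> z)"
proof -
  have \<kappa>m: "\<kappa> \<in> borel_measurable (M \<Otimes>\<^sub>M M)" using \<kappa> by (simp add: dominated_def)
  note [measurable] = L2_measurable[OF assms(2)] L2_measurable[OF assms(3)] \<kappa>m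
  have int: "integrable (M \<Otimes>\<^sub>M M) (\<lambda>z. c * (cmod (g (fst z)) * cmod (h (snd z)) * W z))"
    by (intro integrable_mult_right W_tensor assms)
  show ?thesis
  proof (rule Bochner_Integration.integrable_bound[OF int _ AE_I2])
    show "norm ((g (fst z) \<bullet> h (snd z)) *\<^sub>R \<kappa> z) \<le> norm (c * (cmod (g (fst z)) * cmod (h (snd z)) * W z))"
      if "z \<in> space (M \<Otimes>\<^sub>M M)" for z
      using dominated_pointwise[OF \<kappa> that, of g h] by (metis abs_ge_self order_trans real_norm_def)
  qed measurable
qed

text \<open>Cauchy-Schwarz on the product space: the tensor of |g| and |h| has L2 norm
  \<open>nrm M g * nrm M h\<close> and is paired with the weight.\<close>

lemma norm_bil_le:
  assumes \<kappa>: "dominated c \<kappa>" and c: "0 \<le> c" and g: "g \<in> L2 M" and h: "h \<in> L2 M"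
  shows "norm (bil M \<kappa> g h) \<le> c * W_nrm * nrm M g * nrm M h"
proof -
  have "norm (bil M \<kappa> g h) \<le> (LINT z|(M \<Otimes>\<^sub>M M). norm ((g (fst z) \<bullet> h (snd z)) *\<^sub>R \<kappa> z))"
    unfolding bil_def by (rule integral_norm_bound)
  also have "\<dots> \<le> (LINT z|(M \<Otimes>\<^sub>M M). c * \<bar>cmod (g (fst z)) * cmod (h (snd z)) * W z\<bar>)"
  proof (rule integral_mono)
    show "integrable (M \<Otimes>\<^sub>M M) (\<lambda>z. c * \<bar>cmod (g (fst z)) * cmod (h (snd z)) * W z\<bar>)"
      by (intro integrable_mult_right integrable_abs W_tensor g h)
    show "norm ((g (fst z) \<bullet> h (snd z)) *\<^sub>R \<kappa> z) \<le> c * \<bar>cmod (g (fst z)) * cmod (h (snd z)) * W z\<bar>"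
      if "z \<in> space (M \<Otimes>\<^sub>M M)" for z
      using dominated_pointwise[OF \<kappa> that, of g h] c
      by (meson abs_ge_self mult_left_mono order_trans)
  qed (intro integrable_norm bil_integrable[OF \<kappa> g h])
  also have "\<dots> = c * (LINT z|(M \<Otimes>\<^sub>M M). \<bar>cmod (g (fst z)) * cmod (h (snd z)) * W z\<bar>)"
    by simp
  also have "\<dots> \<le> c * (nrm M g * nrm M h * W_nrm)"
    by (intro mult_left_mono W_tensor c g h)
  finally show ?thesis by (simp add: mult_ac)
qed

lemma bil_diff_kernel:
  assumes "dominated c \<kappa>" "dominated c' \<kappa>'" "g \<in> L2 M" "h \<in> L2 M"
  shows "bil M (\<lambda>z. \<kappa> z - \<kappa>' z) g h = bil M \<kappa> g h - bil M \<kappa>' g h"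
  unfolding bil_def scaleR_diff_right
  by (intro Bochner_Integration.integral_diff bil_integrable[OF assms(1)] bil_integrable[OF assms(2)] assms)

lemma bil_diff_left:
  assumes "dominated c \<kappa>" "f \<in> L2 M" "g \<in> L2 M" "h \<in> L2 M"
  shows "bil M \<kappa> (\<lambda>s. f s - g s) h = bil M \<kappa> f h - bil M \<kappa> g h"
  unfolding bil_def inner_diff_left scaleR_diff_left
  by (intro Bochner_Integration.integral_diff bil_integrable[OF assms(1)] assms)

lemma bil_diff_right:
  assumes "dominated c \<kappa>" "f \<in> L2 M" "g \<in> L2 M" "h \<in> L2 M"
  shows "bil M \<kappa> f (\<lambda>s. g s - h s) = bil M \<kappa> f g - bil M \<kappa> f h"
  unfolding bil_def inner_diff_right scaleR_diff_left
  by (intro Bochner_Integration.integral_diff bil_integrable[OF assms(1)] assms)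

lemma bil_inner:
  assumes "dominated c \<kappa>" "g \<in> L2 M" "h \<in> L2 M"
  shows "bil M \<kappa> g h \<bullet> v = bil M (\<lambda>z. \<kappa> z \<bullet> v) g h"
  unfolding bil_def using bil_integrable[OF assms]
  by (subst integral_inner_left[symmetric]) (auto simp: mult.commute)

lemma bil_bounded_linear:
  assumes "bounded_linear F" "dominated c \<kappa>" "g \<in> L2 M" "h \<in> L2 M"
  shows "F (bil M \<kappa> g h) = bil M (\<lambda>z. F (\<kappa> z)) g h"
  unfolding bil_def
  using integral_bounded_linear[OF assms(1) bil_integrable[OF assms(2-4)]]
  by (simp add: linear_simps(5)[OF assms(1)])

end

subsection \<open>Duality for the regularised least-squares problem\<close>

definition character :: "real ^ 'n \<Rightarrow> real ^ 'n \<Rightarrow> complex" where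
  "character w x = exp (2 * of_real pi * \<i> * of_real (w \<bullet> x))"

lemma norm_character: "cmod (character w x) = 1"
proof -
  have "character w x = exp (\<i> * of_real (2 * pi * (w \<bullet> x)))" by (simp add: character_def mult_ac)
  then show ?thesis by (simp only: norm_exp_i_times)
qed

lemma character_diff: "character w (x - y) = character w x * cnj (character w y)"
  by (simp add: character_def exp_cnj inner_diff_right mult_exp_exp algebra_simps)

lemma measurable_character[measurable (raw)]:
  assumes [measurable]: "f \<in> borel_measurable N" "g \<in> borel_measurable N"
  shows "(\<lambda>z. character (f z) (g z)) \<in> borel_measurable N"
  unfolding character_def by measurable

lemma measurable_mult_vec[measurable (raw)]:
  fixes U :: "real ^ 'n ^ 'n"
  assumes [measurable]: "f \<in> borel_measurable N"
  shows "(\<lambda>z. U *v f z) \<in> borel_measurable N"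
  by (rule measurable_compose[OF assms borel_measurable_continuous_onI])
    (intro linear_continuous_on, simp add: matrix_vector_mul_bounded_linear)

lemma qform_measurable[measurable (raw)]:
  assumes [measurable]: "f \<in> borel_measurable N"
  shows "(\<lambda>z. qform S (f z)) \<in> borel_measurable N"
  unfolding qform_def by measurable

text \<open>The smoothness of the profile enters as inequalities on the half-line: B1 plays the role
  of a bound for the first derivative, B2 for the second. \<open>factor\<close> guarantees that the
  matrix selected in \<open>calJ\<close> exists for every form in the cone.\<close>

locale kernel_regression = prob_space M for M :: "'a measure" +
  fixes X :: "'a \<Rightarrow> real ^ 'n" and Y :: "'a \<Rightarrow> complex"
    and kV :: "real ^ 'n \<Rightarrow> real" and lam :: real
    and Kc Kc' :: "real \<Rightarrow> real" and B1 B2 :: real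
  assumes X_meas[measurable]: "X \<in> borel_measurable M"
    and Y_L2: "Y \<in> L2 M"
    and lam_pos: "0 < lam"
    and X8: "integrable M (\<lambda>s. norm (X s) ^ 8)"
    and kV_pos: "\<And>w. 0 < kV w"
    and kV_int: "integrable lborel kV" and kV_one: "(LINT w|lborel. kV w) = 1"
    and kernel_eq: "\<And>x. kernel_fun kV x = complex_of_real (Kc (V_normsq M X x))"
    and Kc_lip: "\<And>a b. 0 \<le> a \<Longrightarrow> 0 \<le> b \<Longrightarrow> \<bar>Kc b - Kc a\<bar> \<le> B1 * \<bar>b - a\<bar>"
    and Kc_taylor: "\<And>a b. 0 \<le> a \<Longrightarrow> 0 \<le> b \<Longrightarrow> \<bar>Kc b - Kc a - Kc' a * (b - a)\<bar> \<le> B2 * (b - a)\<^sup>2"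
    and Kc'_bound: "\<And>a. 0 \<le> a \<Longrightarrow> \<bar>Kc' a\<bar> \<le> B1"
    and Kc'_lip: "\<And>a b. 0 \<le> a \<Longrightarrow> 0 \<le> b \<Longrightarrow> \<bar>Kc' b - Kc' a\<bar> \<le> B2 * \<bar>b - a\<bar>"
    and B_nonneg: "0 \<le> B1" "0 \<le> B2"
    and factor: "\<And>S :: real ^ 'n ^ 'n. S \<in> Sym_nonneg \<Longrightarrow> \<exists>U. \<forall>x. qform S x = V_normsq M X (U *v x)"
begin

text \<open>One weight for three kernels: the fourth power covers second-order terms in S, the sum
  also dominates the square in first-order terms, and the 1 covers the kernel itself.\<close>

definition diff4 :: "'a \<times> 'a \<Rightarrow> real" where
  "diff4 z = 1 + norm (X (fst z) - X (snd z)) ^ 4"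

lemma Y_meas[measurable]: "Y \<in> borel_measurable M"
  using Y_L2 by measurable

lemma diff8_integrable: "integrable (M \<Otimes>\<^sub>M M) (\<lambda>z. norm (X (fst z) - X (snd z)) ^ 8)"
proof -
  interpret MM: pair_sigma_finite M M by (rule pair_self)
  have "integrable (M \<Otimes>\<^sub>M M) (\<lambda>z. norm (X (fst z)) ^ 8)" "integrable (M \<Otimes>\<^sub>M M) (\<lambda>z. norm (X (snd z)) ^ 8)"
    using MM.integrable_tensor(1)[OF X8, of "\<lambda>_. 1"] MM.integrable_tensor(1)[OF _ X8, of "\<lambda>_. 1"] by auto
  then have int: "integrable (M \<Otimes>\<^sub>M M) (\<lambda>z. 256 * (norm (X (fst z)) ^ 8 + norm (X (snd z)) ^ 8))"
    by simp
  show ?thesis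
  proof (rule Bochner_Integration.integrable_bound[OF int _ AE_I2])
    fix z
    define a b where "a = norm (X (fst z))" and "b = norm (X (snd z))"
    have ab: "0 \<le> a" "0 \<le> b" by (auto simp: a_def b_def)
    have "norm (X (fst z) - X (snd z)) \<le> 2 * max a b"
      using norm_triangle_ineq4[of "X (fst z)" "X (snd z)"] by (simp add: a_def b_def)
    then have "norm (X (fst z) - X (snd z)) ^ 8 \<le> (2 * max a b) ^ 8"
      by (rule power_mono) simp
    also have "\<dots> = 256 * (max a b) ^ 8" by (simp add: power_mult_distrib)
    also have "\<dots> \<le> 256 * (a ^ 8 + b ^ 8)" using ab by (auto simp: max_def)
    finally show "norm (norm (X (fst z) - X (snd z)) ^ 8) \<le>
      norm (256 * (norm (X (fst z)) ^ 8 + norm (X (snd z)) ^ 8))"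
      by (simp add: a_def b_def)
  qed measurable
qed

sublocale weighted_prob_space M diff4
proof
  show [measurable]: "diff4 \<in> borel_measurable (M \<Otimes>\<^sub>M M)" unfolding diff4_def by measurable
  have int: "integrable (M \<Otimes>\<^sub>M M) (\<lambda>z. 2 + 2 * norm (X (fst z) - X (snd z)) ^ 8)"
  proof -
    interpret P: pair_prob_space M M ..
    show ?thesis using diff8_integrable by (intro Bochner_Integration.integrable_add) auto
  qed
  show "integrable (M \<Otimes>\<^sub>M M) (\<lambda>z. (diff4 z)\<^sup>2)"
  proof (rule Bochner_Integration.integrable_bound[OF int _ AE_I2])
    fix z
    define a where "a = norm (X (fst z) - X (snd z)) ^ 4"
    have "(1 + a)\<^sup>2 \<le> 2 + 2 * a\<^sup>2"
      using zero_le_power2[of "1 - a"] by (simp add: power2_eq_square algebra_simps)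
    moreover have "a\<^sup>2 = norm (X (fst z) - X (snd z)) ^ 8" by (simp add: a_def flip: power_mult)
    ultimately show "norm ((diff4 z)\<^sup>2) \<le> norm (2 + 2 * norm (X (fst z) - X (snd z)) ^ 8)"
      by (simp add: diff4_def a_def)
  qed measurable
qed

section \<open>Fourier representation of the kernel operator\<close>

definition hat :: "real ^ 'n ^ 'n \<Rightarrow> ('a \<Rightarrow> complex) \<Rightarrow> real ^ 'n \<Rightarrow> complex" where
  "hat U g w = (LINT s|M. g s * cnj (character w (U *v X s)))"

text \<open>Evaluates at the points U X a function given by its Fourier transform. It is adjoint to
  \<open>hat\<close>, which transforms the push-forward under U X of the measure with density
  g.\<close>

definition synth :: "real ^ 'n ^ 'n \<Rightarrow> (real ^ 'n \<Rightarrow> complex) \<Rightarrow> 'a \<Rightarrow> complex" where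
  "synth U \<phi> s = (LINT w|lborel. \<phi> w * character w (U *v X s))"

lemma pair_lborel: "pair_sigma_finite M (lborel :: (real ^ 'n) measure)"
  by (intro pair_sigma_finite.intro) unfold_locales

lemma hat_measurable[measurable]:
  assumes [measurable]: "g \<in> borel_measurable M"
  shows "hat U g \<in> borel_measurable borel"
proof -
  have [measurable]: "cnj \<in> borel_measurable borel"
    by (intro borel_measurable_continuous_onI continuous_intros)
  have "(\<lambda>w. LINT s|M. g s * cnj (character w (U *v X s))) \<in> borel_measurable lborel"
    by measurable
  then show ?thesis by (simp add: hat_def[abs_def])
qed

lemma norm_hat_le: "cmod (hat U g w) \<le> (LINT s|M. cmod (g s))"
  unfolding hat_def by (rule order_trans[OF integral_norm_bound]) (simp add: norm_mult norm_character)

lemma synth_measurable[measurable]: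
  assumes [measurable]: "\<phi> \<in> borel_measurable borel"
  shows "synth U \<phi> \<in> borel_measurable M"
  unfolding synth_def[abs_def] by measurable

lemma norm_synth_le: "cmod (synth U \<phi> s) \<le> (LINT w|lborel. cmod (\<phi> w))"
  unfolding synth_def by (rule order_trans[OF integral_norm_bound]) (simp add: norm_mult norm_character)

lemma synth_L2:
  assumes "\<phi> \<in> borel_measurable borel"
  shows "synth U \<phi> \<in> L2 M"
  by (rule L2_bounded[OF synth_measurable[OF assms] norm_synth_le])

lemma ip_synth:
  assumes g: "integrable M g" and \<phi>: "integrable lborel \<phi>"
  shows "ip M g (synth U \<phi>) = (LINT w|lborel. Re (\<phi> w * cnj (hat U g w)))"
proof -
  interpret P: pair_sigma_finite M "lborel :: (real ^ 'n) measure" by (rule pair_lborel)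
  note [measurable] = borel_measurable_integrable[OF g] borel_measurable_integrable[OF \<phi>]
  have [measurable]: "cnj \<in> borel_measurable borel"
    by (intro borel_measurable_continuous_onI continuous_intros)
  define F where "F s w = cnj (g s) * (\<phi> w * character w (U *v X s))" for s w
  have int: "integrable (M \<Otimes>\<^sub>M lborel) (case_prod F)"
  proof (rule Bochner_Integration.integrable_bound)
    show "integrable (M \<Otimes>\<^sub>M lborel) (\<lambda>z. cmod (g (fst z)) * cmod (\<phi> (snd z)))"
      by (intro P.integrable_tensor integrable_norm g \<phi>)
    show "AE z in M \<Otimes>\<^sub>M lborel. norm (case_prod F z) \<le> norm (cmod (g (fst z)) * cmod (\<phi> (snd z)))"
      by (intro AE_I2) (auto simp: F_def norm_mult norm_character)
    show "case_prod F \<in> borel_measurable (M \<Otimes>\<^sub>M lborel)"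
      unfolding F_def split_def by measurable
  qed
  have inner: "g s \<bullet> synth U \<phi> s = Re (LINT w|lborel. F s w)" for s
    unfolding F_def synth_def by (simp add: inner_complex_def)
  have cnjhat: "(LINT s|M. F s w) = \<phi> w * cnj (hat U g w)" for w
  proof -
    have "(LINT s|M. F s w) = (LINT s|M. \<phi> w * cnj (g s * cnj (character w (U *v X s))))"
      unfolding F_def by (intro Bochner_Integration.integral_cong refl) (simp add: mult_ac)
    also have "\<dots> = \<phi> w * (LINT s|M. cnj (g s * cnj (character w (U *v X s))))"
      by (rule integral_mult_right_zero)
    also have "(LINT s|M. cnj (g s * cnj (character w (U *v X s)))) = cnj (hat U g w)"
      unfolding hat_def by (rule Bochner_Integration.integral_cnj)
    finally show ?thesis .
  qed
  have "ip M g (synth U \<phi>) = (LINT s|M. Re (LINT w|lborel. F s w))"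
    by (simp add: ip_def inner)
  also have "\<dots> = Re (LINT s|M. LINT w|lborel. F s w)"
    using P.integrable_fst[OF int] by (intro integral_Re)
  also have "\<dots> = Re (LINT w|lborel. LINT s|M. F s w)"
    by (simp only: P.Fubini_integral[OF int])
  also have "\<dots> = (LINT w|lborel. Re (LINT s|M. F s w))"
    using P.integrable_snd[OF int] by (intro integral_Re[symmetric])
  finally show ?thesis by (simp add: cnjhat)
qed

text \<open>Stated through S itself rather than through a factor U, so the dependence on S stays
  smooth at singular forms as well.\<close>

definition kern :: "real ^ 'n ^ 'n \<Rightarrow> 'a \<times> 'a \<Rightarrow> real" where
  "kern S z = Kc (qform S (X (fst z) - X (snd z)))"

definition T :: "real ^ 'n ^ 'n \<Rightarrow> ('a \<Rightarrow> complex) \<Rightarrow> 'a \<Rightarrow> complex" where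
  "T S g s = (LINT r|M. kern S (s, r) *\<^sub>R g r)"

definition Uof :: "real ^ 'n ^ 'n \<Rightarrow> real ^ 'n ^ 'n" where
  "Uof S = (SOME U. \<forall>x. qform S x = V_normsq M X (U *v x))"

lemma Uof: "S \<in> Sym_nonneg \<Longrightarrow> qform S x = V_normsq M X (Uof S *v x)"
  unfolding Uof_def by (drule factor, drule someI_ex) blast

lemma kernel_fun_Uof:
  assumes "S \<in> Sym_nonneg"
  shows "kernel_fun kV (Uof S *v (X s - X r)) = complex_of_real (kern S (s, r))"
  by (simp add: kernel_eq kern_def Uof[OF assms])

lemma kernel_fun_character: "kernel_fun kV x = (LINT w|lborel. character w x * of_real (kV w))"
  by (simp add: kernel_fun_def character_def inner_commute)

text \<open>K is the Fourier transform of a probability density. The bound is uniform in S, which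
  later makes the iteration rate uniform.\<close>

lemma abs_kern_le_1:
  assumes "S \<in> Sym_nonneg"
  shows "\<bar>kern S z\<bar> \<le> 1"
proof -
  have "cmod (kernel_fun kV x) \<le> (LINT w|lborel. kV w)" for x
    unfolding kernel_fun_character
    using kV_pos by (intro order_trans[OF integral_norm_bound])
      (simp add: norm_mult norm_character abs_of_pos)
  from this[of "Uof S *v (X (fst z) - X (snd z))"] show ?thesis
    by (simp add: kernel_fun_Uof[OF assms] kV_one)
qed

text \<open>Bounds on the profile are available only for nonnegative arguments; extending it by its
  value at 0 gives a continuous function on the line, and thereby measurability of the
  kernels.\<close>

lemma Kc_continuous: "continuous_on UNIV (\<lambda>r. Kc (max 0 r))"
proof (rule lipschitz_on_continuous_on[where L=B1], rule lipschitz_onI)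
  fix x y :: real
  have "dist (Kc (max 0 x)) (Kc (max 0 y)) \<le> B1 * \<bar>max 0 x - max 0 y\<bar>"
    unfolding dist_real_def by (rule Kc_lip) auto
  also have "\<dots> \<le> B1 * \<bar>x - y\<bar>" using B_nonneg by (intro mult_left_mono) auto
  finally show "dist (Kc (max 0 x)) (Kc (max 0 y)) \<le> B1 * dist x y" by (simp add: dist_real_def)
qed (use B_nonneg in auto)

lemma Kc'_continuous: "continuous_on UNIV (\<lambda>r. Kc' (max 0 r))"
proof (rule lipschitz_on_continuous_on[where L=B2], rule lipschitz_onI)
  fix x y :: real
  have "dist (Kc' (max 0 x)) (Kc' (max 0 y)) \<le> B2 * \<bar>max 0 x - max 0 y\<bar>"
    unfolding dist_real_def by (rule Kc'_lip) auto
  also have "\<dots> \<le> B2 * \<bar>x - y\<bar>" using B_nonneg by (intro mult_left_mono) auto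
  finally show "dist (Kc' (max 0 x)) (Kc' (max 0 y)) \<le> B2 * dist x y" by (simp add: dist_real_def)
qed (use B_nonneg in auto)

lemma kern_measurable:
  assumes "S \<in> Sym_nonneg"
  shows "kern S \<in> borel_measurable (M \<Otimes>\<^sub>M M)"
proof -
  have [measurable]: "(\<lambda>r. Kc (max 0 r)) \<in> borel_measurable borel"
    by (rule borel_measurable_continuous_onI[OF Kc_continuous])
  have "kern S = (\<lambda>z. Kc (max 0 (qform S (X (fst z) - X (snd z)))))"
    using assms by (auto simp: kern_def Sym_nonneg_def fun_eq_iff max_def)
  also have "\<dots> \<in> borel_measurable (M \<Otimes>\<^sub>M M)" by measurable
  finally show ?thesis .
qed

lemma dominated_kern:
  assumes "S \<in> Sym_nonneg"
  shows "dominated 1 (kern S)"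
  unfolding dominated_def
proof (intro conjI ballI)
  fix z
  have "1 \<le> diff4 z" by (simp add: diff4_def)
  then show "norm (kern S z) \<le> 1 * diff4 z" using abs_kern_le_1[OF assms, of z] by simp
qed (rule kern_measurable[OF assms])

lemma kV_meas[measurable]: "kV \<in> borel_measurable borel"
  using borel_measurable_integrable[OF kV_int] by simp

lemma kV_hat_integrable:
  assumes [measurable]: "g \<in> borel_measurable M"
  shows "integrable lborel (\<lambda>w. of_real (kV w) * hat U g w)"
proof (rule Bochner_Integration.integrable_bound)
  show "integrable lborel (\<lambda>w. kV w * (LINT s|M. cmod (g s)))" using kV_int by simp
  show "AE w in lborel. norm (of_real (kV w) * hat U g w) \<le> norm (kV w * (LINT s|M. cmod (g s)))"
    using norm_hat_le kV_pos by (intro AE_I2) (auto simp: norm_mult abs_mult intro!: mult_left_mono)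
qed measurable

text \<open>The Fourier integral of the kernel is inserted, the character of a difference splits,
  and Fubini exchanges the integrals. So T is \<open>hat\<close>, then weighting by
  \<open>kV\<close>, then the adjoint of \<open>hat\<close>; positivity and the link to H rest on
  this factorisation.\<close>

lemma T_eq_synth:
  assumes S: "S \<in> Sym_nonneg" and g: "g \<in> L2 M"
  shows "T S g = synth (Uof S) (\<lambda>w. of_real (kV w) * hat (Uof S) g w)"
proof
  fix s
  interpret P: pair_sigma_finite M "lborel :: (real ^ 'n) measure" by (rule pair_lborel)
  have gi: "integrable M g" by (rule L2_imp_integrable[OF g])
  note [measurable] = borel_measurable_integrable[OF gi]
  define U where "U = Uof S"
  define F where "F r w = g r * (character w (U *v X s - U *v X r) * of_real (kV w))" for r w
  have int: "integrable (M \<Otimes>\<^sub>M lborel) (case_prod F)"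
  proof (rule Bochner_Integration.integrable_bound)
    show "integrable (M \<Otimes>\<^sub>M lborel) (\<lambda>z. cmod (g (fst z)) * kV (snd z))"
      by (intro P.integrable_tensor integrable_norm gi kV_int)
    show "AE z in M \<Otimes>\<^sub>M lborel. norm (case_prod F z) \<le> norm (cmod (g (fst z)) * kV (snd z))"
      by (intro AE_I2) (auto simp: F_def norm_mult norm_character abs_mult)
    show "case_prod F \<in> borel_measurable (M \<Otimes>\<^sub>M lborel)"
      unfolding F_def split_def by measurable
  qed
  have 1: "(LINT w|lborel. F r w) = kern S (s, r) *\<^sub>R g r" for r
  proof -
    have "(LINT w|lborel. F r w) = g r * kernel_fun kV (U *v X s - U *v X r)"
      unfolding F_def kernel_fun_character by (rule integral_mult_right_zero)
    also have "U *v X s - U *v X r = U *v (X s - X r)" by (simp add: matrix_vector_mult_diff_distrib)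
    finally show ?thesis by (simp add: U_def kernel_fun_Uof[OF S] scaleR_conv_of_real)
  qed
  have 2: "(LINT r|M. F r w) = of_real (kV w) * hat U g w * character w (U *v X s)" for w
  proof -
    have "(LINT r|M. F r w) = (LINT r|M. (of_real (kV w) * character w (U *v X s)) * (g r * cnj (character w (U *v X r))))"
      unfolding F_def character_diff by (intro Bochner_Integration.integral_cong refl) (simp add: mult_ac)
    also have "\<dots> = (of_real (kV w) * character w (U *v X s)) * hat U g w"
      unfolding hat_def by (rule integral_mult_right_zero)
    finally show ?thesis by (simp add: mult_ac)
  qed
  show "T S g s = synth (Uof S) (\<lambda>w. of_real (kV w) * hat (Uof S) g w) s"
    using P.Fubini_integral[OF int] unfolding T_def synth_def 1 2 U_def by simp
qed

lemma hat_times_kV_measurable: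
  assumes "g \<in> L2 M"
  shows "(\<lambda>w. of_real (kV w) * hat U g w) \<in> borel_measurable borel"
  using L2_measurable[OF assms, measurable] by measurable

lemma T_L2: "S \<in> Sym_nonneg \<Longrightarrow> g \<in> L2 M \<Longrightarrow> T S g \<in> L2 M"
  by (simp add: T_eq_synth synth_L2 hat_times_kV_measurable)

definition Q :: "real ^ 'n ^ 'n \<Rightarrow> ('a \<Rightarrow> complex) \<Rightarrow> real" where
  "Q S g = ip M g (T S g)"

lemma kV_hat_sq_integrable:
  assumes "g \<in> L2 M"
  shows "integrable lborel (\<lambda>w. kV w * (cmod (hat U g w))\<^sup>2)"
proof (rule Bochner_Integration.integrable_bound)
  note [measurable] = L2_measurable[OF assms]
  show "integrable lborel (\<lambda>w. kV w * (LINT s|M. cmod (g s))\<^sup>2)" using kV_int by simp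
  show "AE w in lborel. norm (kV w * (cmod (hat U g w))\<^sup>2) \<le> norm (kV w * (LINT s|M. cmod (g s))\<^sup>2)"
    using norm_hat_le kV_pos
    by (intro AE_I2) (auto simp: abs_mult intro!: mult_left_mono power_mono)
  show "(\<lambda>w. kV w * (cmod (hat U g w))\<^sup>2) \<in> borel_measurable lborel" by measurable
qed

lemma Q_eq:
  assumes "S \<in> Sym_nonneg" "g \<in> L2 M"
  shows "Q S g = (LINT w|lborel. kV w * (cmod (hat (Uof S) g w))\<^sup>2)"
  unfolding Q_def T_eq_synth[OF assms]
  by (subst ip_synth[OF L2_imp_integrable[OF assms(2)] kV_hat_integrable[OF L2_measurable[OF assms(2)]]])
    (simp only: mult.assoc complex_norm_square[symmetric] of_real_mult[symmetric] Re_complex_of_real)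

lemma Q_nonneg: "S \<in> Sym_nonneg \<Longrightarrow> g \<in> L2 M \<Longrightarrow> 0 \<le> Q S g"
  using kV_pos by (simp add: Q_eq less_imp_le)

text \<open>This passes from the operator, where positivity is visible, to the kernel, where the
  dependence on S is visible.\<close>

lemma ip_T_eq_bil:
  assumes S: "S \<in> Sym_nonneg" and g: "g \<in> L2 M" and h: "h \<in> L2 M"
  shows "ip M g (T S h) = bil M (kern S) g h"
proof -
  have int: "integrable (M \<Otimes>\<^sub>M M) (\<lambda>z. (g (fst z) \<bullet> h (snd z)) *\<^sub>R kern S z)"
    by (rule bil_integrable[OF dominated_kern[OF S] g h])
  have "g s \<bullet> T S h s = (LINT r|M. (g s \<bullet> h r) *\<^sub>R kern S (s, r))" if "s \<in> space M" for s
  proof -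
    have m: "(\<lambda>r. kern S (s, r)) \<in> borel_measurable M"
      using kern_measurable[OF S] that by measurable
    have "integrable M (\<lambda>r. kern S (s, r) *\<^sub>R h r)"
      by (rule Bochner_Integration.integrable_bound[OF integrable_norm[OF L2_imp_integrable[OF h]]])
        (use m L2_measurable[OF h] abs_kern_le_1[OF S] in \<open>auto intro!: mult_left_le_one_le\<close>)
    then show ?thesis unfolding T_def by (subst integral_inner_right[symmetric]) (auto simp: mult.commute)
  qed
  then have "ip M g (T S h) = (LINT s|M. LINT r|M. (g s \<bullet> h r) *\<^sub>R kern S (s, r))"
    unfolding ip_def by (intro Bochner_Integration.integral_cong refl)
  also have "\<dots> = bil M (kern S) g h"
    using MM.integral_fst'[OF int] by (simp add: bil_def)
  finally show ?thesis .
qed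

lemma T_scaleR_add:
  assumes S: "S \<in> Sym_nonneg" and g: "g \<in> L2 M" and h: "h \<in> L2 M" and s: "s \<in> space M"
  shows "T S (\<lambda>s. g s + c *\<^sub>R h s) s = T S g s + c *\<^sub>R T S h s"
proof -
  have m: "(\<lambda>r. kern S (s, r)) \<in> borel_measurable M"
    using kern_measurable[OF S] s by measurable
  have int: "integrable M (\<lambda>r. kern S (s, r) *\<^sub>R f r)" if "f \<in> L2 M" for f
    by (rule Bochner_Integration.integrable_bound[OF integrable_norm[OF L2_imp_integrable[OF that]]])
      (use m L2_measurable[OF that] abs_kern_le_1[OF S] in \<open>auto intro!: mult_left_le_one_le\<close>)
  show ?thesis
    unfolding T_def using int[OF g] int[OF h]
    by (simp add: scaleR_add_right scaleR_left_commute[of _ c] del: scaleR_scaleR)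
qed

text \<open>The kernel is bounded by 1 and M is a probability measure, so the operator norm of T is
  at most 1 whatever S is.\<close>

lemma ip_T_T_le:
  assumes S: "S \<in> Sym_nonneg" and g: "g \<in> L2 M"
  shows "ip M (T S g) (T S g) \<le> ip M g g"
proof -
  have b: "cmod (T S g s) \<le> nrm M g" if s: "s \<in> space M" for s
  proof -
    have "cmod (T S g s) \<le> (LINT r|M. norm (kern S (s, r) *\<^sub>R g r))"
      unfolding T_def by (rule integral_norm_bound)
    also have "\<dots> \<le> (LINT r|M. cmod (g r))"
    proof (rule integral_mono')
      show "integrable M (\<lambda>r. cmod (g r))" by (intro integrable_norm L2_imp_integrable g)
      show "norm (kern S (s, r) *\<^sub>R g r) \<le> cmod (g r)" for r
        using abs_kern_le_1[OF S, of "(s, r)"] by (simp add: mult_left_le_one_le)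
    qed auto
    also have "\<dots> \<le> nrm M g" by (rule integral_cmod_le_nrm[OF g])
    finally show ?thesis .
  qed
  have "ip M (T S g) (T S g) \<le> (LINT s|M. (nrm M g)\<^sup>2)"
    unfolding ip_self using L2_integrable[OF T_L2[OF S g]]
    by (intro integral_mono) (auto intro!: power_mono b)
  then show ?thesis by (simp add: nrm_power2 prob_space)
qed

text \<open>Half the square of |a|, with a = Y - f(U X), is the supremum over g of the pairing of a
  with g minus half the square of |g|; minimising over f first turns the penalty into
  \<open>Q S g / (2 * lam)\<close>.\<close>

definition dual_obj :: "real ^ 'n ^ 'n \<Rightarrow> ('a \<Rightarrow> complex) \<Rightarrow> real" where
  "dual_obj S g = ip M Y g - ip M g g / 2 - Q S g / (2 * lam)"

text \<open>The gradient in g of the concave functional \<open>dual_obj S\<close>; it vanishes at a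
  maximiser.\<close>

definition resid :: "real ^ 'n ^ 'n \<Rightarrow> ('a \<Rightarrow> complex) \<Rightarrow> 'a \<Rightarrow> complex" where
  "resid S g s = Y s - g s - (1 / lam) *\<^sub>R T S g s"

lemma resid_L2: "S \<in> Sym_nonneg \<Longrightarrow> g \<in> L2 M \<Longrightarrow> resid S g \<in> L2 M"
  unfolding resid_def[abs_def] by (intro L2_diff L2_scaleR T_L2 Y_L2)

section \<open>Weak duality and the duality gap\<close>

abbreviation J where "J \<equiv> calJ M X Y kV lam"

lemma J_eq:
  "J S = Inf {1/2 * (LINT s|M. (cmod (Y s - f (Uof S *v X s)))\<^sup>2) + lam/2 * rkhs_normsq kV fh | f fh.
          rkhs_rep kV fh f}"
  by (simp add: calJ_def J_fun_def Uof_def)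

lemma objective_nonneg:
  "0 \<le> 1/2 * (LINT s|M. (cmod (Y s - f (Uof S *v X s)))\<^sup>2) + lam/2 * rkhs_normsq kV fh"
  unfolding rkhs_normsq_def using lam_pos less_imp_le[OF kV_pos]
  by (intro add_nonneg_nonneg mult_nonneg_nonneg integral_nonneg_AE AE_I2 divide_nonneg_nonneg) auto

lemma J_le_objective:
  assumes "rkhs_rep kV fh f"
  shows "J S \<le> 1/2 * (LINT s|M. (cmod (Y s - f (Uof S *v X s)))\<^sup>2) + lam/2 * rkhs_normsq kV fh"
  unfolding J_eq
  by (rule cInf_lower) (use assms objective_nonneg in \<open>auto intro!: bdd_belowI[of _ 0]\<close>)

lemma rkhs_rep_zero: "rkhs_rep kV (\<lambda>_. 0) (\<lambda>_. 0)"
  by (simp add: rkhs_rep_def)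

lemma J_ge:
  assumes "\<And>f fh. rkhs_rep kV fh f \<Longrightarrow>
    c \<le> 1/2 * (LINT s|M. (cmod (Y s - f (Uof S *v X s)))\<^sup>2) + lam/2 * rkhs_normsq kV fh"
  shows "c \<le> J S"
  unfolding J_eq by (rule cInf_greatest) (use assms rkhs_rep_zero in auto)

lemma J_nonneg: "0 \<le> J S"
  by (rule J_ge) (rule objective_nonneg)

lemma J_le: "J S \<le> ip M Y Y / 2"
  using J_le_objective[OF rkhs_rep_zero, of S] by (simp add: rkhs_normsq_def ip_self)

text \<open>Two Young inequalities: one in L2 for the data term, one at each frequency for the
  penalty.\<close>

lemma J_ge_dual:
  assumes S: "S \<in> Sym_nonneg" and g: "g \<in> L2 M"
  shows "dual_obj S g \<le> J S"
proof (rule J_ge)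
  fix f fh assume "rkhs_rep kV fh f"
  then have [measurable]: "fh \<in> borel_measurable borel"
    and fh: "integrable lborel (\<lambda>w. (cmod (fh w))\<^sup>2 / kV w)"
    and f: "\<And>x. f x = (LINT w|lborel. fh w * character w x)"
    by (auto simp: rkhs_rep_def character_def)
  define U where "U = Uof S"
  have fU: "f (U *v X s) = synth U fh s" for s by (simp add: f synth_def)
  have fhi: "integrable lborel fh"
  proof (rule Bochner_Integration.integrable_bound[OF Bochner_Integration.integrable_add[OF fh kV_int] _ AE_I2])
    fix w
    have k: "0 < kV w" by (rule kV_pos)
    \<comment> \<open>|fh| is the geometric mean of |fh|^2 / k and k, both integrable, so it is
      integrable itself.\<close>
    have "0 \<le> (cmod (fh w) - kV w)\<^sup>2 / kV w" using k by simp
    also have "\<dots> = (cmod (fh w))\<^sup>2 / kV w - 2 * cmod (fh w) + kV w"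
      using k by (simp add: power2_eq_square field_simps)
    finally have "cmod (fh w) \<le> (cmod (fh w))\<^sup>2 / kV w + kV w" using norm_ge_zero[of "fh w"] by linarith
    then show "norm (fh w) \<le> norm ((cmod (fh w))\<^sup>2 / kV w + kV w)" by simp
  qed simp
  have A: "synth U fh \<in> L2 M" by (rule synth_L2) simp
  have "ip M g (synth U fh) = (LINT w|lborel. Re (fh w * cnj (hat U g w)))"
    by (rule ip_synth[OF L2_imp_integrable[OF g] fhi])
  also have "\<dots> \<le> (LINT w|lborel. lam/2 * ((cmod (fh w))\<^sup>2 / kV w) + 1/(2*lam) * (kV w * (cmod (hat U g w))\<^sup>2))"
  proof (rule integral_mono')
    show "integrable lborel (\<lambda>w. lam/2 * ((cmod (fh w))\<^sup>2 / kV w) + 1/(2*lam) * (kV w * (cmod (hat U g w))\<^sup>2))"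
      by (intro Bochner_Integration.integrable_add integrable_mult_right fh kV_hat_sq_integrable g)
    fix w
    define a b k where "a = cmod (fh w)" and "b = cmod (hat U g w)" and "k = kV w"
    have k: "0 < k" by (simp add: k_def kV_pos)
    have "Re (fh w * cnj (hat U g w)) \<le> a * b"
      unfolding a_def b_def by (rule order_trans[OF complex_Re_le_cmod]) (simp add: norm_mult)
    also have "a * b \<le> lam/2 * (a\<^sup>2 / k) + 1/(2*lam) * (k * b\<^sup>2)"
    proof -
      \<comment> \<open>Weighting by lam and k makes the cross term a b and turns the squares into
        the densities of the penalty and of Q.\<close>
      have "0 \<le> (lam * a - k * b)\<^sup>2 / (2 * lam * k)" using lam_pos k by simp
      also have "\<dots> = lam/2 * (a\<^sup>2 / k) + 1/(2*lam) * (k * b\<^sup>2) - a * b"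
        using lam_pos k by (simp add: power2_eq_square field_simps)
      finally show ?thesis by simp
    qed
    finally show "Re (fh w * cnj (hat U g w)) \<le> lam/2 * ((cmod (fh w))\<^sup>2 / kV w) + 1/(2*lam) * (kV w * (cmod (hat U g w))\<^sup>2)"
      by (simp add: a_def b_def k_def)
    show "0 \<le> lam/2 * ((cmod (fh w))\<^sup>2 / kV w) + 1/(2*lam) * (kV w * (cmod (hat U g w))\<^sup>2)"
      using lam_pos kV_pos[of w] by simp
  qed
  also have "\<dots> = lam/2 * rkhs_normsq kV fh + Q S g / (2 * lam)"
    unfolding rkhs_normsq_def Q_eq[OF S g] U_def[symmetric]
    by (subst Bochner_Integration.integral_add[OF integrable_mult_right[OF fh]
          integrable_mult_right[OF kV_hat_sq_integrable[OF g]]], unfold integral_mult_right_zero) simp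
  finally have 1: "ip M g (synth U fh) \<le> lam/2 * rkhs_normsq kV fh + Q S g / (2 * lam)" .
  define d where "d = (\<lambda>s. Y s - synth U fh s)"
  have d: "d \<in> L2 M" unfolding d_def by (intro L2_diff Y_L2 A)
  have "0 \<le> ip M (\<lambda>s. d s - g s) (\<lambda>s. d s - g s)" by (rule ip_self_nonneg)
  also have "\<dots> = ip M d d - 2 * ip M d g + ip M g g"
    using d g by (simp add: ip_simps ip_commute[of M g d])
  also have "ip M d g = ip M Y g - ip M g (synth U fh)"
    unfolding d_def using A g Y_L2 by (simp add: ip_simps ip_commute[of M g])
  also have "ip M d d = (LINT s|M. (cmod (Y s - f (Uof S *v X s)))\<^sup>2)"
    by (simp add: ip_self d_def fU U_def[symmetric])
  finally show "dual_obj S g \<le> 1/2 * (LINT s|M. (cmod (Y s - f (Uof S *v X s)))\<^sup>2) + lam/2 * rkhs_normsq kV fh"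
    using 1 unfolding dual_obj_def by simp
qed

text \<open>The frequency-wise Young inequality is an equality for fh = kV hat g / lam. For that f
  the primal residual Y - f(U X) is g plus the dual residual, so the two objectives differ by
  exactly half the square of the residual norm.\<close>

lemma J_le_dual:
  assumes S: "S \<in> Sym_nonneg" and g: "g \<in> L2 M"
  shows "J S \<le> dual_obj S g + (nrm M (resid S g))\<^sup>2 / 2"
proof -
  note [measurable] = L2_measurable[OF g]
  define U where "U = Uof S"
  define fh where "fh w = of_real (1/lam) * (of_real (kV w) * hat U g w)" for w
  define f where "f x = (LINT w|lborel. fh w * character w x)" for x
  have nf: "(cmod (fh w))\<^sup>2 / kV w = (1/lam)\<^sup>2 * (kV w * (cmod (hat U g w))\<^sup>2)" for w
    using kV_pos[of w] by (simp add: fh_def norm_mult norm_divide power2_eq_square)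
  have rep: "rkhs_rep kV fh f"
    unfolding rkhs_rep_def nf
  proof (intro conjI allI)
    show "fh \<in> borel_measurable lborel" unfolding fh_def by measurable
    show "integrable lborel (\<lambda>w. (1/lam)\<^sup>2 * (kV w * (cmod (hat U g w))\<^sup>2))"
      by (intro integrable_mult_right kV_hat_sq_integrable g)
    show "f x = (LINT w|lborel. fh w * exp (2 * of_real pi * \<i> * of_real (w \<bullet> x)))" for x
      by (simp add: f_def character_def)
  qed
  have ns: "rkhs_normsq kV fh = Q S g / lam\<^sup>2"
    unfolding rkhs_normsq_def nf by (simp add: Q_eq[OF S g] U_def power2_eq_square)
  define r where "r = resid S g"
  have r: "r \<in> L2 M" unfolding r_def by (rule resid_L2[OF S g])
  have fr: "Y s - f (U *v X s) = g s + r s" for s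
  proof -
    have "f (U *v X s) = (LINT w|lborel. of_real (1/lam) * (of_real (kV w) * hat U g w * character w (U *v X s)))"
      unfolding f_def fh_def by (simp only: mult.assoc)
    also have "\<dots> = of_real (1/lam) * (LINT w|lborel. of_real (kV w) * hat U g w * character w (U *v X s))"
      by (rule integral_mult_right_zero)
    also have "\<dots> = (1/lam) *\<^sub>R T S g s"
      unfolding T_eq_synth[OF S g] synth_def U_def by (simp add: scaleR_conv_of_real)
    finally show ?thesis by (simp add: r_def resid_def)
  qed
  have "J S \<le> 1/2 * ip M (\<lambda>s. g s + r s) (\<lambda>s. g s + r s) + lam/2 * (Q S g / lam\<^sup>2)"
    using J_le_objective[OF rep, of S] by (simp add: fr[unfolded U_def] ns ip_self)
  also have "ip M (\<lambda>s. g s + r s) (\<lambda>s. g s + r s) = ip M g g + 2 * ip M r g + ip M r r"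
    using g r by (simp add: ip_simps ip_commute[of M g r])
  also have "ip M r g = ip M Y g - ip M g g - Q S g / lam"
    unfolding r_def resid_def[abs_def] Q_def
    using g Y_L2 T_L2[OF S g] by (simp add: ip_simps ip_commute[of M "T S g"])
  also have "lam/2 * (Q S g / lam\<^sup>2) = Q S g / lam / 2"
    using lam_pos by (simp add: power2_eq_square field_simps)
  finally have "J S \<le> ip M Y g - ip M g g / 2 - Q S g / lam / 2 + ip M r r / 2"
    by (simp add: algebra_simps)
  then show ?thesis
    by (simp add: dual_obj_def nrm_power2 r_def mult.commute)
qed

subsection \<open>Approximate dual solutions\<close>

text \<open>One damped Richardson step for g + T g / lam = Y; the step size is the minimiser of
  (1 - \<tau>)^2 + (\<tau> / lam)^2.\<close>

lemma Richardson_step: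
  assumes S: "S \<in> Sym_nonneg" and g: "g \<in> L2 M"
  defines "\<tau> \<equiv> lam\<^sup>2 / (1 + lam\<^sup>2)"
  shows "\<exists>h \<in> L2 M. ip M (resid S h) (resid S h) \<le> (1 - \<tau>) * ip M (resid S g) (resid S g)"
proof
  define r where "r = resid S g"
  have r: "r \<in> L2 M" unfolding r_def by (rule resid_L2[OF S g])
  have Tr: "T S r \<in> L2 M" by (rule T_L2[OF S r])
  define h where "h = (\<lambda>s. g s + \<tau> *\<^sub>R r s)"
  show h: "h \<in> L2 M" unfolding h_def by (intro L2_add L2_scaleR g r)
  define u where "u = (\<lambda>s. (1 - \<tau>) *\<^sub>R r s - (\<tau> / lam) *\<^sub>R T S r s)"
  have p: "0 < lam\<^sup>2" "0 < 1 + lam\<^sup>2" using lam_pos by (auto simp: add_pos_pos)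
  then have "1 + 1 / lam\<^sup>2 = (1 + lam\<^sup>2) / lam\<^sup>2" by (simp add: add_divide_distrib)
  then have \<tau>: "0 < \<tau>" "\<tau> < 1" "\<tau> * (1 + 1 / lam\<^sup>2) = 1"
    unfolding \<tau>_def using p lam_pos by auto
  have "resid S h s = u s" if "s \<in> space M" for s
  proof -
    have "resid S h s = (Y s - g s - (1 / lam) *\<^sub>R T S g s) - \<tau> *\<^sub>R r s - (\<tau> / lam) *\<^sub>R T S r s"
      unfolding resid_def h_def T_scaleR_add[OF S g r that]
      by (simp add: scaleR_add_right)
    then show ?thesis by (simp add: u_def r_def resid_def[symmetric] scaleR_diff_left)
  qed
  then have "ip M (resid S h) (resid S h) = ip M u u"
    unfolding ip_def by (intro Bochner_Integration.integral_cong) auto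
  also have "\<dots> = (1 - \<tau>)\<^sup>2 * ip M r r - 2 * ((1 - \<tau>) * (\<tau> / lam) * Q S r) + (\<tau> / lam)\<^sup>2 * ip M (T S r) (T S r)"
    unfolding u_def Q_def using r Tr
    by (simp add: ip_simps ip_commute[of M "T S r" r] power2_eq_square algebra_simps
        diff_divide_distrib)
  also have "\<dots> \<le> (1 - \<tau>)\<^sup>2 * ip M r r + (\<tau> / lam)\<^sup>2 * ip M r r"
  proof -
    \<comment> \<open>Positivity of Q gives the cross term a favourable sign, and the norm bound for
      T does not involve S.\<close>
    have "0 \<le> (1 - \<tau>) * (\<tau> / lam) * Q S r"
      using \<tau> lam_pos Q_nonneg[OF S r] by simp
    moreover have "(\<tau> / lam)\<^sup>2 * ip M (T S r) (T S r) \<le> (\<tau> / lam)\<^sup>2 * ip M r r"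
      by (intro mult_left_mono ip_T_T_le[OF S r]) simp
    ultimately show ?thesis by linarith
  qed
  \<comment> \<open>By the choice of \<tau> the factor (1 - \<tau>)^2 + (\<tau> / lam)^2 collapses
    to 1 - \<tau>.\<close>
  also have "\<dots> = (1 - 2 * \<tau> + \<tau> * (\<tau> * (1 + 1 / lam\<^sup>2))) * ip M r r"
    by (simp add: power2_eq_square algebra_simps add_divide_distrib)
  also have "\<dots> = (1 - \<tau>) * ip M r r" by (simp add: \<tau>)
  finally show "ip M (resid S h) (resid S h) \<le> (1 - \<tau>) * ip M (resid S g) (resid S g)"
    by (simp add: r_def)
qed

text \<open>The iteration starts at Y and reduces the squared residual geometrically; stopping it
  suffices, so no limit in L2 is formed.\<close>

lemma exists_small_resid:
  assumes S: "S \<in> Sym_nonneg" and e: "0 < e"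
  shows "\<exists>g \<in> L2 M. nrm M (resid S g) \<le> e"
proof -
  define \<tau> where "\<tau> = lam\<^sup>2 / (1 + lam\<^sup>2)"
  have \<tau>: "0 < \<tau>" "\<tau> < 1" using lam_pos by (auto simp: \<tau>_def add_pos_pos)
  define c where "c = ip M (resid S Y) (resid S Y)"
  have it: "\<exists>g \<in> L2 M. ip M (resid S g) (resid S g) \<le> (1 - \<tau>) ^ n * c" for n
  proof (induction n)
    case 0
    then show ?case using Y_L2 by (auto simp: c_def)
  next
    case (Suc n)
    then obtain g where g: "g \<in> L2 M" "ip M (resid S g) (resid S g) \<le> (1 - \<tau>) ^ n * c" by blast
    obtain h where h: "h \<in> L2 M" "ip M (resid S h) (resid S h) \<le> (1 - \<tau>) * ip M (resid S g) (resid S g)"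
      using Richardson_step[OF S g(1)] by (auto simp: \<tau>_def)
    have "(1 - \<tau>) * ip M (resid S g) (resid S g) \<le> (1 - \<tau>) * ((1 - \<tau>) ^ n * c)"
      using g \<tau> by (intro mult_left_mono) auto
    with h show ?case by (intro bexI[of _ h]) auto
  qed
  have "(\<lambda>n. (1 - \<tau>) ^ n * c) \<longlonglongrightarrow> 0 * c"
    using \<tau> by (intro tendsto_mult LIMSEQ_power_zero tendsto_const) auto
  then have "eventually (\<lambda>n. (1 - \<tau>) ^ n * c < e\<^sup>2) sequentially"
    using e by (intro order_tendstoD(2)[where y="0 * c"]) auto
  then obtain n where n: "(1 - \<tau>) ^ n * c < e\<^sup>2" by (auto simp: eventually_sequentially)
  obtain g where g: "g \<in> L2 M" "ip M (resid S g) (resid S g) \<le> (1 - \<tau>) ^ n * c" using it by blast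
  then have "nrm M (resid S g) \<le> e"
    unfolding nrm_def using n e by (intro real_le_lsqrt) (auto simp: ip_self_nonneg)
  with g show ?thesis by blast
qed

text \<open>Coercivity: the identity g + T g / lam = Y - \<open>resid S g\<close> is paired with g,
  and the nonnegative term from T is dropped.\<close>

lemma nrm_le_of_resid:
  assumes S: "S \<in> Sym_nonneg" and g: "g \<in> L2 M"
  shows "nrm M g \<le> nrm M Y + nrm M (resid S g)"
proof -
  define r where "r = resid S g"
  have r: "r \<in> L2 M" unfolding r_def by (rule resid_L2[OF S g])
  have "(nrm M g)\<^sup>2 \<le> ip M g g + Q S g / lam"
    using Q_nonneg[OF S g] lam_pos by (simp add: nrm_power2)
  also have "\<dots> = ip M g (\<lambda>s. Y s - r s)"
    unfolding r_def resid_def[abs_def] Q_def using g Y_L2 T_L2[OF S g]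
    by (simp add: ip_simps)
  also have "\<dots> \<le> nrm M g * nrm M (\<lambda>s. Y s - r s)"
    using ip_le_nrm[OF g L2_diff[OF Y_L2 r]] by linarith
  also have "\<dots> \<le> nrm M g * (nrm M Y + nrm M r)"
    by (intro mult_left_mono nrm_diff_le Y_L2 r nrm_nonneg)
  finally have "nrm M g * nrm M g \<le> nrm M g * (nrm M Y + nrm M r)" by (simp add: power2_eq_square)
  then show ?thesis
    using nrm_nonneg[of M g] nrm_nonneg[of M Y] nrm_nonneg[of M r] unfolding r_def
    by (cases "nrm M g = 0") auto
qed

subsection \<open>The gradient of the optimal value\<close>

text \<open>The derivative of \<open>kern S z\<close> with respect to S, whose argument in the
  profile is linear in S.\<close>

definition grad_kern :: "real ^ 'n ^ 'n \<Rightarrow> 'a \<times> 'a \<Rightarrow> real ^ 'n ^ 'n" where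
  "grad_kern S z = Kc' (qform S (X (fst z) - X (snd z))) *\<^sub>R outer (X (fst z) - X (snd z))"

lemma grad_kern_measurable:
  assumes "S \<in> Sym_nonneg"
  shows "grad_kern S \<in> borel_measurable (M \<Otimes>\<^sub>M M)"
proof -
  have [measurable]: "(\<lambda>r. Kc' (max 0 r)) \<in> borel_measurable borel"
    by (rule borel_measurable_continuous_onI[OF Kc'_continuous])
  have [measurable]: "(outer :: real ^ 'n \<Rightarrow> _) \<in> borel_measurable borel"
    by (intro borel_measurable_continuous_onI continuous_intros)
  have "grad_kern S = (\<lambda>z. Kc' (max 0 (qform S (X (fst z) - X (snd z)))) *\<^sub>R outer (X (fst z) - X (snd z)))"
    using assms by (auto simp: grad_kern_def Sym_nonneg_def fun_eq_iff max_def)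
  also have "\<dots> \<in> borel_measurable (M \<Otimes>\<^sub>M M)" by measurable
  finally show ?thesis .
qed

lemma sq_le_diff4: "(norm (X (fst z) - X (snd z)))\<^sup>2 \<le> diff4 z"
proof -
  define a where "a = (norm (X (fst z) - X (snd z)))\<^sup>2"
  have "2 * a \<le> 1 + a\<^sup>2" using zero_le_power2[of "a - 1"] by (simp add: power2_eq_square algebra_simps)
  moreover have "0 \<le> a" by (simp add: a_def)
  moreover have "a\<^sup>2 = norm (X (fst z) - X (snd z)) ^ 4" by (simp add: a_def flip: power_mult)
  ultimately have "a \<le> 1 + norm (X (fst z) - X (snd z)) ^ 4" by linarith
  then show ?thesis by (simp add: diff4_def a_def)
qed

lemma pow4_le_diff4: "norm (X (fst z) - X (snd z)) ^ 4 \<le> diff4 z"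
  by (simp add: diff4_def)

lemma dominated_grad_kern:
  assumes "S \<in> Sym_nonneg"
  shows "dominated B1 (grad_kern S)"
  unfolding dominated_def
proof (intro conjI ballI grad_kern_measurable[OF assms])
  fix z
  have "\<bar>Kc' (qform S (X (fst z) - X (snd z)))\<bar> \<le> B1"
    using assms by (intro Kc'_bound) (auto simp: Sym_nonneg_def)
  then show "norm (grad_kern S z) \<le> B1 * diff4 z"
    unfolding grad_kern_def norm_scaleR norm_outer using sq_le_diff4[of z] B_nonneg
    by (intro mult_mono) auto
qed

lemma abs_qform_diff_le: "\<bar>qform S' x - qform S x\<bar> \<le> norm (S' - S) * (norm x)\<^sup>2"
  using abs_qform_le[of "S' - S" x] by (simp add: qform_diff_matrix)

lemma dominated_kern_diff:
  assumes S: "S \<in> Sym_nonneg" and S': "S' \<in> Sym_nonneg"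
  shows "dominated (B1 * norm (S' - S)) (\<lambda>z. kern S' z - kern S z)"
  unfolding dominated_def
proof (intro conjI ballI)
  show "(\<lambda>z. kern S' z - kern S z) \<in> borel_measurable (M \<Otimes>\<^sub>M M)"
    by (intro borel_measurable_diff kern_measurable S S')
  fix z
  define x where "x = X (fst z) - X (snd z)"
  have "norm (kern S' z - kern S z) \<le> B1 * \<bar>qform S' x - qform S x\<bar>"
    unfolding kern_def real_norm_def x_def[symmetric] using S S'
    by (intro Kc_lip) (auto simp: Sym_nonneg_def)
  also have "\<dots> \<le> B1 * (norm (S' - S) * diff4 z)"
    using B_nonneg sq_le_diff4[of z, folded x_def]
    by (intro mult_left_mono order_trans[OF abs_qform_diff_le]) auto
  finally show "norm (kern S' z - kern S z) \<le> B1 * norm (S' - S) * diff4 z" by (simp add: mult_ac)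
qed

text \<open>One square of |X - X'| comes from the rank-one matrix and another from the change in the
  argument of Kc', hence the fourth power in the weight.\<close>

lemma dominated_grad_kern_diff:
  assumes S: "S \<in> Sym_nonneg" and S': "S' \<in> Sym_nonneg"
  shows "dominated (B2 * norm (S' - S)) (\<lambda>z. grad_kern S' z - grad_kern S z)"
  unfolding dominated_def
proof (intro conjI ballI)
  show "(\<lambda>z. grad_kern S' z - grad_kern S z) \<in> borel_measurable (M \<Otimes>\<^sub>M M)"
    by (intro borel_measurable_diff grad_kern_measurable S S')
  fix z
  define x where "x = X (fst z) - X (snd z)"
  have "norm (grad_kern S' z - grad_kern S z) = \<bar>Kc' (qform S' x) - Kc' (qform S x)\<bar> * (norm x)\<^sup>2"
    unfolding grad_kern_def x_def[symmetric] scaleR_diff_left[symmetric] norm_scaleR norm_outer by simp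
  also have "\<dots> \<le> (B2 * \<bar>qform S' x - qform S x\<bar>) * (norm x)\<^sup>2"
    using S S' by (intro mult_right_mono Kc'_lip) (auto simp: Sym_nonneg_def)
  also have "\<dots> \<le> (B2 * (norm (S' - S) * (norm x)\<^sup>2)) * (norm x)\<^sup>2"
    using B_nonneg by (intro mult_right_mono mult_left_mono abs_qform_diff_le) auto
  also have "\<dots> = B2 * norm (S' - S) * norm x ^ 4"
    by (simp add: power2_eq_square power4_eq_xxxx mult_ac)
  also have "\<dots> \<le> B2 * norm (S' - S) * diff4 z"
    using B_nonneg pow4_le_diff4[of z, folded x_def] by (intro mult_left_mono) auto
  finally show "norm (grad_kern S' z - grad_kern S z) \<le> B2 * norm (S' - S) * diff4 z" .
qed

lemma dominated_grad_kern_inner: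
  assumes "S \<in> Sym_nonneg"
  shows "dominated (B1 * norm H) (\<lambda>z. grad_kern S z \<bullet> H)"
  unfolding dominated_def
proof (intro conjI ballI)
  show "(\<lambda>z. grad_kern S z \<bullet> H) \<in> borel_measurable (M \<Otimes>\<^sub>M M)"
    by (intro borel_measurable_inner grad_kern_measurable assms) simp
  fix z assume z: "z \<in> space (M \<Otimes>\<^sub>M M)"
  have "norm (grad_kern S z \<bullet> H) \<le> norm (grad_kern S z) * norm H" by (simp add: Cauchy_Schwarz_ineq2)
  also have "\<dots> \<le> (B1 * diff4 z) * norm H"
    using dominated_grad_kern[OF assms] z by (intro mult_right_mono) (auto simp: dominated_def)
  finally show "norm (grad_kern S z \<bullet> H) \<le> B1 * norm H * diff4 z" by (simp add: mult_ac)
qed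

lemma dominated_taylor:
  assumes S: "S \<in> Sym_nonneg" and S': "S' \<in> Sym_nonneg"
  shows "dominated (B2 * (norm (S' - S))\<^sup>2) (\<lambda>z. (kern S' z - kern S z) - grad_kern S z \<bullet> (S' - S))"
  unfolding dominated_def
proof (intro conjI ballI)
  show "(\<lambda>z. (kern S' z - kern S z) - grad_kern S z \<bullet> (S' - S)) \<in> borel_measurable (M \<Otimes>\<^sub>M M)"
    by (intro borel_measurable_diff borel_measurable_inner borel_measurable_const kern_measurable
        grad_kern_measurable S S')
  fix z
  define x where "x = X (fst z) - X (snd z)"
  have "grad_kern S z \<bullet> (S' - S) = Kc' (qform S x) * (qform S' x - qform S x)"
    by (simp add: grad_kern_def x_def[symmetric] qform_eq_inner inner_commute[of "outer x"] inner_diff_left)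
  then have "norm ((kern S' z - kern S z) - grad_kern S z \<bullet> (S' - S)) \<le> B2 * (qform S' x - qform S x)\<^sup>2"
    unfolding kern_def x_def[symmetric] real_norm_def using S S'
    by (simp only:) (intro Kc_taylor, auto simp: Sym_nonneg_def)
  also have "\<dots> \<le> B2 * (norm (S' - S) * (norm x)\<^sup>2)\<^sup>2"
    using B_nonneg abs_qform_diff_le[of S' x S]
    by (intro mult_left_mono) (auto simp: abs_le_square_iff[symmetric])
  also have "\<dots> = B2 * (norm (S' - S))\<^sup>2 * norm x ^ 4"
    by (simp add: power_mult_distrib mult_ac flip: power_mult)
  also have "\<dots> \<le> B2 * (norm (S' - S))\<^sup>2 * diff4 z"
    using B_nonneg pow4_le_diff4[of z, folded x_def] by (intro mult_left_mono) auto
  finally show "norm ((kern S' z - kern S z) - grad_kern S z \<bullet> (S' - S)) \<le> B2 * (norm (S' - S))\<^sup>2 * diff4 z" .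
qed

text \<open>S enters \<open>dual_obj S g\<close> only through Q, and this is the derivative in S
  with g held fixed. By the envelope principle it approximates the gradient of the value when g is
  nearly optimal.\<close>

definition G :: "real ^ 'n ^ 'n \<Rightarrow> ('a \<Rightarrow> complex) \<Rightarrow> real ^ 'n ^ 'n" where
  "G S g = (- 1 / (2 * lam)) *\<^sub>R bil M (grad_kern S) g g"

lemma transpose_G:
  assumes "S \<in> Sym_nonneg" "g \<in> L2 M"
  shows "transpose (G S g) = G S g"
proof -
  have "transpose (bil M (grad_kern S) g g) = bil M (\<lambda>z. transpose (grad_kern S z)) g g"
    by (rule bil_bounded_linear[OF bounded_linear_transpose dominated_grad_kern]) (use assms in auto)
  also have "(\<lambda>z. transpose (grad_kern S z)) = grad_kern S"
    by (simp add: grad_kern_def transpose_scaleR transpose_outer fun_eq_iff)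
  finally show ?thesis by (simp only: G_def transpose_scaleR)
qed

text \<open>The equations for g and h are subtracted and paired with the difference d. Positivity of
  T S discards its contribution; what remains are the residuals and the change of kernel acting on
  h.\<close>

lemma nrm_diff_solutions:
  assumes S: "S \<in> Sym_nonneg" and S': "S' \<in> Sym_nonneg" and g: "g \<in> L2 M" and h: "h \<in> L2 M"
  shows "nrm M (\<lambda>s. g s - h s) \<le> nrm M (resid S g) + nrm M (resid S' h)
    + B1 * norm (S' - S) * W_nrm * nrm M h / lam"
proof -
  define d where "d = (\<lambda>s. g s - h s)"
  define r where "r = resid S g"
  define r' where "r' = resid S' h"
  have d: "d \<in> L2 M" unfolding d_def by (intro L2_diff g h)
  have r: "r \<in> L2 M" "r' \<in> L2 M" unfolding r_def r'_def by (intro resid_L2 S S' g h)+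
  have T: "T S g \<in> L2 M" "T S' h \<in> L2 M" by (intro T_L2 S S' g h)+
  have dk: "dominated 1 (kern S)" "dominated 1 (kern S')" by (intro dominated_kern S S')+
  have "d = (\<lambda>s. (r' s - r s) - (1 / lam) *\<^sub>R (T S g s - T S' h s))"
    by (auto simp: d_def r_def r'_def resid_def fun_eq_iff scaleR_diff_right)
  then have "ip M d d = ip M d (\<lambda>s. (r' s - r s) - (1 / lam) *\<^sub>R (T S g s - T S' h s))" by simp
  also have "\<dots> = ip M d (\<lambda>s. r' s - r s) - (1 / lam) * (ip M d (T S g) - ip M d (T S' h))"
    using d r T by (simp add: ip_simps)
  \<comment> \<open>T S g - T S' h is T S applied to d, minus the change of operator applied to h;
    so the norm of h alone enters the bound.\<close>
  also have "ip M d (T S g) - ip M d (T S' h) = Q S d - bil M (\<lambda>z. kern S' z - kern S z) d h"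
  proof -
    have "bil M (kern S) d g - bil M (kern S) d h = bil M (kern S) d d"
      using bil_diff_right[OF dk(1) d g h] by (simp add: d_def)
    moreover have "bil M (\<lambda>z. kern S' z - kern S z) d h = bil M (kern S') d h - bil M (kern S) d h"
      by (rule bil_diff_kernel[OF dk(2) dk(1) d h])
    ultimately show ?thesis
      unfolding Q_def by (simp add: ip_T_eq_bil S S' d g h)
  qed
  also have "ip M d (\<lambda>s. r' s - r s) - (1 / lam) * (Q S d - bil M (\<lambda>z. kern S' z - kern S z) d h)
      \<le> nrm M d * (nrm M r' + nrm M r) + (1 / lam) * (B1 * norm (S' - S) * W_nrm * nrm M d * nrm M h)"
  proof -
    have 1: "ip M d (\<lambda>s. r' s - r s) \<le> nrm M d * (nrm M r' + nrm M r)"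
      using ip_le_nrm[OF d L2_diff[OF r(2) r(1)]] mult_left_mono[OF nrm_diff_le[OF r(2) r(1)] nrm_nonneg[of M d]]
      by linarith
    have "bil M (\<lambda>z. kern S' z - kern S z) d h \<le> B1 * norm (S' - S) * W_nrm * nrm M d * nrm M h"
      using norm_bil_le[OF dominated_kern_diff[OF S S'] _ d h] B_nonneg by simp
    then have "(1 / lam) * (bil M (\<lambda>z. kern S' z - kern S z) d h - Q S d)
      \<le> (1 / lam) * (B1 * norm (S' - S) * W_nrm * nrm M d * nrm M h)"
      using Q_nonneg[OF S d] lam_pos by (intro mult_left_mono) auto
    with 1 show ?thesis by (simp add: algebra_simps)
  qed
  finally have "nrm M d * nrm M d \<le> nrm M d * (nrm M r + nrm M r' + B1 * norm (S' - S) * W_nrm * nrm M h / lam)"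
    by (simp add: nrm_power2[symmetric] power2_eq_square algebra_simps)
  moreover have "0 \<le> nrm M r + nrm M r' + B1 * norm (S' - S) * W_nrm * nrm M h / lam"
    using B_nonneg lam_pos W_nrm_nonneg nrm_nonneg[of M r] nrm_nonneg[of M r'] nrm_nonneg[of M h]
    by simp
  ultimately show ?thesis
    using nrm_nonneg[of M d] unfolding d_def[symmetric] r_def[symmetric] r'_def[symmetric]
    by (cases "nrm M d = 0") auto
qed

section \<open>Uniform Lipschitz bounds for approximate gradients\<close>

definition NY :: real where "NY = nrm M Y + 1"

text \<open>The prefactor is that of \<open>G\<close>. The B1 term pays for moving the two arguments
  of the form, at the rate in \<open>nrm_diff_solutions\<close>, and the B2 term for moving the
  kernel; \<open>NY\<close> bounds every g with residual norm at most 1.\<close>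

definition LipG :: real where
  "LipG = (1 / (2 * lam)) * (2 * B1 * W_nrm * NY * (1 + B1 * W_nrm * NY / lam) + B2 * W_nrm * NY\<^sup>2)"

lemma NY_nonneg: "0 \<le> NY" by (simp add: NY_def nrm_nonneg)

lemma LipG_nonneg: "0 \<le> LipG"
  unfolding LipG_def using lam_pos B_nonneg W_nrm_nonneg NY_nonneg by simp

text \<open>Residuals and the distance of the forms appear side by side, so the same bound gives the
  Cauchy property for S = S' and the Lipschitz property of the limit.\<close>

lemma G_lipschitz:
  assumes S: "S \<in> Sym_nonneg" and S': "S' \<in> Sym_nonneg" and g: "g \<in> L2 M" and h: "h \<in> L2 M"
    and rg: "nrm M (resid S g) \<le> 1" and rh: "nrm M (resid S' h) \<le> 1"
  shows "norm (G S' h - G S g) \<le> LipG * (nrm M (resid S g) + nrm M (resid S' h) + norm (S' - S))"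
proof -
  define d where "d = (\<lambda>s. g s - h s)"
  have d: "d \<in> L2 M" unfolding d_def by (intro L2_diff g h)
  define \<rho> where "\<rho> = nrm M (resid S g) + nrm M (resid S' h)"
  define \<delta> where "\<delta> = norm (S' - S)"
  have \<rho>0: "0 \<le> \<rho>" "0 \<le> \<delta>" by (simp_all add: \<rho>_def \<delta>_def nrm_nonneg)
  have Ng: "nrm M g \<le> NY" "nrm M h \<le> NY"
    using nrm_le_of_resid[OF S g] nrm_le_of_resid[OF S' h] rg rh by (auto simp: NY_def)
  have W0: "0 \<le> B1 * W_nrm" "0 \<le> B2 * W_nrm" using B_nonneg W_nrm_nonneg by auto
  have nd: "nrm M d \<le> \<rho> + B1 * W_nrm * NY / lam * \<delta>"
  proof -
    have "B1 * norm (S' - S) * W_nrm * nrm M h / lam \<le> B1 * \<delta> * W_nrm * NY / lam"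
      unfolding \<delta>_def using Ng B_nonneg W_nrm_nonneg lam_pos
      by (intro divide_right_mono mult_left_mono) auto
    then show ?thesis using nrm_diff_solutions[OF S S' g h] by (simp add: d_def \<rho>_def mult_ac)
  qed
  have k: "dominated B1 (grad_kern S)" "dominated B1 (grad_kern S')"
    by (intro dominated_grad_kern S S')+
  \<comment> \<open>The kernel is changed first, then the arguments one at a time.\<close>
  have eq: "bil M (grad_kern S') h h - bil M (grad_kern S) g g =
    bil M (\<lambda>z. grad_kern S' z - grad_kern S z) h h - (bil M (grad_kern S) d g + bil M (grad_kern S) h d)"
    unfolding bil_diff_kernel[OF k(2) k(1) h h] d_def
    by (simp add: bil_diff_left[OF k(1) g h g] bil_diff_right[OF k(1) h g h])
  have "norm (bil M (grad_kern S') h h - bil M (grad_kern S) g g) \<le>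
    norm (bil M (\<lambda>z. grad_kern S' z - grad_kern S z) h h) + (norm (bil M (grad_kern S) d g) + norm (bil M (grad_kern S) h d))"
    unfolding eq by (intro order_trans[OF norm_triangle_ineq4] add_left_mono norm_triangle_ineq)
  also have "\<dots> \<le> B2 * \<delta> * W_nrm * nrm M h * nrm M h + (B1 * W_nrm * nrm M d * nrm M g + B1 * W_nrm * nrm M h * nrm M d)"
    unfolding \<delta>_def
    by (intro add_mono norm_bil_le dominated_grad_kern_diff S S' g h d k B_nonneg mult_nonneg_nonneg norm_ge_zero)
  also have "\<dots> \<le> B2 * \<delta> * W_nrm * NY * NY + (B1 * W_nrm * nrm M d * NY + B1 * W_nrm * NY * nrm M d)"
    using Ng NY_nonneg \<rho>0 B_nonneg W_nrm_nonneg nrm_nonneg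
    by (intro add_mono mult_mono mult_nonneg_nonneg) auto
  also have "\<dots> = B2 * W_nrm * NY\<^sup>2 * \<delta> + 2 * B1 * W_nrm * NY * nrm M d"
    by (simp add: power2_eq_square algebra_simps)
  also have "\<dots> \<le> B2 * W_nrm * NY\<^sup>2 * (\<rho> + \<delta>) + 2 * B1 * W_nrm * NY * ((1 + B1 * W_nrm * NY / lam) * (\<rho> + \<delta>))"
  proof -
    have "nrm M d \<le> (1 + B1 * W_nrm * NY / lam) * (\<rho> + \<delta>)"
    proof -
      have "0 \<le> B1 * W_nrm * NY / lam * \<rho>" using W0 NY_nonneg lam_pos \<rho>0 by simp
      then show ?thesis using nd \<rho>0 by (simp add: algebra_simps add_divide_distrib)
    qed
    then show ?thesis
      using W0 NY_nonneg B_nonneg W_nrm_nonneg \<rho>0 by (intro add_mono mult_left_mono) auto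
  qed
  also have "\<dots> = (2 * lam) * (LipG * (\<rho> + \<delta>))"
    using lam_pos by (simp add: LipG_def) (simp add: algebra_simps)
  finally have main: "norm (bil M (grad_kern S') h h - bil M (grad_kern S) g g) \<le> (2 * lam) * (LipG * (\<rho> + \<delta>))" .
  have "G S' h - G S g = (- 1 / (2 * lam)) *\<^sub>R (bil M (grad_kern S') h h - bil M (grad_kern S) g g)"
    by (simp add: G_def scaleR_diff_right)
  then have "norm (G S' h - G S g) = (1 / (2 * lam)) * norm (bil M (grad_kern S') h h - bil M (grad_kern S) g g)"
    using lam_pos by simp
  also have "\<dots> \<le> (1 / (2 * lam)) * ((2 * lam) * (LipG * (\<rho> + \<delta>)))"
    using lam_pos by (intro mult_left_mono main) auto
  finally show ?thesis using lam_pos by (simp add: \<rho>_def \<delta>_def)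
qed

text \<open>An arbitrary near-solution; the shift by 1 in the denominator keeps the residual norm at
  most 1 from n = 0 on, as \<open>G_lipschitz\<close> requires.\<close>

definition gs :: "real ^ 'n ^ 'n \<Rightarrow> nat \<Rightarrow> 'a \<Rightarrow> complex" where
  "gs S n = (SOME g. g \<in> L2 M \<and> nrm M (resid S g) \<le> 1 / (real n + 1))"

lemma gs:
  assumes "S \<in> Sym_nonneg"
  shows "gs S n \<in> L2 M" "nrm M (resid S (gs S n)) \<le> 1 / (real n + 1)"
proof -
  have "\<exists>g. g \<in> L2 M \<and> nrm M (resid S g) \<le> 1 / (real n + 1)"
    using exists_small_resid[OF assms, of "1 / (real n + 1)"] by auto
  from someI_ex[OF this] show "gs S n \<in> L2 M" "nrm M (resid S (gs S n)) \<le> 1 / (real n + 1)"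
    by (auto simp: gs_def)
qed

lemma gs_resid_le_1: "S \<in> Sym_nonneg \<Longrightarrow> nrm M (resid S (gs S n)) \<le> 1"
  by (rule order_trans[OF gs(2)]) (auto simp: field_simps)

lemma inverse_Suc_tendsto: "(\<lambda>n. 1 / (real n + 1)) \<longlonglongrightarrow> 0"
  using LIMSEQ_inverse_real_of_nat by (simp add: inverse_eq_divide add.commute)

lemma G_gs_lipschitz:
  assumes "S \<in> Sym_nonneg" "S' \<in> Sym_nonneg"
  shows "norm (G S' (gs S' m) - G S (gs S n)) \<le> LipG * (1 / (real n + 1) + 1 / (real m + 1) + norm (S' - S))"
  using G_lipschitz[OF assms gs(1)[OF assms(1)] gs(1)[OF assms(2)] gs_resid_le_1[OF assms(1)] gs_resid_le_1[OF assms(2)], of m n]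
    gs(2)[OF assms(1), of n] gs(2)[OF assms(2), of m] LipG_nonneg
  by (elim order_trans) (intro mult_left_mono add_mono, auto)

text \<open>A limit of matrices stands in for the gradient at an exact dual maximiser. It is used on
  the cone, where the sequence is Cauchy.\<close>

definition D :: "real ^ 'n ^ 'n \<Rightarrow> real ^ 'n ^ 'n" where
  "D S = lim (\<lambda>n. G S (gs S n))"

lemma G_tendsto_D:
  assumes S: "S \<in> Sym_nonneg"
  shows "(\<lambda>n. G S (gs S n)) \<longlonglongrightarrow> D S"
proof -
  have "Cauchy (\<lambda>n. G S (gs S n))"
  proof (rule metric_CauchyI)
    fix e :: real assume e: "0 < e"
    have "(\<lambda>n. LipG * (2 * (1 / (real n + 1)))) \<longlonglongrightarrow> LipG * (2 * 0)"
      by (intro tendsto_intros inverse_Suc_tendsto)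
    then have "eventually (\<lambda>n. LipG * (2 * (1 / (real n + 1))) < e) sequentially"
      using e by (intro order_tendstoD(2)[where y="LipG * (2 * 0)"]) auto
    then obtain N where N: "LipG * (2 * (1 / (real N + 1))) < e" by (auto simp: eventually_sequentially)
    have "dist (G S (gs S m)) (G S (gs S n)) < e" if "m \<ge> N" "n \<ge> N" for m n
    proof -
      have "dist (G S (gs S m)) (G S (gs S n)) \<le> LipG * (1 / (real n + 1) + 1 / (real m + 1))"
        using G_gs_lipschitz[OF S S, of m n] by (simp add: dist_norm)
      also have "\<dots> \<le> LipG * (1 / (real N + 1) + 1 / (real N + 1))"
        using that by (intro mult_left_mono LipG_nonneg add_mono divide_left_mono) auto
      finally show ?thesis using N by simp
    qed
    then show "\<exists>N. \<forall>m\<ge>N. \<forall>n\<ge>N. dist (G S (gs S m)) (G S (gs S n)) < e" by blast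
  qed
  then show ?thesis unfolding D_def using Cauchy_convergent convergent_LIMSEQ_iff by blast
qed

lemma D_lipschitz:
  assumes S: "S \<in> Sym_nonneg" and S': "S' \<in> Sym_nonneg"
  shows "norm (D S' - D S) \<le> LipG * norm (S' - S)"
proof -
  have "(\<lambda>n. norm (G S' (gs S' n) - G S (gs S n))) \<longlonglongrightarrow> norm (D S' - D S)"
    by (intro tendsto_intros G_tendsto_D S S')
  moreover have "(\<lambda>n. LipG * (1 / (real n + 1) + 1 / (real n + 1) + norm (S' - S))) \<longlonglongrightarrow> LipG * (0 + 0 + norm (S' - S))"
    by (intro tendsto_intros inverse_Suc_tendsto)
  ultimately have "norm (D S' - D S) \<le> LipG * (0 + 0 + norm (S' - S))"
    by (rule LIMSEQ_le) (intro exI[of _ 0] allI impI G_gs_lipschitz S S')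
  then show ?thesis by simp
qed

lemma transpose_D:
  assumes S: "S \<in> Sym_nonneg"
  shows "transpose (D S) = D S"
proof -
  have "(\<lambda>n. transpose (G S (gs S n))) \<longlonglongrightarrow> transpose (D S)"
    by (rule bounded_linear.tendsto[OF bounded_linear_transpose G_tendsto_D[OF S]])
  then have "(\<lambda>n. G S (gs S n)) \<longlonglongrightarrow> transpose (D S)"
    by (simp add: transpose_G[OF S gs(1)[OF S]])
  then show ?thesis using G_tendsto_D[OF S] LIMSEQ_unique by blast
qed

text \<open>A near-maximiser for S is a competitor for S', so weak duality bounds the value at S'
  from below; expanding the kernel to second order gives the gradient term and the quadratic
  loss.\<close>

lemma J_lower_bound:
  assumes S: "S \<in> Sym_nonneg" and S': "S' \<in> Sym_nonneg"
  shows "J S + D S \<bullet> (S' - S) - B2 * W_nrm * NY\<^sup>2 / (2 * lam) * (norm (S' - S))\<^sup>2 \<le> J S'"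
proof -
  define c where "c = B2 * W_nrm * NY\<^sup>2 / (2 * lam) * (norm (S' - S))\<^sup>2"
  \<comment> \<open>The price of a near-maximiser is half its squared residual, which disappears as
    n grows.\<close>
  have "J S - (1 / (real n + 1))\<^sup>2 / 2 + G S (gs S n) \<bullet> (S' - S) - c \<le> J S'" for n
  proof -
    define g where "g = gs S n"
    have g: "g \<in> L2 M" unfolding g_def by (rule gs(1)[OF S])
    have Ng: "nrm M g \<le> NY"
      using nrm_le_of_resid[OF S g] gs_resid_le_1[OF S, of n] by (simp add: NY_def g_def)
    define R where "R = bil M (\<lambda>z. (kern S' z - kern S z) - grad_kern S z \<bullet> (S' - S)) g g"
    have "R = (Q S' g - Q S g) - bil M (grad_kern S) g g \<bullet> (S' - S)"
      unfolding R_def Q_def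
      by (simp add: bil_diff_kernel[OF dominated_kern_diff[OF S S'] dominated_grad_kern_inner[OF S] g g]
          bil_diff_kernel[OF dominated_kern[OF S'] dominated_kern[OF S] g g] ip_T_eq_bil S S' g
          bil_inner[OF dominated_grad_kern[OF S] g g])
    then have "G S g \<bullet> (S' - S) = (- 1 / (2 * lam)) * (Q S' g - Q S g - R)"
      by (simp add: G_def)
    then have eq: "dual_obj S' g = dual_obj S g + G S g \<bullet> (S' - S) - R / (2 * lam)"
      unfolding dual_obj_def by (simp add: diff_divide_distrib add_divide_distrib)
    have "R \<le> B2 * (norm (S' - S))\<^sup>2 * W_nrm * nrm M g * nrm M g"
      using norm_bil_le[OF dominated_taylor[OF S S'] _ g g] B_nonneg by (simp add: R_def)
    also have "\<dots> \<le> B2 * (norm (S' - S))\<^sup>2 * W_nrm * NY * NY"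
      using Ng NY_nonneg B_nonneg W_nrm_nonneg nrm_nonneg by (intro mult_mono) auto
    finally have "R / (2 * lam) \<le> B2 * (norm (S' - S))\<^sup>2 * W_nrm * NY * NY / (2 * lam)"
      using lam_pos by (intro divide_right_mono) auto
    also have "\<dots> = c" by (simp add: c_def power2_eq_square mult_ac)
    finally have Rc: "R / (2 * lam) \<le> c" .
    have "(nrm M (resid S g))\<^sup>2 \<le> (1 / (real n + 1))\<^sup>2"
      unfolding g_def by (intro power_mono gs(2)[OF S] nrm_nonneg)
    then show ?thesis
      using J_ge_dual[OF S' g] J_le_dual[OF S g] eq Rc unfolding g_def by linarith
  qed
  moreover have "(\<lambda>n. J S - (1 / (real n + 1))\<^sup>2 / 2 + G S (gs S n) \<bullet> (S' - S) - c) \<longlonglongrightarrow>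
      J S - 0\<^sup>2 / 2 + D S \<bullet> (S' - S) - c"
    by (intro tendsto_intros inverse_Suc_tendsto G_tendsto_D S) auto
  ultimately have "J S - 0\<^sup>2 / 2 + D S \<bullet> (S' - S) - c \<le> J S'"
    by (intro LIMSEQ_le_const2) auto
  then show ?thesis by (simp add: c_def)
qed

text \<open>The lower bound is used from S to S' and back. The second use involves the gradient at
  S', and \<open>D_lipschitz\<close> replaces it by the one at S at quadratic cost.\<close>

lemma J_has_derivative:
  assumes S: "S \<in> Sym_nonneg"
  shows "(J has_derivative (\<lambda>H. D S \<bullet> H)) (at S within Sym_nonneg)"
  unfolding has_derivative_within_alt
proof (intro conjI allI impI bounded_linear_inner_right)
  fix e :: real assume e: "0 < e"
  define K where "K = B2 * W_nrm * NY\<^sup>2 / (2 * lam) + LipG"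
  have c0: "0 \<le> B2 * W_nrm * NY\<^sup>2 / (2 * lam)" using B_nonneg W_nrm_nonneg lam_pos by simp
  have K0: "0 \<le> K" unfolding K_def using c0 LipG_nonneg by simp
  have bd: "norm (J S' - J S - D S \<bullet> (S' - S)) \<le> K * (norm (S' - S))\<^sup>2" if S': "S' \<in> Sym_nonneg" for S'
  proof -
    have "D S' \<bullet> (S - S') = - (D S \<bullet> (S' - S)) - (D S' - D S) \<bullet> (S' - S)"
      by (simp add: inner_diff_left inner_diff_right)
    moreover have "(D S' - D S) \<bullet> (S' - S) \<le> LipG * (norm (S' - S))\<^sup>2"
    proof -
      have "(D S' - D S) \<bullet> (S' - S) \<le> norm (D S' - D S) * norm (S' - S)" by (rule norm_cauchy_schwarz)
      also have "\<dots> \<le> (LipG * norm (S' - S)) * norm (S' - S)"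
        by (intro mult_right_mono D_lipschitz S S') simp
      finally show ?thesis by (simp add: power2_eq_square mult_ac)
    qed
    moreover have "K * (norm (S' - S))\<^sup>2 = B2 * W_nrm * NY\<^sup>2 / (2 * lam) * (norm (S' - S))\<^sup>2 + LipG * (norm (S' - S))\<^sup>2"
      by (simp add: K_def algebra_simps)
    moreover have "0 \<le> LipG * (norm (S' - S))\<^sup>2" using LipG_nonneg by simp
    ultimately show ?thesis
      using J_lower_bound[OF S S'] J_lower_bound[OF S' S]
      unfolding norm_minus_commute[of S S'] real_norm_def by linarith
  qed
  show "\<exists>d>0. \<forall>y\<in>Sym_nonneg. norm (y - S) < d \<longrightarrow> norm (J y - J S - D S \<bullet> (y - S)) \<le> e * norm (y - S)"
  proof (intro exI[of _ "e / (K + 1)"] conjI ballI impI)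
    show "0 < e / (K + 1)" using e K0 by simp
    fix y assume y: "y \<in> Sym_nonneg" "norm (y - S) < e / (K + 1)"
    have "K * norm (y - S) \<le> (K + 1) * norm (y - S)" by (intro mult_right_mono) auto
    also have "\<dots> \<le> e" using y(2) K0 by (simp add: pos_less_divide_eq mult.commute)
    finally have "K * norm (y - S) * norm (y - S) \<le> e * norm (y - S)" by (intro mult_right_mono) auto
    then show "norm (J y - J S - D S \<bullet> (y - S)) \<le> e * norm (y - S)"
      using bd[OF y(1)] by (simp add: power2_eq_square mult.assoc)
  qed
qed

text \<open>The cone is not full-dimensional in the space of all matrices; the directions outer v
  nevertheless detect every symmetric matrix.\<close>

lemma DJ_eq_D:
  assumes S: "S \<in> Sym_nonneg"
  shows "DJ M X Y kV lam S = D S"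
  unfolding DJ_def
proof (rule the_equality)
  show "transpose (D S) = D S \<and> (J has_derivative (\<lambda>H. D S \<bullet> H)) (at S within Sym_nonneg)"
    using transpose_D[OF S] J_has_derivative[OF S] by blast
next
  fix E assume E: "transpose E = E \<and> (J has_derivative (\<lambda>H. E \<bullet> H)) (at S within Sym_nonneg)"
  \<comment> \<open>The pairing with a rank-one matrix is a right derivative along a ray that stays
    in the cone, so every candidate gives the same number.\<close>
  have "F \<bullet> outer v = vector_derivative (\<lambda>t. J (S + t *\<^sub>R outer v)) (at 0 within {0..})"
    if F: "(J has_derivative (\<lambda>H. F \<bullet> H)) (at S within Sym_nonneg)" for F v
  proof -
    have c: "((\<lambda>t. S + t *\<^sub>R outer v) has_derivative (\<lambda>t. t *\<^sub>R outer v)) (at 0 within {0::real..})"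
      by (auto intro!: derivative_eq_intros)
    have sub: "(\<lambda>t. S + t *\<^sub>R outer v) ` {0::real..} \<subseteq> Sym_nonneg"
      using Sym_nonneg_add_outer[OF S] by auto
    have F': "(J has_derivative (\<lambda>H. F \<bullet> H)) (at (S + 0 *\<^sub>R outer v) within (\<lambda>t. S + t *\<^sub>R outer v) ` {0::real..})"
      using has_derivative_subset[OF F sub] by simp
    have "((\<lambda>t. J (S + t *\<^sub>R outer v)) has_derivative (\<lambda>t. F \<bullet> (t *\<^sub>R outer v))) (at 0 within {0..})"
      by (rule has_derivative_in_compose[OF c F'])
    then have "((\<lambda>t. J (S + t *\<^sub>R outer v)) has_vector_derivative (F \<bullet> outer v)) (at 0 within {0..})"
      by (simp add: has_vector_derivative_def)
    then show ?thesis
      by (intro vector_derivative_within[symmetric]) (auto simp: trivial_limit_at_right_real at_within_Ici_at_right)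
  qed
  then have "E \<bullet> outer v = D S \<bullet> outer v" for v
    using E J_has_derivative[OF S] by metis
  then have "qform (E - D S) v = 0" for v by (simp add: qform_eq_inner inner_diff_left)
  then have "E - D S = 0"
    using E transpose_D[OF S] by (intro qform_eq_0_imp_0) (auto simp: transpose_minus)
  then show "E = D S" by simp
qed

subsection \<open>Compact sublevel sets\<close>

lemma J_sublevel_bounded:
  assumes Kc0: "(Kc \<longlongrightarrow> 0) at_top"
    and hyper: "\<And>a c. a \<noteq> 0 \<Longrightarrow> AE s in M. a \<bullet> X s \<noteq> c"
    and b: "b < ip M Y Y / 2"
  shows "bounded {S \<in> Sym_nonneg. J S \<le> b}"
proof (rule ccontr)
  assume unb: "\<not> ?thesis"
  have "\<exists>S \<in> Sym_nonneg. J S \<le> b \<and> real n + 1 < norm S" for n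
    using unb unfolding bounded_iff by (metis (mono_tags, lifting) mem_Collect_eq not_le)
  then obtain S where S: "\<And>n. S n \<in> Sym_nonneg" "\<And>n. J (S n) \<le> b" "\<And>n. real n + 1 < norm (S n)"
    by metis
  have Spos: "0 < norm (S n)" for n using S(3)[of n] by linarith
  define A where "A n = (1 / norm (S n)) *\<^sub>R S n" for n
  have An: "A n \<in> sphere 0 1" for n using Spos[of n] by (simp add: A_def)
  obtain L r where L: "L \<in> sphere 0 1" "strict_mono r" "(A \<circ> r) \<longlonglongrightarrow> L"
    using compact_sphere[of "0 :: real ^ 'n ^ 'n" 1] An unfolding compact_def by metis
  have Anon: "A n \<in> Sym_nonneg" for n
    using S(1)[of n] by (simp add: A_def Sym_nonneg_def transpose_scaleR qform_scaleR_matrix)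
  have Lnon: "L \<in> Sym_nonneg"
    using closed_sequentially[OF closed_Sym_nonneg _ L(3)] Anon by auto
  have "L \<noteq> 0" using L(1) by auto
  \<comment> \<open>L may be singular, but one nonzero row suffices: if the form of L vanishes at X
    - X', this row is orthogonal to X - X', which confines X' to a hyperplane.\<close>
  then obtain i where i: "L $ i \<noteq> 0" by (auto simp: vec_eq_iff[of L])
  have norm_inf: "filterlim (\<lambda>n. norm (S (r n))) at_top sequentially"
  proof (rule filterlim_at_top_mono[OF filterlim_real_sequentially])
    have "real n \<le> norm (S (r n))" for n
      using S(3)[of "r n"] seq_suble[OF L(2), of n] by linarith
    then show "eventually (\<lambda>n. real n \<le> norm (S (r n))) sequentially" by simp
  qed
  have pos: "AE z in M \<Otimes>\<^sub>M M. 0 < qform L (X (fst z) - X (snd z))"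
  proof (rule MM.AE_pair_measure)
    show "{z \<in> space (M \<Otimes>\<^sub>M M). 0 < qform L (X (fst z) - X (snd z))} \<in> sets (M \<Otimes>\<^sub>M M)"
      by measurable
    show "AE x in M. AE y in M. 0 < qform L (X (fst (x, y)) - X (snd (x, y)))"
    proof (rule AE_I2)
      fix x
      show "AE y in M. 0 < qform L (X (fst (x, y)) - X (snd (x, y)))"
        using hyper[OF i, of "L $ i \<bullet> X x"]
      proof eventually_elim
        case (elim y)
        have "(L *v (X x - X y)) $ i \<noteq> 0"
          using elim by (simp add: matrix_vector_mul_component inner_diff_right)
        then have "qform L (X x - X y) \<noteq> 0"
          using qform_zero_imp_kernel[OF Lnon] by fastforce
        then show ?case using Lnon by (auto simp: Sym_nonneg_def order_less_le)
      qed
    qed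
  qed
  have "(\<lambda>n. bil M (kern (S (r n))) Y Y) \<longlonglongrightarrow> (LINT z|(M \<Otimes>\<^sub>M M). (0::real))"
    unfolding bil_def
  proof (rule integral_dominated_convergence[where w="\<lambda>z. cmod (Y (fst z)) * cmod (Y (snd z))"])
    show "integrable (M \<Otimes>\<^sub>M M) (\<lambda>z. cmod (Y (fst z)) * cmod (Y (snd z)))"
      by (intro MM.integrable_tensor integrable_norm L2_imp_integrable Y_L2)
    show "(\<lambda>z. (Y (fst z) \<bullet> Y (snd z)) *\<^sub>R kern (S (r n)) z) \<in> borel_measurable (M \<Otimes>\<^sub>M M)" for n
      using bil_integrable[OF dominated_kern[OF S(1)] Y_L2 Y_L2] by blast
    show "AE z in M \<Otimes>\<^sub>M M. norm ((Y (fst z) \<bullet> Y (snd z)) *\<^sub>R kern (S (r n)) z) \<le> cmod (Y (fst z)) * cmod (Y (snd z))" for n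
    proof (intro AE_I2)
      fix z
      have "norm ((Y (fst z) \<bullet> Y (snd z)) *\<^sub>R kern (S (r n)) z) \<le> (cmod (Y (fst z)) * cmod (Y (snd z))) * 1"
        unfolding real_scaleR_def real_norm_def abs_mult
        by (intro mult_mono Cauchy_Schwarz_ineq2 abs_kern_le_1 S) auto
      then show "norm ((Y (fst z) \<bullet> Y (snd z)) *\<^sub>R kern (S (r n)) z) \<le> cmod (Y (fst z)) * cmod (Y (snd z))" by simp
    qed
    show "AE z in M \<Otimes>\<^sub>M M. (\<lambda>n. (Y (fst z) \<bullet> Y (snd z)) *\<^sub>R kern (S (r n)) z) \<longlonglongrightarrow> 0"
      using pos
    proof eventually_elim
      case (elim z)
      define x where "x = X (fst z) - X (snd z)"
      \<comment> \<open>For fixed sample points the normalised forms converge to a positive number,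
        so the forms themselves grow like their norms and the profile decays.\<close>
      have lim: "(\<lambda>n. qform (A (r n)) x) \<longlonglongrightarrow> qform L x"
        unfolding qform_eq_inner using L(3) by (intro tendsto_intros) (simp add: o_def)
      have "filterlim (\<lambda>n. qform (A (r n)) x * norm (S (r n))) at_top sequentially"
        using elim by (intro filterlim_tendsto_pos_mult_at_top[OF lim _ norm_inf]) (simp add: x_def)
      moreover have "qform (A n) x * norm (S n) = qform (S n) x" for n
        using Spos[of n] by (simp add: A_def qform_scaleR_matrix)
      ultimately have "(\<lambda>n. Kc (qform (S (r n)) x)) \<longlonglongrightarrow> 0"
        using filterlim_compose[OF Kc0] by simp
      then have "(\<lambda>n. (Y (fst z) \<bullet> Y (snd z)) *\<^sub>R kern (S (r n)) z) \<longlonglongrightarrow> (Y (fst z) \<bullet> Y (snd z)) *\<^sub>R 0"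
        unfolding kern_def x_def[symmetric] by (intro tendsto_intros)
      then show ?case by simp
    qed
  qed auto
  then have Qlim: "(\<lambda>n. bil M (kern (S (r n))) Y Y) \<longlonglongrightarrow> 0" by simp
  \<comment> \<open>Y itself serves as dual competitor: its objective is half its squared norm minus
    a multiple of the vanishing form.\<close>
  have "ip M Y Y / 2 - bil M (kern (S (r n))) Y Y / (2 * lam) \<le> b" for n
  proof -
    have "dual_obj (S (r n)) Y \<le> b" using J_ge_dual[OF S(1) Y_L2, of "r n"] S(2)[of "r n"] by linarith
    then show ?thesis by (simp add: dual_obj_def Q_def ip_T_eq_bil[OF S(1) Y_L2 Y_L2])
  qed
  moreover have "(\<lambda>n. ip M Y Y / 2 - bil M (kern (S (r n))) Y Y / (2 * lam)) \<longlonglongrightarrow> ip M Y Y / 2 - 0 / (2 * lam)"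
    using lam_pos by (intro tendsto_intros Qlim) auto
  ultimately have "ip M Y Y / 2 - 0 / (2 * lam) \<le> b"
    by (intro LIMSEQ_le_const2) auto
  then show False using b by simp
qed

end

subsection \<open>The covariance form\<close>

lemma integrable_centred_square:
  fixes X :: "'a \<Rightarrow> real ^ 'n"
  assumes "prob_space M" and [measurable]: "X \<in> borel_measurable M"
    and X8: "integrable M (\<lambda>s. norm (X s) ^ 8)"
  shows "integrable M (\<lambda>s. (X s $ i - c)\<^sup>2)"
proof -
  interpret prob_space M by fact
  have [measurable]: "(\<lambda>s. X s $ i) \<in> borel_measurable M"
    by (rule measurable_compose[OF assms(2) borel_measurable_continuous_onI]) (intro continuous_intros)
  have int: "integrable M (\<lambda>s. 2 * (1 + norm (X s) ^ 8) + 2 * c\<^sup>2)" using X8 by simp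
  show ?thesis
  proof (rule Bochner_Integration.integrable_bound[OF int _ AE_I2])
    fix s
    define a where "a = norm (X s)"
    have a: "0 \<le> a" by (simp add: a_def)
    have "(X s $ i - c)\<^sup>2 \<le> 2 * (X s $ i)\<^sup>2 + 2 * c\<^sup>2"
      using zero_le_power2[of "X s $ i + c"] by (simp add: power2_eq_square algebra_simps)
    also have "(X s $ i)\<^sup>2 \<le> a\<^sup>2"
      using component_le_norm_cart[of "X s" i] by (simp add: a_def abs_le_square_iff[symmetric])
    also have "a\<^sup>2 \<le> 1 + a ^ 8"
    proof (cases "a \<le> 1")
      case True
      then have "a\<^sup>2 \<le> 1" using a by (simp add: power_le_one)
      then show ?thesis using zero_le_power[OF a, of 8] by linarith
    next
      case False
      then have "a\<^sup>2 \<le> a ^ 8" by (intro power_increasing) auto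
      then show ?thesis by simp
    qed
    finally show "norm ((X s $ i - c)\<^sup>2) \<le> norm (2 * (1 + norm (X s) ^ 8) + 2 * c\<^sup>2)"
      by (simp add: a_def)
  qed measurable
qed

text \<open>The form at w is the variance of w \<bullet> X; if it were 0, X would almost surely lie
  in a hyperplane.\<close>

lemma cov_matrix_Sym_pos:
  fixes X :: "'a \<Rightarrow> real ^ 'n"
  assumes M: "prob_space M" and X[measurable]: "X \<in> borel_measurable M"
    and X8: "integrable M (\<lambda>s. norm (X s) ^ 8)"
    and hyper: "\<And>a c. a \<noteq> 0 \<Longrightarrow> AE s in M. a \<bullet> X s \<noteq> c"
  shows "cov_matrix M X \<in> Sym_pos"
  unfolding Sym_pos_def
proof (intro CollectI conjI allI impI)
  interpret prob_space M by fact
  show "transpose (cov_matrix M X) = cov_matrix M X"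
    by (simp add: cov_matrix_def transpose_def mult.commute)
  fix w :: "real ^ 'n" assume w: "w \<noteq> 0"
  define m :: "real ^ 'n" where "m = (\<chi> i. LINT r|M. X r $ i)"
  define f where "f i s = X s $ i - m $ i" for i s
  have comp[measurable]: "(\<lambda>s. X s $ i) \<in> borel_measurable M" for i
    by (rule measurable_compose[OF X borel_measurable_continuous_onI]) (intro continuous_intros)
  have fi: "integrable M (\<lambda>s. f i s * f j s)" for i j
    unfolding f_def
    by (intro integral_Cauchy_Schwarz(1) integrable_centred_square[OF M X X8]) measurable
  have sq: "(w \<bullet> X s - w \<bullet> m)\<^sup>2 = (\<Sum>i\<in>UNIV. \<Sum>j\<in>UNIV. w $ i * w $ j * (f i s * f j s))" for s
  proof -
    have "w \<bullet> X s - w \<bullet> m = (\<Sum>i\<in>UNIV. w $ i * f i s)"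
      by (simp add: inner_vec_def f_def right_diff_distrib sum_subtractf)
    then show ?thesis by (simp add: power2_eq_square sum_product mult_ac)
  qed
  have int: "integrable M (\<lambda>s. (w \<bullet> X s - w \<bullet> m)\<^sup>2)"
    unfolding sq using fi by auto
  have "qform (cov_matrix M X) w = (\<Sum>i\<in>UNIV. \<Sum>j\<in>UNIV. w $ i * w $ j * (LINT s|M. f i s * f j s))"
    by (simp add: qform_def inner_vec_def matrix_vector_mult_def cov_matrix_def f_def m_def
        sum_distrib_left mult_ac)
  also have "\<dots> = (LINT s|M. (w \<bullet> X s - w \<bullet> m)\<^sup>2)"
    unfolding sq using fi by simp
  finally have q: "qform (cov_matrix M X) w = (LINT s|M. (w \<bullet> X s - w \<bullet> m)\<^sup>2)" .
  have "(LINT s|M. (w \<bullet> X s - w \<bullet> m)\<^sup>2) \<noteq> 0"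
  proof
    assume "(LINT s|M. (w \<bullet> X s - w \<bullet> m)\<^sup>2) = 0"
    then have "AE s in M. (w \<bullet> X s - w \<bullet> m)\<^sup>2 = 0"
      using integral_nonneg_eq_0_iff_AE[OF int] by simp
    with hyper[OF w, of "w \<bullet> m"] have "AE s in M. False"
      by eventually_elim simp
    then show False by simp
  qed
  moreover have "0 \<le> (LINT s|M. (w \<bullet> X s - w \<bullet> m)\<^sup>2)" by simp
  ultimately show "0 < qform (cov_matrix M X) w" using q by linarith
qed

lemma Sym_pos_subset: "Sym_pos \<subseteq> Sym_nonneg"
proof
  fix S :: "real ^ 'n ^ 'n" assume S: "S \<in> Sym_pos"
  have "0 \<le> qform S x" for x
    using S by (cases "x = 0") (auto simp: Sym_pos_def qform_def less_imp_le)
  then show "S \<in> Sym_nonneg" using S by (auto simp: Sym_pos_def Sym_nonneg_def)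
qed

text \<open>Definiteness makes the kernel trivial, hence C invertible. Substituting x = C (P x)
  turns the form of the inverse P at x into the form of C at P x.\<close>

lemma Sym_pos_inverse:
  fixes C :: "real ^ 'n ^ 'n"
  assumes C: "C \<in> Sym_pos"
  shows "C ** matrix_inv C = mat 1" "matrix_inv C ** C = mat 1" "matrix_inv C \<in> Sym_pos"
proof -
  have "C *v x = 0 \<Longrightarrow> x = 0" for x
    using C by (force simp: Sym_pos_def qform_def)
  then have "\<exists>B. B ** C = mat 1" by (simp add: matrix_left_invertible_ker)
  then have "\<exists>B. C ** B = mat 1 \<and> B ** C = mat 1" using matrix_left_right_inverse by blast
  from someI_ex[OF this] show CP: "C ** matrix_inv C = mat 1" and PC: "matrix_inv C ** C = mat 1"
    by (auto simp: matrix_inv_def)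
  define P where "P = matrix_inv C"
  have Csym: "transpose C = C" using C by (simp add: Sym_pos_def)
  have "transpose P ** C = mat 1"
    using arg_cong[OF CP, of transpose] by (simp add: P_def matrix_transpose_mul Csym transpose_mat)
  then have "(transpose P ** C) ** P = P" by simp
  then have Psym: "transpose P = P"
    using CP by (simp add: P_def matrix_mul_assoc[symmetric])
  have "0 < qform P x" if "x \<noteq> 0" for x
  proof -
    have x: "x = C *v (P *v x)" by (simp add: matrix_vector_mul_assoc CP P_def)
    then have nz: "P *v x \<noteq> 0" using that by auto
    have "qform P x = (C *v (P *v x)) \<bullet> (P *v x)"
      unfolding qform_def using x by simp
    also have "\<dots> = qform C (P *v x)" by (simp add: qform_def inner_commute)
    finally show ?thesis using C nz by (auto simp: Sym_pos_def)
  qed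
  then show "matrix_inv C \<in> Sym_pos" using Psym by (simp add: Sym_pos_def P_def)
qed

text \<open>With C = R^T R the map R^T carries the Euclidean norm to the norm of the inverse of C,
  so composing it with a Euclidean factor V of S gives U = R^T V.\<close>

lemma Sym_nonneg_factor:
  fixes C S :: "real ^ 'n ^ 'n"
  assumes C: "C \<in> Sym_pos" and S: "S \<in> Sym_nonneg"
  shows "\<exists>U. \<forall>x. qform S x = qform (matrix_inv C) (U *v x)"
proof -
  obtain V :: "real ^ 'n ^ 'n" where V: "S = transpose V ** V" using psd_factorization[OF S] by blast
  obtain R :: "real ^ 'n ^ 'n" where R: "C = transpose R ** R"
    using psd_factorization[of C] Sym_pos_subset C by blast
  have "transpose R ** (R ** matrix_inv C) = mat 1"
    using Sym_pos_inverse(1)[OF C] by (simp add: R matrix_mul_assoc)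
  then have RPR: "(R ** matrix_inv C) ** transpose R = mat 1"
    by (rule matrix_left_right_inverse1)
  have "qform (matrix_inv C) ((transpose R ** V) *v x) = qform S x" for x
  proof -
    define u where "u = V *v x"
    have "qform (matrix_inv C) ((transpose R ** V) *v x) = (transpose R *v u) \<bullet> (matrix_inv C *v (transpose R *v u))"
      by (simp add: qform_def u_def matrix_vector_mul_assoc)
    also have "\<dots> = u \<bullet> (R *v (matrix_inv C *v (transpose R *v u)))"
      by (simp add: dot_lmul_matrix)
    also have "\<dots> = u \<bullet> ((R ** matrix_inv C ** transpose R) *v u)"
      by (simp only: matrix_vector_mul_assoc matrix_mul_assoc)
    finally show ?thesis by (simp add: RPR V qform_transpose_mult u_def)
  qed
  then show ?thesis by (intro exI[of _ "transpose R ** V"]) simp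
qed

subsection \<open>Decay and Taylor bounds for the radial profile\<close>

lemma kernel_fun_osc_int: "kernel_fun k (t *\<^sub>R b) = osc_int b k t"
  unfolding kernel_fun_def osc_int_def
  by (intro Bochner_Integration.integral_cong refl)
    (simp add: cis_conv_exp scaleR_conv_of_real[where 'a=complex] mult_ac)

text \<open>On the ray t b the quadratic q equals t^2 q(b), so a large r is attained at t = sqrt (r
  / q b), and decay of the Fourier transform in one direction is decay of the profile.\<close>

lemma profile_tendsto_0:
  fixes q :: "real ^ 'n \<Rightarrow> real"
  assumes k: "integrable lborel k"
    and K: "\<And>x. kernel_fun k x = complex_of_real (Kc (q x))"
    and hom: "\<And>t x. q (t *\<^sub>R x) = t\<^sup>2 * q x" and b: "norm b = 1" "0 < q b"
  shows "(Kc \<longlongrightarrow> 0) at_top"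
proof (rule tendsto_at_topI_sequentially)
  fix r :: "nat \<Rightarrow> real" assume r: "filterlim r at_top sequentially"
  define t where "t n = sqrt (r n / q b)" for n
  have "filterlim (\<lambda>n. r n * (1 / q b)) at_top sequentially"
    using b r by (intro filterlim_at_top_mult_tendsto_pos[OF tendsto_const]) auto
  then have t: "filterlim t at_top sequentially"
    unfolding t_def by (intro filterlim_compose[OF sqrt_at_top]) simp
  have lim: "(\<lambda>n. complex_of_real (Kc (q (t n *\<^sub>R b)))) \<longlonglongrightarrow> 0"
    using Riemann_Lebesgue_ray[OF k b(1) t] by (simp only: kernel_fun_osc_int[symmetric] K)
  have "eventually (\<lambda>n. 0 \<le> r n) sequentially"
    using r unfolding filterlim_at_top by blast
  then have "eventually (\<lambda>n. complex_of_real (Kc (q (t n *\<^sub>R b))) = complex_of_real (Kc (r n))) sequentially"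
    by eventually_elim (use b in \<open>simp add: hom t_def\<close>)
  then have "(\<lambda>n. complex_of_real (Kc (r n))) \<longlonglongrightarrow> 0"
    using lim by (rule Lim_transform_eventually[rotated])
  then show "(\<lambda>n. Kc (r n)) \<longlonglongrightarrow> 0"
    using tendsto_of_real_iff[where 'a=complex, of "\<lambda>n. Kc (r n)" 0] by simp
qed

lemma lipschitz_of_derivative:
  fixes f :: "real \<Rightarrow> real"
  assumes "\<forall>r\<ge>0. (f has_real_derivative f' r) (at r within {0..})"
    and "\<And>r. 0 \<le> r \<Longrightarrow> \<bar>f' r\<bar> \<le> B" and "0 \<le> a" "0 \<le> b"
  shows "\<bar>f b - f a\<bar> \<le> B * \<bar>b - a\<bar>"
  using field_differentiable_bound[of "{0..}" f f' B b a] assms by auto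

text \<open>The mean value estimate is applied to f minus its linear part at a, on the interval
  between a and b, where the derivative is at most B |b - a|.\<close>

lemma taylor_of_derivative:
  fixes f :: "real \<Rightarrow> real"
  assumes d1: "\<forall>r\<ge>0. (f has_real_derivative f' r) (at r within {0..})"
    and lip: "\<And>a b. 0 \<le> a \<Longrightarrow> 0 \<le> b \<Longrightarrow> \<bar>f' b - f' a\<bar> \<le> B * \<bar>b - a\<bar>"
    and B: "0 \<le> B" and a: "0 \<le> a" and b: "0 \<le> b"
  shows "\<bar>f b - f a - f' a * (b - a)\<bar> \<le> B * (b - a)\<^sup>2"
proof -
  define I where "I = {min a b..max a b}"
  have I: "I \<subseteq> {0..}" using a b by (auto simp: I_def)
  have "norm ((f b - f' a * b) - (f a - f' a * a)) \<le> (B * \<bar>b - a\<bar>) * norm (b - a)"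
  proof (rule field_differentiable_bound[of I "\<lambda>r. f r - f' a * r" "\<lambda>r. f' r - f' a"])
    fix z assume z: "z \<in> I"
    then have "(f has_real_derivative f' z) (at z within I)"
      using d1 I by (intro DERIV_subset[OF _ I]) auto
    then show "((\<lambda>r. f r - f' a * r) has_real_derivative f' z - f' a) (at z within I)"
      by (auto intro!: derivative_eq_intros)
    have "\<bar>f' z - f' a\<bar> \<le> B * \<bar>z - a\<bar>" using z I a by (intro lip) auto
    also have "\<dots> \<le> B * \<bar>b - a\<bar>" using z B by (intro mult_left_mono) (auto simp: I_def)
    finally show "norm (f' z - f' a) \<le> B * \<bar>b - a\<bar>" by simp
  qed (auto simp: I_def)
  then show ?thesis by (simp add: power2_eq_square algebra_simps)
qed

subsection \<open>The flow\<close>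

lemma tendsto_matrix_mult:
  fixes A B :: "'i \<Rightarrow> real ^ 'n ^ 'n"
  assumes "(A \<longlongrightarrow> a) F" "(B \<longlongrightarrow> b) F"
  shows "((\<lambda>i. A i ** B i) \<longlongrightarrow> a ** b) F"
  unfolding matrix_matrix_mult_def
  by (intro vec_tendstoI) (simp, intro tendsto_intros assms)

lemma matrix_mult_0_right: "(A :: real ^ 'n ^ 'n) ** 0 = 0"
  by (simp add: matrix_matrix_mult_def vec_eq_iff)

lemma flow_field_eq:
  fixes X :: "'a \<Rightarrow> real ^ 'n" and S :: "real ^ 'n ^ 'n" and Y :: "'a \<Rightarrow> complex"
    and k :: "real ^ 'n \<Rightarrow> real" and lam :: real
  assumes "transpose (matrix_inv (cov_matrix M X)) = matrix_inv (cov_matrix M X)" "transpose S = S"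
  defines "P \<equiv> matrix_inv (cov_matrix M X)" and "D \<equiv> DJ M X Y k lam S"
  shows "flow_field M X Y k lam S = (- 1 / 2) *\<^sub>R (S ** D ** P + P ** D ** S)"
proof -
  have Pab: "P $ a $ b = P $ b $ a" and Sab: "S $ a $ b = S $ b $ a" for a b
    using arg_cong[OF assms(1), of "\<lambda>A. A $ a $ b"] arg_cong[OF assms(2), of "\<lambda>A. A $ a $ b"]
    by (auto simp: transpose_def P_def)
  have 1: "(\<Sum>c\<in>UNIV. \<Sum>d\<in>UNIV. S $ a $ c * P $ b $ d * D $ c $ d) = (S ** D ** P) $ a $ b" for a b
  proof -
    have "(\<Sum>c\<in>UNIV. \<Sum>d\<in>UNIV. S $ a $ c * P $ b $ d * D $ c $ d) =
        (\<Sum>d\<in>UNIV. \<Sum>c\<in>UNIV. S $ a $ c * P $ b $ d * D $ c $ d)" by (rule sum.swap)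
    then show ?thesis by (simp add: matrix_matrix_mult_def sum_distrib_left sum_distrib_right Pab[of b] mult_ac)
  qed
  have 2: "(\<Sum>c\<in>UNIV. \<Sum>d\<in>UNIV. S $ b $ d * P $ a $ c * D $ c $ d) = (P ** D ** S) $ a $ b" for a b
  proof -
    have "(\<Sum>c\<in>UNIV. \<Sum>d\<in>UNIV. S $ b $ d * P $ a $ c * D $ c $ d) =
        (\<Sum>d\<in>UNIV. \<Sum>c\<in>UNIV. S $ b $ d * P $ a $ c * D $ c $ d)" by (rule sum.swap)
    then show ?thesis by (simp add: matrix_matrix_mult_def sum_distrib_left sum_distrib_right Sab[of b] mult_ac)
  qed
  show ?thesis
    unfolding flow_field_def Let_def P_def[symmetric] D_def[symmetric] 1 2
    by (simp add: vec_eq_iff)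
qed

section \<open>Stationarity and convergence along a sequence of times\<close>

context kernel_regression
begin

text \<open>At full rank S is injective, so S D = 0 gives D = 0. At lower rank the stratum is that
  of \<open>rank S\<close>, and its tangent vectors pair to 0 with D by
  \<open>tangent_space_inner_zero\<close>.\<close>

lemma stationaryI:
  assumes S: "S \<in> Sym_nonneg" and SD: "S ** D S = 0"
  shows "stationary_point M X Y kV lam S"
proof (cases "rank S < CARD('n)")
  case True
  have "Sym_stratum (rank S) \<subseteq> (Sym_nonneg :: (real ^ 'n ^ 'n) set)" by (auto simp: Sym_stratum_def)
  then have "\<forall>H \<in> tangent_space (Sym_stratum (rank S)) S. DJ M X Y kV lam S \<bullet> H = 0"
    using tangent_space_inner_zero[OF _ _ transpose_D[OF S] SD] unfolding DJ_eq_D[OF S] by blast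
  then show ?thesis
    unfolding stationary_point_def using True S
    by (intro disjI2 exI[of _ "rank S"]) (simp add: Sym_stratum_def)
next
  case False
  then have "rank S = CARD('n)" using rank_bound[of S] by simp
  then have inj: "inj ((*v) S)" by (simp add: full_rank_injective)
  have ker: "x = 0" if "S *v x = 0" for x
    using injD[OF inj, of x 0] that by simp
  have "0 < qform S x" if "x \<noteq> 0" for x
  proof -
    have "qform S x \<noteq> 0" using that ker[of x] qform_zero_imp_kernel[OF S, of x] by blast
    moreover have "0 \<le> qform S x" using S by (simp add: Sym_nonneg_def)
    ultimately show ?thesis by simp
  qed
  then have "S \<in> Sym_pos" using S by (auto simp: Sym_pos_def Sym_nonneg_def)
  moreover have "D S *v x = 0" for x
    by (rule ker) (simp add: matrix_vector_mul_assoc SD)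
  then have "D S = 0" by (simp add: matrix_eq)
  ultimately show ?thesis by (simp add: stationary_point_def DJ_eq_D[OF S])
qed

theorem flow_stationary_limit:
  fixes S :: "real \<Rightarrow> real ^ 'n ^ 'n"
  assumes cov: "cov_matrix M X \<in> Sym_pos"
    and Kc0: "(Kc \<longlongrightarrow> 0) at_top"
    and hyper: "\<And>a c. a \<noteq> 0 \<Longrightarrow> AE s in M. a \<bullet> X s \<noteq> c"
    and S: "\<And>t. 0 \<le> t \<Longrightarrow> S t \<in> Sym_nonneg"
    and dS: "\<And>t. 0 \<le> t \<Longrightarrow> (S has_vector_derivative flow_field M X Y kV lam (S t)) (at t within {0..})"
  shows "\<exists>\<tau> :: nat \<Rightarrow> real. (\<forall>i. 0 \<le> \<tau> i) \<and> filterlim \<tau> at_top sequentially \<and>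
           (\<exists>S0 \<in> Sym_nonneg. (\<lambda>i. S (\<tau> i)) \<longlonglongrightarrow> S0 \<and> stationary_point M X Y kV lam S0)"
proof -
  define P where "P = matrix_inv (cov_matrix M X)"
  have P: "P \<in> Sym_nonneg" "transpose P = P" "P ** cov_matrix M X = mat 1"
    using Sym_pos_inverse[OF cov] Sym_pos_subset by (auto simp: P_def Sym_pos_def)
  define e where "e A = D A \<bullet> (A ** D A ** P)" for A
  have e0: "0 \<le> e A" if "A \<in> Sym_nonneg" for A
    unfolding e_def by (rule dissipation_nonneg[OF that P(1)])
  have e_zero: "A ** D A = 0" if "A \<in> Sym_nonneg" "e A = 0" for A
    using dissipation_zero[OF that(1) P(1) P(3)] that(2) by (simp add: e_def)
  have flow: "flow_field M X Y kV lam A = (- 1 / 2) *\<^sub>R (A ** D A ** P + P ** D A ** A)"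
    if A: "A \<in> Sym_nonneg" for A
    using flow_field_eq[of M X A Y kV lam] P(2) A by (simp add: P_def DJ_eq_D[OF A] Sym_nonneg_def)
  define j where "j t = J (S t)" for t
  \<comment> \<open>The value is differentiable relative to the cone, so the chain rule is applied
    within the image of the curve; for t > 0 the half-line is a neighbourhood and the derivative
    becomes two-sided.\<close>
  have dj: "(j has_real_derivative - e (S t)) (at t)" if t: "0 < t" for t
  proof -
    have St: "S t \<in> Sym_nonneg" using S t by simp
    have at: "at t within {0..} = at t" using t by (intro at_within_interior) simp
    have d1: "(S has_derivative (\<lambda>h. h *\<^sub>R flow_field M X Y kV lam (S t))) (at t within {0..})"
      using dS[of t] t by (simp add: has_vector_derivative_def)
    have d2: "(J has_derivative (\<lambda>H. D (S t) \<bullet> H)) (at (S t) within S ` {0..})"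
      by (rule has_derivative_subset[OF J_has_derivative[OF St]]) (use S in auto)
    have "(j has_derivative (\<lambda>h. D (S t) \<bullet> (h *\<^sub>R flow_field M X Y kV lam (S t)))) (at t within {0..})"
      unfolding j_def by (rule has_derivative_in_compose[OF d1 d2])
    moreover have "D (S t) \<bullet> flow_field M X Y kV lam (S t) = - e (S t)"
      unfolding flow[OF St] e_def
      using dissipation_sym[OF _ P(2) transpose_D[OF St], of "S t"] St
      by (simp add: inner_add_right Sym_nonneg_def)
    ultimately show ?thesis
      unfolding at by (simp add: has_real_derivative_iff_has_vector_derivative has_vector_derivative_def)
  qed
  have j_mono: "j b \<le> j a" if "0 < a" "a \<le> b" for a b
  proof (rule DERIV_nonpos_imp_nonincreasing[OF that(2)])
    fix x assume "a \<le> x"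
    then have "0 < x" using that(1) by simp
    then show "\<exists>y. (j has_real_derivative y) (at x) \<and> y \<le> 0"
      using dj[of x] e0[OF S[of x]] by (intro exI[of _ "- e (S x)"]) auto
  qed
  show ?thesis
  proof (cases "\<exists>t0>0. j t0 < ip M Y Y / 2")
    case True
    then obtain t0 where t0: "0 < t0" "j t0 < ip M Y Y / 2" by blast
    \<comment> \<open>The mean value theorem on [i + 1, i + 2] turns the dissipation at one time
      into a decrement of the value; starting at 1 avoids the endpoint 0.\<close>
    have "\<exists>z. real i + 1 < z \<and> e (S z) = j (real i + 1) - j (real i + 2)" for i :: nat
    proof -
      have "\<exists>z. real i + 1 < z \<and> z < real i + 2 \<and>
          j (real i + 2) - j (real i + 1) = (real i + 2 - (real i + 1)) * - e (S z)"
        by (rule MVT2[of _ _ j "\<lambda>x. - e (S x)"]) (simp, rule dj, linarith)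
      then obtain z where z: "real i + 1 < z"
        "j (real i + 2) - j (real i + 1) = (real i + 2 - (real i + 1)) * - e (S z)" by blast
      from z(2) have "e (S z) = j (real i + 1) - j (real i + 2)" by simp
      with z(1) show ?thesis by blast
    qed
    then obtain \<xi> where \<xi>: "\<And>i. real i + 1 < \<xi> i"
      "\<And>i :: nat. e (S (\<xi> i)) = j (real i + 1) - j (real i + 2)"
      by metis
    define x where "x i = j (real i + 1)" for i
    \<comment> \<open>The value is nonincreasing and bounded below by 0, so its unit decrements tend
      to 0.\<close>
    have "decseq x"
      unfolding decseq_Suc_iff x_def by (auto intro!: j_mono)
    moreover have "\<forall>i. 0 \<le> x i" by (simp add: x_def j_def J_nonneg)
    ultimately obtain L where "x \<longlonglongrightarrow> L" by (rule decseq_convergent)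
    then have "(\<lambda>i. x i - x (Suc i)) \<longlonglongrightarrow> L - L"
      by (intro tendsto_diff LIMSEQ_Suc)
    moreover have "x i - x (Suc i) = e (S (\<xi> i))" for i
    proof -
      have "real (Suc i) + 1 = real i + 2" by simp
      then show ?thesis by (simp only: \<xi>(2) x_def)
    qed
    ultimately have e_lim: "(\<lambda>i. e (S (\<xi> i))) \<longlonglongrightarrow> 0" by simp
    \<comment> \<open>From index N on the sampled times exceed t0, and the forms stay in a bounded
      sublevel set.\<close>
    obtain N :: nat where N: "t0 \<le> real N" using real_arch_simple by blast
    have bdd: "bounded {A \<in> Sym_nonneg. J A \<le> j t0}"
      by (rule J_sublevel_bounded[OF Kc0 hyper t0(2)])
    have \<xi>pos: "0 < \<xi> i" "0 \<le> \<xi> i" for i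
      using \<xi>(1)[of i] of_nat_0_le_iff[of i, where 'a=real] by linarith+
    have mem: "S (\<xi> (i + N)) \<in> {A \<in> Sym_nonneg. J A \<le> j t0}" for i
    proof -
      have "t0 \<le> \<xi> (i + N)" using \<xi>(1)[of "i + N"] N by simp
      then have "j (\<xi> (i + N)) \<le> j t0" by (rule j_mono[OF t0(1)])
      then show ?thesis using S[OF \<xi>pos(2)] by (simp add: j_def)
    qed
    have "compact (closure {A \<in> Sym_nonneg. J A \<le> j t0})" using bdd by simp
    then have sc: "seq_compact (closure {A \<in> Sym_nonneg. J A \<le> j t0})"
      by (rule compact_imp_seq_compact)
    have "\<forall>i. S (\<xi> (i + N)) \<in> closure {A \<in> Sym_nonneg. J A \<le> j t0}"
      by (intro allI subsetD[OF closure_subset] mem)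
    from seq_compactE[OF sc this]
    obtain S0 r where S0: "strict_mono r" "((\<lambda>i. S (\<xi> (i + N))) \<circ> r) \<longlonglongrightarrow> S0"
      by metis
    define \<tau> where "\<tau> i = \<xi> (r i + N)" for i
    have lim: "(\<lambda>i. S (\<tau> i)) \<longlonglongrightarrow> S0" using S0(2) by (simp add: \<tau>_def o_def)
    have \<tau>S: "S (\<tau> i) \<in> Sym_nonneg" for i unfolding \<tau>_def by (rule S[OF \<xi>pos(2)])
    have S0n: "S0 \<in> Sym_nonneg"
      by (rule closed_sequentially[OF closed_Sym_nonneg _ lim]) (use \<tau>S in auto)
    have \<tau>inf: "filterlim \<tau> at_top sequentially"
    proof (rule filterlim_at_top_mono[OF filterlim_real_sequentially])
      have "real i \<le> \<tau> i" for i
        using \<xi>(1)[of "r i + N"] seq_suble[OF S0(1), of i] unfolding \<tau>_def by linarith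
      then show "eventually (\<lambda>i. real i \<le> \<tau> i) sequentially" by simp
    qed
    have Dlim: "(\<lambda>i. D (S (\<tau> i))) \<longlonglongrightarrow> D S0"
    proof (rule LIM_zero_cancel, rule Lim_null_comparison)
      show "eventually (\<lambda>i. norm (D (S (\<tau> i)) - D S0) \<le> LipG * norm (S (\<tau> i) - S0)) sequentially"
        by (intro always_eventually allI D_lipschitz S0n \<tau>S)
      have "(\<lambda>i. LipG * norm (S (\<tau> i) - S0)) \<longlonglongrightarrow> LipG * norm (S0 - S0)"
        by (intro tendsto_intros lim)
      then show "(\<lambda>i. LipG * norm (S (\<tau> i) - S0)) \<longlonglongrightarrow> 0" by simp
    qed
    \<comment> \<open>The Lipschitz bound for D makes the dissipation continuous on the whole cone,
      also where the rank drops in the limit.\<close>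
    have "(\<lambda>i. e (S (\<tau> i))) \<longlonglongrightarrow> e S0"
      unfolding e_def by (intro tendsto_inner tendsto_matrix_mult Dlim lim tendsto_const)
    moreover have "(\<lambda>i. e (S (\<tau> i))) \<longlonglongrightarrow> 0"
    proof -
      have "strict_mono (\<lambda>i. r i + N)" using S0(1) by (auto simp: strict_mono_def)
      from LIMSEQ_subseq_LIMSEQ[OF e_lim this] show ?thesis by (simp add: \<tau>_def o_def)
    qed
    ultimately have "e S0 = 0" by (rule LIMSEQ_unique)
    then have "stationary_point M X Y kV lam S0"
      using stationaryI[OF S0n e_zero[OF S0n]] by simp
    then show ?thesis
      using \<tau>inf lim S0n \<xi>pos(2) by (intro exI[of _ \<tau>]) (auto simp: \<tau>_def)
  next
    case False
    \<comment> \<open>The competitor f = 0 bounds the value from above, so in this case the bound is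
      attained at all positive times.\<close>
    have jc: "j t = ip M Y Y / 2" if "0 < t" for t
    proof (rule antisym)
      show "j t \<le> ip M Y Y / 2" unfolding j_def by (rule J_le)
      show "ip M Y Y / 2 \<le> j t" using False that not_less by blast
    qed
    have SD: "S t ** D (S t) = 0" if t: "0 < t" for t
    proof -
      have "((\<lambda>_. ip M Y Y / 2) has_real_derivative - e (S t)) (at t)"
      proof (rule has_field_derivative_transform_within[OF dj[OF t] t])
        fix u assume "dist u t < t"
        then have "0 < u" unfolding dist_real_def by linarith
        then show "j u = ip M Y Y / 2" by (rule jc)
      qed simp
      from DERIV_unique[OF this DERIV_const] have "e (S t) = 0" by simp
      then show ?thesis using e_zero S t by simp
    qed
    \<comment> \<open>The vanishing product of the form with its gradient, together with its
      transpose, kills both halves of the flow field.\<close>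
    have "(S has_vector_derivative 0) (at t within {1..})" if t: "t \<in> {1..}" for t
    proof -
      have St: "S t \<in> Sym_nonneg" using S t by simp
      have SD': "S t ** D (S t) = 0" using SD t by simp
      have "D (S t) ** S t = transpose (S t ** D (S t))"
        using transpose_D[OF St] St by (simp add: matrix_transpose_mul Sym_nonneg_def)
      also have "\<dots> = 0" unfolding SD' by (simp add: transpose_def vec_eq_iff)
      finally have "D (S t) ** S t = 0" .
      then have "flow_field M X Y kV lam (S t) = 0"
        unfolding flow[OF St] SD' by (simp add: matrix_mul_assoc[symmetric] matrix_mult_0_right)
      then show ?thesis
        using has_vector_derivative_within_subset[OF dS[of t], of "{1..}"] t by auto
    qed
    then obtain c where c: "\<And>t. t \<in> {1..} \<Longrightarrow> S t = c"
      using has_vector_derivative_zero_constant[of "{1..}" S] by auto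
    define \<tau> where "\<tau> i = real i + 1" for i :: nat
    have "filterlim \<tau> at_top sequentially"
      unfolding \<tau>_def by (intro filterlim_at_top_mono[OF filterlim_real_sequentially]) auto
    moreover have "(\<lambda>i. S (\<tau> i)) \<longlonglongrightarrow> S 1" using c by (simp add: \<tau>_def)
    moreover have "stationary_point M X Y kV lam (S 1)"
      using SD[of 1] S[of 1] by (intro stationaryI) auto
    ultimately show ?thesis
      using S[of 1] by (intro exI[of _ \<tau>]) (auto simp: \<tau>_def)
  qed
qed

end

section \<open>Verification of the standing assumptions\<close>

theorem theorem1p3:
  fixes M :: "'a measure" and X :: "'a \<Rightarrow> real ^ 'n" and Y :: "'a \<Rightarrow> complex"
    and kV :: "real ^ 'n \<Rightarrow> real" and lam :: real
    and Kc Kc' Kc'' :: "real \<Rightarrow> real"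
    and S :: "real \<Rightarrow> real ^ 'n ^ 'n"
  assumes "prob_space M"
    and "X \<in> borel_measurable M" and "Y \<in> borel_measurable M"
    and "0 < lam"
    and "integrable M (\<lambda>s. (cmod (Y s))\<^sup>2)"
    and "integrable M (\<lambda>s. norm (X s) ^ 8)"
    and "\<exists>p. distributed M lborel X p"
    and "\<forall>w. 0 < kV w"
    and "\<exists>\<kappa>. \<forall>w. kV w = \<kappa> (V_dual_normsq M X w)"
    and "integrable lborel kV" and "(LINT w|lborel. kV w) = 1"
    and "\<forall>x. kernel_fun kV x = complex_of_real (Kc (V_normsq M X x))"
    and "\<forall>r\<ge>0. (Kc has_real_derivative Kc' r) (at r within {0..})"
    and "\<forall>r\<ge>0. (Kc' has_real_derivative Kc'' r) (at r within {0..})"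
    and "continuous_on {0..} Kc'" and "bounded (Kc' ` {0..})"
    and "continuous_on {0..} Kc''" and "bounded (Kc'' ` {0..})"
    and "\<exists>R B. \<forall>r\<ge>R. \<bar>r * Kc' r\<bar> \<le> B"
    and "\<forall>t\<ge>0. S t \<in> Sym_nonneg"
    and "\<forall>t\<ge>0. (S has_vector_derivative flow_field M X Y kV lam (S t)) (at t within {0..})"
  shows "\<exists>\<tau> :: nat \<Rightarrow> real. (\<forall>i. 0 \<le> \<tau> i) \<and> filterlim \<tau> at_top sequentially \<and>
           (\<exists>S0 \<in> Sym_nonneg. (\<lambda>i. S (\<tau> i)) \<longlonglongrightarrow> S0 \<and> stationary_point M X Y kV lam S0)"
proof -
  have hyper: "AE s in M. a \<bullet> X s \<noteq> c" if "a \<noteq> 0" for a c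
    using assms(7) distributed_AE_not_hyperplane[OF _ that] by blast
  have cov: "cov_matrix M X \<in> Sym_pos"
    by (rule cov_matrix_Sym_pos[OF assms(1,2,6) hyper])
  obtain B1 where B1: "\<And>r. 0 \<le> r \<Longrightarrow> \<bar>Kc' r\<bar> \<le> B1"
    using assms(16) by (auto simp: bounded_iff)
  obtain B2 where B2: "\<And>r. 0 \<le> r \<Longrightarrow> \<bar>Kc'' r\<bar> \<le> B2"
    using assms(18) by (auto simp: bounded_iff)
  have B0: "0 \<le> B1" "0 \<le> B2" using B1[of 0] B2[of 0] by auto
  have lip: "\<bar>Kc' b - Kc' a\<bar> \<le> B2 * \<bar>b - a\<bar>" if "0 \<le> a" "0 \<le> b" for a b
    by (rule lipschitz_of_derivative[OF assms(14) B2 that])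
  have "kernel_regression M X Y kV lam Kc Kc' B1 B2"
  proof (intro kernel_regression.intro kernel_regression_axioms.intro)
    show "\<bar>Kc b - Kc a\<bar> \<le> B1 * \<bar>b - a\<bar>" if "0 \<le> a" "0 \<le> b" for a b
      by (rule lipschitz_of_derivative[OF assms(13) B1 that])
    show "\<bar>Kc b - Kc a - Kc' a * (b - a)\<bar> \<le> B2 * (b - a)\<^sup>2" if "0 \<le> a" "0 \<le> b" for a b
      by (rule taylor_of_derivative[OF assms(13) lip B0(2) that])
    show "\<exists>U. \<forall>x. qform A x = V_normsq M X (U *v x)" if "A \<in> Sym_nonneg" for A :: "real ^ 'n ^ 'n"
      unfolding V_normsq_def by (rule Sym_nonneg_factor[OF cov that])
  qed (use assms B1 B0 lip in \<open>auto simp: L2_def\<close>)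
  then interpret kernel_regression M X Y kV lam Kc Kc' B1 B2 .
  \<comment> \<open>Any unit vector will do; the index of the axis is immaterial.\<close>
  define b :: "real ^ 'n" where "b = axis undefined 1"
  have b: "norm b = 1" by (simp add: b_def)
  have "b \<noteq> 0" using b by auto
  then have "0 < V_normsq M X b"
    using Sym_pos_inverse(3)[OF cov] by (simp add: V_normsq_def Sym_pos_def)
  moreover have "V_normsq M X (t *\<^sub>R x) = t\<^sup>2 * V_normsq M X x" for t x
    by (simp add: V_normsq_def qform_def matrix_vector_mult_scaleR power2_eq_square)
  ultimately have Kc0: "(Kc \<longlongrightarrow> 0) at_top"
    using assms(10,12) b by (intro profile_tendsto_0[of kV Kc "V_normsq M X" b]) auto
  show ?thesis
    by (rule flow_stationary_limit[OF cov Kc0 hyper]) (use assms(20,21) in auto)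
qed

end
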